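(* Let $d\ge2$, $N\ge1$, and let $\Gamma$ be the graph obtained from the lattice graph $\mathbb L^d$ by adding $N$ vertices on each edge of $\mathbb L^d$. Then the fundamental graph $\Gamma_f$ has $\nu=dN+1$ vertices and the spectrum of the Laplacian on $\Gamma$ has the form $$\sigma(\Delta)=\sigma_{ac}(\Delta)\cup\sigma_{fb}(\Delta),\qquad \sigma_{fb}(\Delta)=\Big\{2+2\cos\frac{\pi n}{N+1}\ :\ n=1,\ldots,N\Big\},$$ where the absolutely continuous part $\sigma_{ac}(\Delta)$ consists of $N+1$ open (i.e. non-degenerate) spectral bands $\mathfrak S_1^0,\ldots,\mathfrak S_{N+1}^0$, and each flat band has multiplicity $d-1$ and is an endpoint of a spectral band.
   Context: The lattice $\mathbb L^d$ has vertex set $\mathbb Z^d$ and edges $(m,m+a_s)$, $m\in\mathbb Z^d$, $s=1,\ldots,d$, with $a_1,\ldots,a_d$ the standard basis of $\mathbb R^d$. Adding $N$ vertices on an edge means subdividing it into a path with $N$ interior vertices (each of degree 2); this is done $\mathbb Z^d$-periodically, so $\Gamma=(V,\mathcal E)$ is invariant under translations by $\mathbb Z^d$. The fundamental graph is $\Gamma_f=\Gamma/\mathbb Z^d$ with vertices $\{v_1,\ldots,v_\nu\}=V\cap[0,1)^d$; $\mathcal A_f$ is its set of oriented edges (each unoriented edge gives two oriented ones). Writing $v=[v]+\tilde v$ with $[v]\in\mathbb Z^d$, $\tilde v\in[0,1)^d$, the index of an oriented edge $\mathbf e=(u,v)$ of $\Gamma$ (and of its class in $\mathcal A_f$) is $\tau(\mathbf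 e)=[v]-[u]$. The Laplacian on $\ell^2(V)$ is $(\Delta f)(v)=\sum_{(v,u)_e\in\mathcal E}(f(v)-f(u))$. Its Floquet matrices, for $\vartheta\in\mathbb T^d=\mathbb R^d/(2\pi\mathbb Z)^d$, are $\Delta_{jk}(\vartheta)=\varkappa_j\delta_{jk}-\sum_{\mathbf e=(v_j,v_k)\in\mathcal A_f}e^{i\langle\tau(\mathbf e),\vartheta\rangle}$, $\varkappa_j=\deg v_j$. $\sigma_{ac}(\Delta)$ is the absolutely continuous spectrum and $\sigma_{fb}(\Delta)$ is the set of flat bands, i.e. eigenvalues of $\Delta$ of infinite multiplicity. A flat band $\mu$ has multiplicity $m$ if $\mu$ is an eigenvalue of $\Delta(\vartheta)$ of multiplicity $m$ for every $\vartheta\in\mathbb T^d$, except maybe for a finite number of $\vartheta$. If $\Delta$ has $r$ flat bands (with multiplicity), remove the corresponding $r$ constant eigenvalues from the spectrum of $\Delta(\vartheta)$ and enumerate the remaining ones, none of which is constant, as $\Lambda_1^0(\vartheta)\le\ldots\le\Lambda_{\nu-r}^0(\vartheta)$; the (open, i.e. non-degenerate) spectral bands are the intervals $\mathfrak S_n^0=\Lambda_n^0(\mathbb T^d)$, $n=1,\ldots,\nu-r$. *)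

theory Defs
  imports
    "Jordan_Normal_Form.Char_Poly"
    "HOL-Analysis.Analysis"
    "HOL-Library.Function_Algebras"
begin

no_notation vec_index (infixl "$" 100)

section \<open>Operators on square-summable functions\<close>

text \<open>Functions on a vertex set \<open>V\<close> are represented by total functions vanishing off \<open>V\<close>.\<close>

definition ell2 :: "'a set \<Rightarrow> ('a \<Rightarrow> complex) set" where
  "ell2 V = {f. (\<forall>x. x \<notin> V \<longrightarrow> f x = 0) \<and> (\<lambda>x. (cmod (f x))\<^sup>2) summable_on V}"

definition ell2_inner :: "'a set \<Rightarrow> ('a \<Rightarrow> complex) \<Rightarrow> ('a \<Rightarrow> complex) \<Rightarrow> complex" where
  "ell2_inner V f g = (\<Sum>\<^sub>\<infinity>x\<in>V. f x * cnj (g x))"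

definition ell2_norm :: "'a set \<Rightarrow> ('a \<Rightarrow> complex) \<Rightarrow> real" where
  "ell2_norm V f = sqrt (\<Sum>\<^sub>\<infinity>x\<in>V. (cmod (f x))\<^sup>2)"

text \<open>Spectrum of the restriction of a linear operator \<open>A\<close> to an invariant subspace \<open>S\<close> of
  \<open>ell2 V\<close>: the complement of the set of \<open>z\<close> for which \<open>A - z\<close> is a bijection of \<open>S\<close> with
  bounded inverse.\<close>

definition spectrum_on ::
    "'a set \<Rightarrow> ('a \<Rightarrow> complex) set \<Rightarrow> (('a \<Rightarrow> complex) \<Rightarrow> 'a \<Rightarrow> complex) \<Rightarrow> complex set" where
  "spectrum_on V S A =
     {z. \<not> (bij_betw (\<lambda>f x. A f x - z * f x) S S \<and>
            (\<exists>C. \<forall>f\<in>S. ell2_norm V f \<le> C * ell2_norm V (\<lambda>x. A f x - z * f x)))}"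

definition op_spectrum :: "'a set \<Rightarrow> (('a \<Rightarrow> complex) \<Rightarrow> 'a \<Rightarrow> complex) \<Rightarrow> complex set" where
  "op_spectrum V A = spectrum_on V (ell2 V) A"

text \<open>The spectral measure of a vector \<open>f\<close> with respect to a bounded self-adjoint operator \<open>A\<close>:
  the compactly supported finite Borel measure \<open>M\<close> on the real line with
  \<open>\<langle>p(A) f, f\<rangle> = \<integral> p dM\<close> for all polynomials \<open>p\<close> (by linearity, monomials suffice). By the
  spectral theorem it exists and is unique.\<close>

definition is_spectral_measure ::
    "'a set \<Rightarrow> (('a \<Rightarrow> complex) \<Rightarrow> 'a \<Rightarrow> complex) \<Rightarrow> ('a \<Rightarrow> complex) \<Rightarrow> real measure \<Rightarrow> bool" where
  "is_spectral_measure V A f M \<longleftrightarrow>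
     sets M = sets borel \<and> finite_measure M \<and> (\<exists>C. AE x in M. \<bar>x\<bar> \<le> C) \<and>
     (\<forall>n. ell2_inner V ((A ^^ n) f) f = complex_of_real (\<integral>x. x ^ n \<partial>M))"

definition ac_subspace ::
    "'a set \<Rightarrow> (('a \<Rightarrow> complex) \<Rightarrow> 'a \<Rightarrow> complex) \<Rightarrow> ('a \<Rightarrow> complex) set" where
  "ac_subspace V A =
     {f \<in> ell2 V. \<exists>M. is_spectral_measure V A f M \<and> absolutely_continuous lborel M}"

definition ac_spectrum :: "'a set \<Rightarrow> (('a \<Rightarrow> complex) \<Rightarrow> 'a \<Rightarrow> complex) \<Rightarrow> complex set" where
  "ac_spectrum V A = spectrum_on V (ac_subspace V A) A"

definition eigenspace ::
    "'a set \<Rightarrow> (('a \<Rightarrow> complex) \<Rightarrow> 'a \<Rightarrow> complex) \<Rightarrow> complex \<Rightarrow> ('a \<Rightarrow> complex) set" where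
  "eigenspace V A z = {f \<in> ell2 V. A f = (\<lambda>x. z * f x)}"

definition flat_bands :: "'a set \<Rightarrow> (('a \<Rightarrow> complex) \<Rightarrow> 'a \<Rightarrow> complex) \<Rightarrow> complex set" where
  "flat_bands V A =
     {z. \<exists>B \<subseteq> eigenspace V A z. infinite B \<and> \<not> module.dependent (\<lambda>c f x. c * f x) B}"


section \<open>Periodic graphs in Euclidean space\<close>

text \<open>A graph consists of a set \<open>V\<close> of points and a set \<open>E\<close> of unoriented edges, each edge being
  the set of its two end points. The graphs considered here have no loops or multiple edges;
  their quotients by translations may well have multiple edges.\<close>

definition laplacian :: "'a set set \<Rightarrow> ('a \<Rightarrow> complex) \<Rightarrow> 'a \<Rightarrow> complex" where
  "laplacian E f v = (\<Sum>u | {v, u} \<in> E. f v - f u)"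

definition graph_degree :: "'a set set \<Rightarrow> 'a \<Rightarrow> nat" where
  "graph_degree E v = card {u. {v, u} \<in> E}"

definition oriented_edges :: "'a set set \<Rightarrow> ('a \<times> 'a) set" where
  "oriented_edges E = {(u, v). {u, v} \<in> E}"

definition int_points :: "(real ^ 'd) set" where
  "int_points = {m. \<forall>i. m $ i \<in> \<int>}"

definition int_part :: "(real ^ 'd) \<Rightarrow> (real ^ 'd)" where
  "int_part v = (\<chi> i. of_int \<lfloor>v $ i\<rfloor>)"

definition frac_part :: "(real ^ 'd) \<Rightarrow> (real ^ 'd)" where
  "frac_part v = v - int_part v"

definition fund_verts :: "(real ^ 'd) set \<Rightarrow> (real ^ 'd) set" where
  "fund_verts V = V \<inter> {x. \<forall>i. 0 \<le> x $ i \<and> x $ i < 1}"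

definition translation_rel :: "(((real ^ 'd) \<times> (real ^ 'd)) \<times> ((real ^ 'd) \<times> (real ^ 'd))) set" where
  "translation_rel = {((u, v), (u + m, v + m)) | u v m. m \<in> int_points}"

definition fund_edges :: "(real ^ 'd) set set \<Rightarrow> ((real ^ 'd) \<times> (real ^ 'd)) set set" where
  "fund_edges E = oriented_edges E // translation_rel"

definition fund_edges_between ::
    "(real ^ 'd) set set \<Rightarrow> (real ^ 'd) \<Rightarrow> (real ^ 'd) \<Rightarrow> ((real ^ 'd) \<times> (real ^ 'd)) set set" where
  "fund_edges_between E a b =
     {c \<in> fund_edges E. \<exists>(u, v) \<in> c. frac_part u = a \<and> frac_part v = b}"

definition edge_index :: "(real ^ 'd) \<times> (real ^ 'd) \<Rightarrow> (real ^ 'd)" where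
  "edge_index e = int_part (snd e) - int_part (fst e)"

text \<open>The index is constant on each class of oriented edges modulo translations.\<close>

definition class_index :: "((real ^ 'd) \<times> (real ^ 'd)) set \<Rightarrow> (real ^ 'd)" where
  "class_index c = the_elem (edge_index ` c)"


section \<open>Floquet matrices and bands\<close>

text \<open>The torus is represented by a set of representatives of its points. In the following, \<open>vs\<close>
  is an enumeration of the vertices of the fundamental graph.\<close>

definition torus :: "(real ^ 'd) set" where
  "torus = {\<theta>. \<forall>i. 0 \<le> \<theta> $ i \<and> \<theta> $ i < 2 * pi}"

definition floquet ::
    "(real ^ 'd::finite) set set \<Rightarrow> (real ^ 'd) list \<Rightarrow> (real ^ 'd) \<Rightarrow> complex Matrix.mat" where
  "floquet E vs \<theta> = Matrix.mat (length vs) (length vs) (\<lambda>(j, k).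
     (if j = k then of_nat (graph_degree E (vs ! j)) else 0) -
     (\<Sum>c \<in> fund_edges_between E (vs ! j) (vs ! k). exp (\<i> * of_real (inner (class_index c) \<theta>))))"

definition floquet_eigenvalues ::
    "(real ^ 'd::finite) set set \<Rightarrow> (real ^ 'd) list \<Rightarrow> (real ^ 'd) \<Rightarrow> complex multiset" where
  "floquet_eigenvalues E vs \<theta> = proots (char_poly (floquet E vs \<theta>))"

definition has_flat_multiplicity ::
    "(real ^ 'd::finite) set set \<Rightarrow> (real ^ 'd) list \<Rightarrow> complex \<Rightarrow> nat \<Rightarrow> bool" where
  "has_flat_multiplicity E vs \<mu> m \<longleftrightarrow>
     finite {\<theta> \<in> torus. count (floquet_eigenvalues E vs \<theta>) \<mu> \<noteq> m}"

definition flat_band_mset ::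
    "(real ^ 'd::finite) set \<Rightarrow> (real ^ 'd) set set \<Rightarrow> (real ^ 'd) list \<Rightarrow> complex multiset" where
  "flat_band_mset V E vs =
     (\<Sum>\<mu> \<in> flat_bands V (laplacian E). replicate_mset (THE m. has_flat_multiplicity E vs \<mu> m) \<mu>)"

definition num_bands ::
    "(real ^ 'd::finite) set \<Rightarrow> (real ^ 'd) set set \<Rightarrow> (real ^ 'd) list \<Rightarrow> nat" where
  "num_bands V E vs = card (fund_verts V) - size (flat_band_mset V E vs)"

text \<open>The \<open>n\<close>-th (\<open>n = 1, 2, \<dots>\<close>) non-constant eigenvalue, in increasing order. Floquet matrices are
  Hermitian, so taking real parts loses no information.\<close>

definition band_function ::
    "(real ^ 'd::finite) set \<Rightarrow> (real ^ 'd) set set \<Rightarrow> (real ^ 'd) list \<Rightarrow> nat \<Rightarrow> (real ^ 'd) \<Rightarrow> real" where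
  "band_function V E vs n \<theta> =
     sorted_list_of_multiset (image_mset Re (floquet_eigenvalues E vs \<theta> - flat_band_mset V E vs))
       ! (n - 1)"

definition spectral_band ::
    "(real ^ 'd::finite) set \<Rightarrow> (real ^ 'd) set set \<Rightarrow> (real ^ 'd) list \<Rightarrow> nat \<Rightarrow> real set" where
  "spectral_band V E vs n = band_function V E vs n ` torus"


section \<open>Subdivided lattices\<close>

text \<open>The vertices \<open>m + t s j a\<^sub>s\<close> for \<open>j = 1, \<dots>, N\<close> are those added on the edge from \<open>m\<close> to
  \<open>m + a\<^sub>s\<close>; the parameters \<open>t s j\<close> determine their positions, which do not depend on \<open>m\<close>.\<close>

definition edge_parameters :: "nat \<Rightarrow> ('d \<Rightarrow> nat \<Rightarrow> real) \<Rightarrow> bool" where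
  "edge_parameters N t \<longleftrightarrow>
     (\<forall>s. t s 0 = 0 \<and> t s (N + 1) = 1 \<and> strict_mono_on {0..N + 1} (t s))"

definition edge_point :: "('d::finite \<Rightarrow> nat \<Rightarrow> real) \<Rightarrow> (real ^ 'd) \<Rightarrow> 'd \<Rightarrow> nat \<Rightarrow> (real ^ 'd)" where
  "edge_point t m s j = m + t s j *\<^sub>R axis s 1"

definition subdiv_verts :: "nat \<Rightarrow> ('d::finite \<Rightarrow> nat \<Rightarrow> real) \<Rightarrow> (real ^ 'd) set" where
  "subdiv_verts N t = {edge_point t m s j | m s j. m \<in> int_points \<and> j \<le> N + 1}"

definition subdiv_edges :: "nat \<Rightarrow> ('d::finite \<Rightarrow> nat \<Rightarrow> real) \<Rightarrow> (real ^ 'd) set set" where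
  "subdiv_edges N t =
     {{edge_point t m s j, edge_point t m s (j + 1)} | m s j. m \<in> int_points \<and> j \<le> N}"

end

theory Submission
  imports Defs "HOL-Probability.Probability"
begin

text \<open>
  Unless \<open>x\<close> is a Dirichlet eigenvalue of a subdivided edge, i.e. a root of the Chebyshev polynomial
  \<open>U = cheb (N + 1)\<close>, a solution of \<open>\<Delta> f = x f\<close> is determined by its values at the lattice points, and
  eliminating the added vertices turns the equation into \<open>A f = D(x) f\<close>, where \<open>A\<close> is the adjacency
  operator of the lattice and \<open>D\<close> a polynomial of degree \<open>N + 1\<close>, the discriminant. Hence the spectrum is
  \<open>D\<^sup>-\<^sup>1 [-2d, 2d]\<close>. On the range of \<open>U(\<Delta>)\<close> the operator \<open>D(\<Delta>)\<close> equals \<open>A\<close>, whose spectral measures are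
  absolutely continuous by Fourier transform; the roots of \<open>U\<close> are eigenvalues, with eigenfunctions
  supported on the boundary of a unit square. At such a root \<open>D = \<plusminus>2d\<close>, while \<open>D' \<noteq> 0\<close> because \<open>d \<ge> 2\<close>, so
  that a gap opens above it: the \<open>N + 1\<close> bands are disjoint and the upper ends of the \<open>N\<close> lower ones are the roots of \<open>U\<close>.
  The same elimination, as a column operation, gives the characteristic polynomial of \<open>\<Delta>(\<theta>)\<close>, which up
  to sign is \<open>U ^ (d - 1)\<close> times \<open>D - (\<Sum>s. 2 cos \<theta>\<^sub>s)\<close>.
\<close>

section \<open>Square-summable functions\<close>

text \<open>The absolutely continuous subspace is given only through moments of spectral measures:
  it is not known beforehand to be a closed subspace, nor to be invariant under the resolvent. So
  the argument is run with polynomials of a bounded symmetric operator. Spectral measures come from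
  the Hausdorff moment problem; the measure of \<open>(A - z) f\<close> is that of f with the
  density |x - z|^2, and dividing by this density handles the inverse. A lower bound for A - z
  therefore settles both spectra at once. Conversely, a point lies in either spectrum as soon as no
  lower bound holds on absolutely continuous vectors, and enough of these are the U(\<Delta>) f with
  f of finite support. The same vectors exclude eigenvalues other than the roots of U, since an
  eigenvector is orthogonal to U(\<Delta>) applied to any point mass. The factor U replaces a
  division by U(x): identities hold after multiplication by U, so the roots of U need a limiting
  argument, by nearby points of a band for the spectrum and by comparison at infinitely many points
  for characteristic polynomials.\<close>

lemma ell2D: "f \<in> ell2 V \<Longrightarrow> x \<notin> V \<Longrightarrow> f x = 0"
  by (simp add: ell2_def)

lemma ell2_summable: "f \<in> ell2 V \<Longrightarrow> (\<lambda>x. (cmod (f x))\<^sup>2) summable_on V"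
  by (simp add: ell2_def)

lemma ell2_norm_nonneg [simp]: "ell2_norm V f \<ge> 0"
  by (simp add: ell2_norm_def infsum_nonneg)

lemma ell2_norm_power2: "(ell2_norm V f)\<^sup>2 = (\<Sum>\<^sub>\<infinity>x\<in>V. (cmod (f x))\<^sup>2)"
  by (simp add: ell2_norm_def infsum_nonneg)

lemma L2_set_le_ell2_norm:
  assumes "f \<in> ell2 V" "finite X" "X \<subseteq> V"
  shows "L2_set (\<lambda>x. cmod (f x)) X \<le> ell2_norm V f"
  unfolding L2_set_def ell2_norm_def
  using finite_sum_le_infsum[OF ell2_summable[OF assms(1)] assms(2,3)] by simp

text \<open>Bounds on finite sections yield summability and the norm estimate together; this is how
  sums and operators are bounded before their values are known to be square-summable.\<close>

lemma ell2_boundI: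
  assumes "\<And>x. x \<notin> V \<Longrightarrow> f x = 0"
    and b: "\<And>X. finite X \<Longrightarrow> X \<subseteq> V \<Longrightarrow> L2_set (\<lambda>x. cmod (f x)) X \<le> C"
  shows "f \<in> ell2 V" and "ell2_norm V f \<le> C"
proof -
  have C: "C \<ge> 0"
    using b[of "{}"] by simp
  have le: "(\<Sum>x\<in>X. (cmod (f x))\<^sup>2) \<le> C\<^sup>2" if "finite X" "X \<subseteq> V" for X
  proof -
    have "(\<Sum>x\<in>X. (cmod (f x))\<^sup>2) = (L2_set (\<lambda>x. cmod (f x)) X)\<^sup>2"
      by (simp add: L2_set_def sum_nonneg)
    also have "\<dots> \<le> C\<^sup>2"
      using b[OF that] by (intro power_mono) auto
    finally show ?thesis .
  qed
  have s: "(\<lambda>x. (cmod (f x))\<^sup>2) summable_on V"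
    by (rule nonneg_bdd_above_summable_on) (auto intro!: bdd_aboveI2[where M="C\<^sup>2"] le)
  then show "f \<in> ell2 V"
    using assms(1) by (simp add: ell2_def)
  have "(\<Sum>\<^sub>\<infinity>x\<in>V. (cmod (f x))\<^sup>2) \<le> C\<^sup>2"
    by (rule infsum_le_finite_sums[OF s le])
  then show "ell2_norm V f \<le> C"
    unfolding ell2_norm_def using C real_le_lsqrt by blast
qed

lemma norm_le_ell2_norm:
  assumes "f \<in> ell2 V" shows "cmod (f x) \<le> ell2_norm V f"
proof (cases "x \<in> V")
  case True
  then show ?thesis
    using L2_set_le_ell2_norm[OF assms, of "{x}"] by simp
qed (use assms in \<open>simp add: ell2D\<close>)

lemma
  assumes "f \<in> ell2 V" "g \<in> ell2 V"
  shows ell2_add: "(\<lambda>x. f x + g x) \<in> ell2 V"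
    and ell2_norm_add: "ell2_norm V (\<lambda>x. f x + g x) \<le> ell2_norm V f + ell2_norm V g"
proof -
  have b: "L2_set (\<lambda>x. cmod (f x + g x)) X \<le> ell2_norm V f + ell2_norm V g"
    if "finite X" "X \<subseteq> V" for X
  proof -
    have "L2_set (\<lambda>x. cmod (f x + g x)) X \<le> L2_set (\<lambda>x. cmod (f x) + cmod (g x)) X"
      by (intro L2_set_mono) (auto intro: norm_triangle_ineq)
    also have "\<dots> \<le> L2_set (\<lambda>x. cmod (f x)) X + L2_set (\<lambda>x. cmod (g x)) X"
      by (rule L2_set_triangle_ineq)
    also have "\<dots> \<le> ell2_norm V f + ell2_norm V g"
      using L2_set_le_ell2_norm[OF _ that] assms by (intro add_mono) auto
    finally show ?thesis .
  qed
  show "(\<lambda>x. f x + g x) \<in> ell2 V"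
    by (rule ell2_boundI(1)[OF _ b]) (use assms in \<open>simp_all add: ell2D\<close>)
  show "ell2_norm V (\<lambda>x. f x + g x) \<le> ell2_norm V f + ell2_norm V g"
    by (rule ell2_boundI(2)[OF _ b]) (use assms in \<open>simp_all add: ell2D\<close>)
qed

lemma ell2_norm_scale: "ell2_norm V (\<lambda>x. a * f x) = cmod a * ell2_norm V f"
  by (simp add: ell2_norm_def norm_mult power_mult_distrib infsum_cmult_right' real_sqrt_mult)

lemma ell2_scale: "f \<in> ell2 V \<Longrightarrow> (\<lambda>x. a * f x) \<in> ell2 V"
  by (auto simp: ell2_def norm_mult power_mult_distrib intro: summable_on_cmult_right)

lemma ell2_norm_minus: "ell2_norm V (\<lambda>x. f x - g x) = ell2_norm V (\<lambda>x. g x - f x)"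
  by (simp add: ell2_norm_def norm_minus_commute)

lemma ell2_lincomb:
  "f \<in> ell2 V \<Longrightarrow> g \<in> ell2 V \<Longrightarrow> (\<lambda>x. a * f x + b * g x) \<in> ell2 V"
  by (intro ell2_add ell2_scale)

lemma ell2_diff: "f \<in> ell2 V \<Longrightarrow> g \<in> ell2 V \<Longrightarrow> (\<lambda>x. f x - g x) \<in> ell2 V"
  using ell2_lincomb[of f V g 1 "-1"] by simp

lemma ell2_norm_diff:
  assumes "f \<in> ell2 V" "g \<in> ell2 V"
  shows "ell2_norm V (\<lambda>x. f x - g x) \<le> ell2_norm V f + ell2_norm V g"
  using ell2_norm_add[OF assms(1) ell2_scale[OF assms(2), of "-1"]] ell2_norm_scale[of V "-1" g] by simp

lemma ell2_norm_diff_ge: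
  assumes "f \<in> ell2 V" "g \<in> ell2 V"
  shows "ell2_norm V f - ell2_norm V g \<le> ell2_norm V (\<lambda>x. f x - g x)"
  using ell2_norm_add[OF ell2_diff[OF assms] assms(2)] by simp

lemma ell2_zero [simp]: "(\<lambda>x. 0) \<in> ell2 V"
  by (simp add: ell2_def)

lemma ell2_norm_zero [simp]: "ell2_norm V (\<lambda>x. 0) = 0"
  by (simp add: ell2_norm_def)

lemma ell2_norm_eq_0: "f \<in> ell2 V \<Longrightarrow> ell2_norm V f = 0 \<Longrightarrow> f = (\<lambda>x. 0)"
  using norm_le_ell2_norm[of f V] by (auto intro!: ext)

lemma
  assumes "\<And>i. i \<in> I \<Longrightarrow> f i \<in> ell2 V"
  shows ell2_sum: "(\<lambda>x. \<Sum>i\<in>I. f i x) \<in> ell2 V"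
    and ell2_norm_sum: "ell2_norm V (\<lambda>x. \<Sum>i\<in>I. f i x) \<le> (\<Sum>i\<in>I. ell2_norm V (f i))"
proof -
  have "(\<lambda>x. \<Sum>i\<in>I. f i x) \<in> ell2 V \<and> ell2_norm V (\<lambda>x. \<Sum>i\<in>I. f i x) \<le> (\<Sum>i\<in>I. ell2_norm V (f i))"
  proof (cases "finite I")
    case True
    then show ?thesis
      using assms
    proof (induction I rule: finite_induct)
      case (insert i I)
      then show ?case
        using ell2_add[of "f i" V "\<lambda>x. \<Sum>i\<in>I. f i x"] ell2_norm_add[of "f i" V "\<lambda>x. \<Sum>i\<in>I. f i x"]
        by auto
    qed auto
  qed auto
  then show "(\<lambda>x. \<Sum>i\<in>I. f i x) \<in> ell2 V"
    "ell2_norm V (\<lambda>x. \<Sum>i\<in>I. f i x) \<le> (\<Sum>i\<in>I. ell2_norm V (f i))" by auto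
qed

lemma ell2_finite_support:
  assumes "finite {x. f x \<noteq> 0}" "{x. f x \<noteq> 0} \<subseteq> V" shows "f \<in> ell2 V"
proof -
  have "(\<lambda>x. (cmod (f x))\<^sup>2) summable_on {x. f x \<noteq> 0}"
    using assms(1) by (rule summable_on_finite)
  then have "(\<lambda>x. (cmod (f x))\<^sup>2) summable_on V"
    by (rule summable_on_cong_neutral[THEN iffD1, rotated -1]) (use assms in auto)
  then show ?thesis
    using assms by (auto simp: ell2_def)
qed

lemma ell2_norm_mono:
  assumes "f \<in> ell2 V" "g \<in> ell2 V" "\<And>x. x \<in> V \<Longrightarrow> cmod (f x) \<le> cmod (g x)"
  shows "ell2_norm V f \<le> ell2_norm V g"
  unfolding ell2_norm_def
  by (intro real_sqrt_le_mono infsum_mono ell2_summable assms power_mono) auto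

lemma ell2_inner_abs_summable:
  assumes "f \<in> ell2 V" "g \<in> ell2 V"
  shows "(\<lambda>x. norm (f x * cnj (g x))) summable_on V"
proof (rule Infinite_Sum.abs_summable_on_comparison_test')
  show "(\<lambda>x. (cmod (f x))\<^sup>2 + (cmod (g x))\<^sup>2) summable_on V"
    by (intro summable_on_add ell2_summable assms)
  show "norm (f x * cnj (g x)) \<le> (cmod (f x))\<^sup>2 + (cmod (g x))\<^sup>2" for x
  proof -
    have "0 \<le> cmod (f x) * cmod (g x)" by simp
    then show ?thesis
      using sum_squares_bound[of "cmod (f x)" "cmod (g x)"] unfolding norm_mult complex_mod_cnj by linarith
  qed
qed

lemma ell2_inner_summable:
  "f \<in> ell2 V \<Longrightarrow> g \<in> ell2 V \<Longrightarrow> (\<lambda>x. f x * cnj (g x)) summable_on V"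
  by (rule abs_summable_summable[OF ell2_inner_abs_summable])

lemma ell2_inner_lincomb_left:
  assumes "f \<in> ell2 V" "g \<in> ell2 V" "h \<in> ell2 V"
  shows "ell2_inner V (\<lambda>x. a * f x + b * g x) h = a * ell2_inner V f h + b * ell2_inner V g h"
proof -
  have "ell2_inner V (\<lambda>x. a * f x + b * g x) h
    = (\<Sum>\<^sub>\<infinity>x\<in>V. a * (f x * cnj (h x)) + b * (g x * cnj (h x)))"
    by (simp add: ell2_inner_def algebra_simps)
  also have "\<dots> = (\<Sum>\<^sub>\<infinity>x\<in>V. a * (f x * cnj (h x))) + (\<Sum>\<^sub>\<infinity>x\<in>V. b * (g x * cnj (h x)))"
    by (intro infsum_add summable_on_cmult_right ell2_inner_summable assms)
  also have "\<dots> = a * ell2_inner V f h + b * ell2_inner V g h"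
    by (simp add: ell2_inner_def infsum_cmult_right')
  finally show ?thesis .
qed

lemma ell2_inner_commute: "ell2_inner V g f = cnj (ell2_inner V f g)"
  by (simp add: ell2_inner_def mult.commute flip: infsum_cnj)

lemma ell2_inner_lincomb_right:
  assumes "f \<in> ell2 V" "g \<in> ell2 V" "h \<in> ell2 V"
  shows "ell2_inner V h (\<lambda>x. a * f x + b * g x) = cnj a * ell2_inner V h f + cnj b * ell2_inner V h g"
  using ell2_inner_lincomb_left[OF assms, of a b]
  by (subst (1 2 3) ell2_inner_commute) simp

lemma ell2_inner_self: "ell2_inner V f f = of_real ((ell2_norm V f)\<^sup>2)"
  if "f \<in> ell2 V"
proof -
  have "ell2_inner V f f = (\<Sum>\<^sub>\<infinity>x\<in>V. complex_of_real ((cmod (f x))\<^sup>2))"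
    by (simp add: ell2_inner_def flip: complex_norm_square)
  also have "\<dots> = of_real (\<Sum>\<^sub>\<infinity>x\<in>V. (cmod (f x))\<^sup>2)"
    by (intro infsumI has_sum_of_real_iff[THEN iffD2] has_sum_infsum ell2_summable that)
  finally show ?thesis
    by (simp add: ell2_norm_power2)
qed

lemma ell2_inner_zero [simp]: "ell2_inner V (\<lambda>x. 0) f = 0" "ell2_inner V f (\<lambda>x. 0) = 0"
  by (simp_all add: ell2_inner_def)

lemma ell2_Cauchy_Schwarz:
  assumes "f \<in> ell2 V" "g \<in> ell2 V"
  shows "cmod (ell2_inner V f g) \<le> ell2_norm V f * ell2_norm V g"
proof -
  have s: "(\<lambda>x. cmod (f x * cnj (g x))) summable_on V"
    using ell2_inner_abs_summable[OF assms] by simp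
  have "cmod (ell2_inner V f g) \<le> (\<Sum>\<^sub>\<infinity>x\<in>V. cmod (f x * cnj (g x)))"
    unfolding ell2_inner_def by (rule norm_infsum_bound[OF ell2_inner_abs_summable[OF assms]])
  also have "\<dots> \<le> ell2_norm V f * ell2_norm V g"
  proof (rule infsum_le_finite_sums[OF s])
    fix X assume X: "finite X" "X \<subseteq> V"
    have "(\<Sum>x\<in>X. cmod (f x * cnj (g x))) \<le> L2_set (\<lambda>x. cmod (f x)) X * L2_set (\<lambda>x. cmod (g x)) X"
      using L2_set_mult_ineq[of "\<lambda>x. cmod (f x)" "\<lambda>x. cmod (g x)" X] by (simp add: norm_mult)
    also have "\<dots> \<le> ell2_norm V f * ell2_norm V g"
      using L2_set_le_ell2_norm[OF _ X] assms by (intro mult_mono) auto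
    finally show "(\<Sum>x\<in>X. cmod (f x * cnj (g x))) \<le> ell2_norm V f * ell2_norm V g" .
  qed
  finally show ?thesis .
qed

text \<open>The form of completeness behind the Neumann series. Geometric decay of the norms gives
  pointwise convergence, and the tail estimate passes to the pointwise limit because
  \<open>L2_set\<close> over a finite set is continuous.\<close>

lemma ell2_geometric_series:
  fixes g :: "nat \<Rightarrow> 'a \<Rightarrow> complex"
  assumes g: "\<And>j. g j \<in> ell2 V" and le: "\<And>j. ell2_norm V (g j) \<le> C * q ^ j"
    and q: "0 \<le> q" "q < 1"
  defines "F \<equiv> \<lambda>x. \<Sum>j. g j x"
  shows "F \<in> ell2 V"
    and "ell2_norm V (\<lambda>x. F x - (\<Sum>j<k. g j x)) \<le> C * q ^ k / (1 - q)"
proof -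
  have sumC: "summable (\<lambda>j. C * q ^ j)"
    using q by (intro summable_mult summable_geometric) auto
  have C0: "0 \<le> C * q ^ j" for j
    using le[of j] ell2_norm_nonneg[of V "g j"] by linarith
  have sums: "(\<lambda>m. \<Sum>j<m. g j x) \<longlonglongrightarrow> F x" for x
  proof -
    have "summable (\<lambda>j. g j x)"
      by (rule summable_comparison_test'[OF sumC, of 0])
        (use le norm_le_ell2_norm[OF g] in \<open>auto intro: order_trans\<close>)
    then show ?thesis
      unfolding F_def by (rule summable_LIMSEQ)
  qed
  have bound: "L2_set (\<lambda>x. cmod (F x - (\<Sum>j<k. g j x))) X \<le> C * q ^ k / (1 - q)"
    if X: "finite X" "X \<subseteq> V" for X k
  proof (rule LIMSEQ_le_const2)
    show "(\<lambda>m. L2_set (\<lambda>x. cmod ((\<Sum>j<m. g j x) - (\<Sum>j<k. g j x))) X)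
      \<longlonglongrightarrow> L2_set (\<lambda>x. cmod (F x - (\<Sum>j<k. g j x))) X"
      unfolding L2_set_def by (intro tendsto_intros sums)
    show "\<exists>M. \<forall>m\<ge>M. L2_set (\<lambda>x. cmod ((\<Sum>j<m. g j x) - (\<Sum>j<k. g j x))) X \<le> C * q ^ k / (1 - q)"
    proof (intro exI[of _ k] allI impI)
      fix m assume km: "k \<le> m"
      have eq: "(\<Sum>j<m. g j x) - (\<Sum>j<k. g j x) = (\<Sum>j\<in>{k..<m}. g j x)" for x
        using sum_diff_nat_ivl[of 0 k m "\<lambda>j. g j x"] km by (simp add: atLeast0LessThan)
      have "L2_set (\<lambda>x. cmod ((\<Sum>j<m. g j x) - (\<Sum>j<k. g j x))) X \<le> ell2_norm V (\<lambda>x. \<Sum>j\<in>{k..<m}. g j x)"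
        unfolding eq by (rule L2_set_le_ell2_norm[OF ell2_sum X]) (rule g)
      also have "\<dots> \<le> (\<Sum>j\<in>{k..<m}. ell2_norm V (g j))"
        by (rule ell2_norm_sum) (rule g)
      also have "\<dots> \<le> (\<Sum>j\<in>{k..<m}. C * q ^ j)"
        by (intro sum_mono le)
      also have "\<dots> = (\<Sum>i<m-k. C * q ^ (i + k))"
        using km sum.shift_bounds_nat_ivl[of "\<lambda>j. C * q ^ j" 0 k "m-k"] by (simp add: atLeast0LessThan)
      also have "\<dots> \<le> (\<Sum>i. C * q ^ (i + k))"
        using sumC C0 by (intro sum_le_suminf) (auto simp: summable_iff_shift)
      also have "\<dots> = (\<Sum>i. (C * q ^ k) * q ^ i)"
        by (simp add: power_add mult_ac)
      also have "\<dots> = C * q ^ k / (1 - q)"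
        using q by (subst suminf_mult) (simp_all add: suminf_geometric summable_geometric)
      finally show "L2_set (\<lambda>x. cmod ((\<Sum>j<m. g j x) - (\<Sum>j<k. g j x))) X \<le> C * q ^ k / (1 - q)" .
    qed
  qed
  have 0: "F x - (\<Sum>j<k. g j x) = 0" if "x \<notin> V" for x k
    using that ell2D[OF g] by (simp add: F_def)
  show "F \<in> ell2 V"
    using ell2_boundI(1)[OF 0[of _ 0] bound[of _ 0]] by simp
  show "ell2_norm V (\<lambda>x. F x - (\<Sum>j<k. g j x)) \<le> C * q ^ k / (1 - q)"
    by (rule ell2_boundI(2)[OF 0 bound])
qed

section \<open>Polynomials of bounded symmetric operators\<close>

text \<open>Linearity is demanded on all functions, not just on \<open>ell2 V\<close>, so that
  identities between polynomials of an operator carry no summability conditions.\<close>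

definition linear_op :: "(('a \<Rightarrow> complex) \<Rightarrow> 'b \<Rightarrow> complex) \<Rightarrow> bool" where
  "linear_op A \<longleftrightarrow> (\<forall>a b f g. A (\<lambda>x. a * f x + b * g x) = (\<lambda>x. a * A f x + b * A g x))"

lemma linear_op_lincomb: "linear_op A \<Longrightarrow> A (\<lambda>x. a * f x + b * g x) = (\<lambda>x. a * A f x + b * A g x)"
  by (simp add: linear_op_def)

lemma linear_op_add: "linear_op A \<Longrightarrow> A (\<lambda>x. f x + g x) = (\<lambda>x. A f x + A g x)"
  using linear_op_lincomb[of A 1 f 1 g] by simp

lemma linear_op_scale: "linear_op A \<Longrightarrow> A (\<lambda>x. a * f x) = (\<lambda>x. a * A f x)"
  using linear_op_lincomb[of A a f 0 f] by simp

lemma linear_op_diff: "linear_op A \<Longrightarrow> A (\<lambda>x. f x - g x) = (\<lambda>x. A f x - A g x)"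
  using linear_op_lincomb[of A 1 f "-1" g] by simp

lemma linear_op_zero: "linear_op A \<Longrightarrow> A (\<lambda>x. 0) = (\<lambda>x. 0)"
  using linear_op_scale[of A 0 "\<lambda>x. 0"] by simp

lemma linear_op_sum:
  assumes "linear_op A"
  shows "A (\<lambda>x. \<Sum>i\<in>I. f i x) = (\<lambda>x. \<Sum>i\<in>I. A (f i) x)"
  by (induction I rule: infinite_finite_induct)
    (simp_all add: linear_op_zero[OF assms] linear_op_add[OF assms])

text \<open>Horner's rule for p(A) f. With real coefficients p(A) is symmetric whenever A
  is.\<close>

definition op_poly :: "(('a \<Rightarrow> complex) \<Rightarrow> 'a \<Rightarrow> complex) \<Rightarrow> real poly \<Rightarrow> ('a \<Rightarrow> complex) \<Rightarrow> 'a \<Rightarrow> complex"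
  where "op_poly A p f = fold_coeffs (\<lambda>a g x. of_real a * f x + A g x) p (\<lambda>x. 0)"

lemma op_poly_0 [simp]: "op_poly A 0 f = (\<lambda>x. 0)"
  by (simp add: op_poly_def)

lemma op_poly_pCons:
  assumes "linear_op A"
  shows "op_poly A (pCons a p) f = (\<lambda>x. of_real a * f x + A (op_poly A p f) x)"
proof (cases "p = 0 \<and> a = 0")
  case True
  then show ?thesis
    using linear_op_zero[OF assms] by (simp add: op_poly_def)
next
  case False
  then show ?thesis
    by (auto simp: op_poly_def)
qed

lemma op_poly_add:
  assumes "linear_op A"
  shows "op_poly A (p + q) f = (\<lambda>x. op_poly A p f x + op_poly A q f x)"
proof (induction p q rule: poly_induct2)
  case (pCons a p b q)
  then show ?case
    by (simp add: op_poly_pCons[OF assms] linear_op_add[OF assms] algebra_simps)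
qed simp

lemma op_poly_smult:
  assumes "linear_op A"
  shows "op_poly A (Polynomial.smult c p) f = (\<lambda>x. of_real c * op_poly A p f x)"
proof (induction p)
  case (pCons a p)
  then show ?case
    by (simp add: op_poly_pCons[OF assms] linear_op_scale[OF assms] algebra_simps)
qed simp

lemma op_poly_diff:
  assumes "linear_op A"
  shows "op_poly A (p - q) f = (\<lambda>x. op_poly A p f x - op_poly A q f x)"
  using op_poly_add[OF assms, of p "Polynomial.smult (-1) q" f] op_poly_smult[OF assms, of "-1" q f] by simp

lemma op_poly_linear:
  assumes "linear_op A" shows "linear_op (op_poly A p)"
  unfolding linear_op_def
proof (intro allI)
  fix a b f g
  show "op_poly A p (\<lambda>x. a * f x + b * g x) = (\<lambda>x. a * op_poly A p f x + b * op_poly A p g x)"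
    by (induction p)
      (simp_all add: op_poly_pCons[OF assms] linear_op_lincomb[OF assms] algebra_simps)
qed

lemma op_poly_commute:
  assumes "linear_op A" "linear_op B" "\<And>f. B (A f) = A (B f)"
  shows "B (op_poly A p f) = op_poly A p (B f)"
  by (induction p)
    (simp_all add: op_poly_pCons[OF assms(1)] linear_op_zero[OF assms(2)] linear_op_add[OF assms(2)]
      linear_op_scale[OF assms(2)] assms(3))

lemma op_poly_mult:
  assumes "linear_op A"
  shows "op_poly A (p * q) f = op_poly A p (op_poly A q f)"
  by (induction p)
    (simp_all add: op_poly_pCons[OF assms] op_poly_add[OF assms] op_poly_smult[OF assms])

lemma op_poly_const: "linear_op A \<Longrightarrow> op_poly A [:c:] f = (\<lambda>x. of_real c * f x)"
  by (simp add: op_poly_pCons linear_op_zero)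

lemma op_poly_1 [simp]: "linear_op A \<Longrightarrow> op_poly A 1 f = f"
  by (simp add: one_pCons op_poly_const)

lemma op_poly_X: "linear_op A \<Longrightarrow> op_poly A [:0, 1:] f = A f"
  by (simp add: op_poly_pCons linear_op_zero)

lemma op_poly_X_minus: "linear_op A \<Longrightarrow> op_poly A [:- c, 1:] f = (\<lambda>x. A f x - of_real c * f x)"
  by (simp add: op_poly_pCons linear_op_zero)

lemma op_poly_X_power: "linear_op A \<Longrightarrow> op_poly A ([:0, 1:] ^ n) f = (A ^^ n) f"
  by (induction n arbitrary: f) (simp_all add: op_poly_mult op_poly_X del: mult_pCons_left)

lemma op_poly_eigenvector:
  assumes "linear_op A" "A e = (\<lambda>x. of_real \<mu> * e x)"
  shows "op_poly A p e = (\<lambda>x. of_real (poly p \<mu>) * e x)"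
proof (induction p)
  case (pCons a p)
  then show ?case
    by (simp add: op_poly_pCons[OF assms(1)] linear_op_scale[OF assms(1)] assms(2))
      (simp add: algebra_simps)
qed simp

text \<open>The function |x - z|^2 of a real variable x, a real polynomial even for complex z. For
  symmetric A it represents the product of A - z and its adjoint.\<close>

definition dist_poly :: "complex \<Rightarrow> real poly" where
  "dist_poly z = [:(cmod z)\<^sup>2, - 2 * Re z, 1:]"

lemma poly_dist_poly: "poly (dist_poly z) x = (cmod (of_real x - z))\<^sup>2"
  by (simp add: dist_poly_def cmod_power2) (simp add: power2_eq_square algebra_simps)

lemma dist_poly_cnj [simp]: "dist_poly (cnj z) = dist_poly z"
  by (simp add: dist_poly_def)

lemma op_poly_dist_poly:
  assumes "linear_op A"
  shows "op_poly A (dist_poly z) f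
    = (\<lambda>x. A (\<lambda>x. A f x - cnj z * f x) x - z * (A f x - cnj z * f x))"
proof -
  have 1: "A (\<lambda>x. A f x - cnj z * f x) = (\<lambda>x. A (A f) x - cnj z * A f x)"
    by (simp add: linear_op_diff[OF assms] linear_op_scale[OF assms])
  have 2: "complex_of_real (- 2 * Re z) = - (z + cnj z)" "complex_of_real ((cmod z)\<^sup>2) = z * cnj z"
    by (simp_all add: complex_add_cnj complex_norm_square flip: of_real_power)
  have "op_poly A (dist_poly z) f
    = (\<lambda>x. of_real ((cmod z)\<^sup>2) * f x + (of_real (- 2 * Re z) * A f x + A (A f) x))"
    unfolding dist_poly_def op_poly_pCons[OF assms]
    using linear_op_lincomb[OF assms, of "of_real (- 2 * Re z)" f 1 "A f"]
    by (simp add: linear_op_zero[OF assms])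
  also have "\<dots> = (\<lambda>x. A (A f) x - cnj z * A f x - z * (A f x - cnj z * f x))"
    unfolding 2 by (simp add: algebra_simps)
  finally show ?thesis
    unfolding 1 .
qed

locale bounded_symmetric =
  fixes V :: "'a set" and A :: "('a \<Rightarrow> complex) \<Rightarrow> 'a \<Rightarrow> complex" and K :: real
  assumes lin: "linear_op A"
    and maps: "f \<in> ell2 V \<Longrightarrow> A f \<in> ell2 V"
    and bounded: "f \<in> ell2 V \<Longrightarrow> ell2_norm V (A f) \<le> K * ell2_norm V f"
    and sym: "f \<in> ell2 V \<Longrightarrow> g \<in> ell2 V \<Longrightarrow> ell2_inner V (A f) g = ell2_inner V f (A g)"
begin

lemma op_poly_ell2: "f \<in> ell2 V \<Longrightarrow> op_poly A p f \<in> ell2 V"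
  by (induction p) (simp_all add: op_poly_pCons[OF lin] ell2_add ell2_scale maps)

lemma op_poly_bounded: "\<exists>C\<ge>0. \<forall>f\<in>ell2 V. ell2_norm V (op_poly A p f) \<le> C * ell2_norm V f"
proof (induction p)
  case (pCons a p)
  then obtain C where C: "C \<ge> 0" "\<And>f. f \<in> ell2 V \<Longrightarrow> ell2_norm V (op_poly A p f) \<le> C * ell2_norm V f"
    by auto
  show ?case
  proof (intro exI[of _ "\<bar>a\<bar> + \<bar>K\<bar> * C"] conjI ballI)
    fix f :: "'a \<Rightarrow> complex" assume f: "f \<in> ell2 V"
    have "ell2_norm V (A (op_poly A p f)) \<le> \<bar>K\<bar> * ell2_norm V (op_poly A p f)"
      using bounded[OF op_poly_ell2[OF f, of p]] mult_right_mono[OF abs_ge_self[of K]] 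
      by (meson ell2_norm_nonneg order_trans)
    also have "\<dots> \<le> \<bar>K\<bar> * (C * ell2_norm V f)"
      using C(2)[OF f] by (intro mult_left_mono) auto
    finally show "ell2_norm V (op_poly A (pCons a p) f) \<le> (\<bar>a\<bar> + \<bar>K\<bar> * C) * ell2_norm V f"
      using ell2_norm_add[OF ell2_scale[OF f] maps[OF op_poly_ell2[OF f]], of a p] ell2_norm_scale[of V a f]
      by (simp add: op_poly_pCons[OF lin] algebra_simps)
  qed (use C in simp)
qed auto

lemma op_poly_sym:
  assumes "f \<in> ell2 V" "g \<in> ell2 V"
  shows "ell2_inner V (op_poly A p f) g = ell2_inner V f (op_poly A p g)"
  using assms(2)
proof (induction p arbitrary: g)
  case (pCons a p)
  have "ell2_inner V (A (op_poly A p f)) g = ell2_inner V (op_poly A p f) (A g)"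
    by (intro sym op_poly_ell2 assms pCons)
  also have "\<dots> = ell2_inner V f (A (op_poly A p g))"
    using pCons(2)[OF maps[OF pCons(3)]] op_poly_commute[OF lin lin, of p g] by simp
  finally show ?case
    using ell2_inner_lincomb_left[of f V "A (op_poly A p f)" g a 1] 
      ell2_inner_lincomb_right[of g V "A (op_poly A p g)" f a 1] assms pCons(3)
    by (simp add: op_poly_pCons[OF lin] op_poly_ell2 maps)
qed simp

lemma inner_power2:
  assumes "f \<in> ell2 V"
  shows "ell2_inner V (op_poly A p f) (op_poly A q f) = ell2_inner V (op_poly A (q * p) f) f"
  using op_poly_sym[OF op_poly_ell2[OF assms] assms, of q p] by (simp add: op_poly_mult[OF lin])

end

section \<open>Bounded inverses from lower bounds\<close>

context bounded_symmetric
begin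

lemma shift_ell2: "f \<in> ell2 V \<Longrightarrow> (\<lambda>x. A f x - z * f x) \<in> ell2 V"
  by (intro ell2_diff ell2_scale maps)

lemma shift_adjoint:
  assumes "f \<in> ell2 V" "g \<in> ell2 V"
  shows "ell2_inner V (\<lambda>x. A f x - z * f x) g = ell2_inner V f (\<lambda>x. A g x - cnj z * g x)"
  using ell2_inner_lincomb_left[OF maps[OF assms(1)] assms(1,2), of 1 "-z"]
    ell2_inner_lincomb_right[OF maps[OF assms(2)] assms(2,1), of 1 "-cnj z"] sym[OF assms]
  by simp

lemma norm_shift_power2:
  assumes "f \<in> ell2 V"
  shows "ell2_inner V (op_poly A (dist_poly z) f) f = of_real ((ell2_norm V (\<lambda>x. A f x - z * f x))\<^sup>2)"
proof -
  have "op_poly A (dist_poly z) f = (\<lambda>x. A (\<lambda>x. A f x - z * f x) x - cnj z * (A f x - z * f x))"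
    using op_poly_dist_poly[OF lin, of "cnj z" f] by simp
  then show ?thesis
    using shift_adjoint[OF shift_ell2[OF assms] assms, of z "cnj z"] ell2_inner_self[OF shift_ell2[OF assms], of z]
    by simp
qed

text \<open>The form <A f, f> is real, so the imaginary part of <(A - z) f, f> is -Im z times the
  squared norm of f; Cauchy-Schwarz does the rest.\<close>

lemma nonreal_bounded_below:
  assumes f: "f \<in> ell2 V"
  shows "\<bar>Im z\<bar> * ell2_norm V f \<le> ell2_norm V (\<lambda>x. A f x - z * f x)"
proof (cases "ell2_norm V f = 0")
  case False
  have "ell2_inner V (A f) f = cnj (ell2_inner V (A f) f)"
    using sym[OF f f] ell2_inner_commute by metis
  then have "Im (ell2_inner V (A f) f) = 0"
    by (metis Im_complex_of_real Reals_cases Reals_cnj_iff)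
  moreover have "ell2_inner V (\<lambda>x. A f x - z * f x) f = ell2_inner V (A f) f - z * of_real ((ell2_norm V f)\<^sup>2)"
    using ell2_inner_lincomb_left[OF maps[OF f] f f, of 1 "-z"] ell2_inner_self[OF f] by simp
  ultimately have "\<bar>Im z\<bar> * (ell2_norm V f)\<^sup>2 = \<bar>Im (ell2_inner V (\<lambda>x. A f x - z * f x) f)\<bar>"
    by (simp add: abs_mult)
  also have "\<dots> \<le> ell2_norm V (\<lambda>x. A f x - z * f x) * ell2_norm V f"
    using ell2_Cauchy_Schwarz[OF shift_ell2[OF f] f] abs_Im_le_cmod order_trans by blast
  finally have "(\<bar>Im z\<bar> * ell2_norm V f) * ell2_norm V f \<le> ell2_norm V (\<lambda>x. A f x - z * f x) * ell2_norm V f"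
    by (simp add: power2_eq_square)
  then show ?thesis
    using False ell2_norm_nonneg[of V f] by (simp add: mult_le_cancel_right)
qed simp

text \<open>\<open>1 - \<bar>A - z\<bar>\<^sup>2 / \<kappa>\<close> is a contraction when \<open>\<kappa>\<close> is large, because \<open>\<bar>A - z\<bar>\<^sup>2\<close> is bounded and
  bounded below.\<close>
lemma contraction:
  assumes c: "c > 0" and below: "\<And>f. f \<in> ell2 V \<Longrightarrow> c * ell2_norm V f \<le> ell2_norm V (\<lambda>x. A f x - z * f x)"
  obtains \<kappa>0 where "\<kappa>0 > 0"
    and "\<And>\<kappa>. \<kappa> \<ge> \<kappa>0 \<Longrightarrow> \<exists>q. 0 \<le> q \<and> q < 1 \<and>
      (\<forall>f\<in>ell2 V. ell2_norm V (op_poly A (1 - Polynomial.smult (1 / \<kappa>) (dist_poly z)) f) \<le> q * ell2_norm V f)"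
proof -
  obtain B where B: "B \<ge> 0" "\<And>f. f \<in> ell2 V \<Longrightarrow> ell2_norm V (op_poly A (dist_poly z) f) \<le> B * ell2_norm V f"
    using op_poly_bounded[of "dist_poly z"] by auto
  define \<kappa>0 where "\<kappa>0 = (B\<^sup>2 + c\<^sup>2 * c\<^sup>2) / c\<^sup>2"
  have \<kappa>0: "\<kappa>0 > 0"
    using c unfolding \<kappa>0_def by (intro divide_pos_pos add_nonneg_pos) auto
  have "\<exists>q. 0 \<le> q \<and> q < 1 \<and>
      (\<forall>f\<in>ell2 V. ell2_norm V (op_poly A (1 - Polynomial.smult (1 / \<kappa>) (dist_poly z)) f) \<le> q * ell2_norm V f)"
    if \<kappa>: "\<kappa> \<ge> \<kappa>0" for \<kappa>
  proof (intro exI[of _ "sqrt (1 - c\<^sup>2 / \<kappa>)"] conjI ballI)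
    have \<kappa>p: "\<kappa> > 0" using \<kappa> \<kappa>0 by simp
    have "B\<^sup>2 + c\<^sup>2 * c\<^sup>2 \<le> \<kappa> * c\<^sup>2"
      using \<kappa> c unfolding \<kappa>0_def by (simp add: divide_le_eq)
    then have Bk: "B\<^sup>2 \<le> \<kappa> * c\<^sup>2" and ck: "c\<^sup>2 * c\<^sup>2 \<le> \<kappa> * c\<^sup>2"
      using zero_le_power2[of B] zero_le_square[of "c\<^sup>2"] by linarith+
    have "c\<^sup>2 \<le> \<kappa>" using c by (intro mult_right_le_imp_le[OF ck]) simp
    then show "0 \<le> sqrt (1 - c\<^sup>2 / \<kappa>)" "sqrt (1 - c\<^sup>2 / \<kappa>) < 1"
      using \<kappa>p c by (auto simp: field_simps)
    fix f :: "'a \<Rightarrow> complex" assume f: "f \<in> ell2 V"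
    let ?Q = "op_poly A (dist_poly z) f"
    let ?n = "ell2_norm V f" and ?m = "ell2_norm V (\<lambda>x. A f x - z * f x)"
    have Q: "?Q \<in> ell2 V" using f by (rule op_poly_ell2)
    let ?T = "op_poly A (1 - Polynomial.smult (1 / \<kappa>) (dist_poly z)) f"
    have T: "?T = (\<lambda>x. 1 * f x + of_real (- 1 / \<kappa>) * ?Q x)"
      by (simp add: op_poly_diff[OF lin] op_poly_smult[OF lin] lin)
    have T': "?T \<in> ell2 V" using f by (rule op_poly_ell2)
    have i1: "ell2_inner V ?Q f = of_real (?m\<^sup>2)" using norm_shift_power2[OF f] .
    have i2: "ell2_inner V f ?Q = of_real (?m\<^sup>2)" 
      using i1 by (subst ell2_inner_commute) simp
    have "complex_of_real ((ell2_norm V ?T)\<^sup>2) = ell2_inner V ?T ?T"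
      using ell2_inner_self[OF T'] by simp
    also have "\<dots> = ell2_inner V f ?T + of_real (- 1 / \<kappa>) * ell2_inner V ?Q ?T"
      using ell2_inner_lincomb_left[OF f Q T', of 1 "of_real (- 1 / \<kappa>)"] unfolding T by simp
    also have "ell2_inner V f ?T = of_real (?n\<^sup>2) + of_real (- 1 / \<kappa>) * of_real (?m\<^sup>2)"
      using ell2_inner_lincomb_right[OF f Q f, of 1 "of_real (- 1 / \<kappa>)"] i2 ell2_inner_self[OF f] unfolding T by simp
    also have "ell2_inner V ?Q ?T = of_real (?m\<^sup>2) + of_real (- 1 / \<kappa>) * of_real ((ell2_norm V ?Q)\<^sup>2)"
      using ell2_inner_lincomb_right[OF f Q Q, of 1 "of_real (- 1 / \<kappa>)"] i1 ell2_inner_self[OF Q] unfolding T by simp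
    finally have "complex_of_real ((ell2_norm V ?T)\<^sup>2)
      = of_real (?n\<^sup>2 + (- 1 / \<kappa>) * ?m\<^sup>2 + (- 1 / \<kappa>) * (?m\<^sup>2 + (- 1 / \<kappa>) * (ell2_norm V ?Q)\<^sup>2))"
      by simp
    then have "(ell2_norm V ?T)\<^sup>2 = ?n\<^sup>2 + (- 1 / \<kappa>) * ?m\<^sup>2 + (- 1 / \<kappa>) * (?m\<^sup>2 + (- 1 / \<kappa>) * (ell2_norm V ?Q)\<^sup>2)"
      unfolding of_real_eq_iff .
    also have "\<dots> = ?n\<^sup>2 - 2 / \<kappa> * ?m\<^sup>2 + (ell2_norm V ?Q)\<^sup>2 / \<kappa>\<^sup>2"
      using \<kappa>p by (simp add: field_simps power2_eq_square)
    also have "\<dots> \<le> ?n\<^sup>2 - 2 / \<kappa> * (c * ?n)\<^sup>2 + (B * ?n)\<^sup>2 / \<kappa>\<^sup>2"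
      using \<kappa>p below[OF f] B(2)[OF f] c
      by (intro add_mono diff_mono mult_left_mono divide_right_mono power_mono) auto
    also have "\<dots> \<le> ?n\<^sup>2 - 2 / \<kappa> * (c * ?n)\<^sup>2 + (\<kappa> * c\<^sup>2) * ?n\<^sup>2 / \<kappa>\<^sup>2"
      using Bk by (intro add_mono divide_right_mono) (auto simp: power_mult_distrib intro!: mult_right_mono)
    also have "\<dots> = (1 - c\<^sup>2 / \<kappa>) * ?n\<^sup>2"
      using \<kappa>p by (simp add: field_simps power2_eq_square)
    finally have "sqrt ((ell2_norm V ?T)\<^sup>2) \<le> sqrt ((1 - c\<^sup>2 / \<kappa>) * ?n\<^sup>2)"
      by (rule real_sqrt_le_mono)
    then show "ell2_norm V ?T \<le> sqrt (1 - c\<^sup>2 / \<kappa>) * ?n"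
      by (simp add: real_sqrt_mult)
  qed
  then show ?thesis
    using that \<kappa>0 by blast
qed

lemma funpow_contraction:
  assumes "f \<in> ell2 V" "0 \<le> q"
    "\<And>f. f \<in> ell2 V \<Longrightarrow> ell2_norm V (op_poly A p f) \<le> q * ell2_norm V f"
  shows "ell2_norm V (op_poly A (p ^ k) f) \<le> q ^ k * ell2_norm V f"
proof (induction k)
  case (Suc k)
  have "ell2_norm V (op_poly A (p ^ Suc k) f) \<le> q * ell2_norm V (op_poly A (p ^ k) f)"
    using assms(3)[OF op_poly_ell2[OF assms(1)], of "p ^ k"] by (simp add: op_poly_mult[OF lin])
  also have "\<dots> \<le> q * (q ^ k * ell2_norm V f)"
    using Suc assms(2) by (intro mult_left_mono)
  finally show ?case by simp
qed (simp add: lin)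

text \<open>With T = 1 - |A - z|^2 / \<kappa> a contraction, the Neumann series of T^j g is summed
  in \<open>ell2 V\<close>; its partial sums telescope under 1 - T, which is |A - z|^2 /
  \<kappa>.\<close>

lemma bounded_below_surj:
  assumes c: "c > 0" and below: "\<And>f. f \<in> ell2 V \<Longrightarrow> c * ell2_norm V f \<le> ell2_norm V (\<lambda>x. A f x - z * f x)"
    and g: "g \<in> ell2 V"
  shows "\<exists>f\<in>ell2 V. op_poly A (dist_poly z) f = g"
proof -
  obtain \<kappa> where \<kappa>: "\<kappa> > 0" and "\<exists>q. 0 \<le> q \<and> q < 1 \<and>
      (\<forall>f\<in>ell2 V. ell2_norm V (op_poly A (1 - Polynomial.smult (1 / \<kappa>) (dist_poly z)) f) \<le> q * ell2_norm V f)"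
    using contraction[OF c below] by (metis order_refl)
  define T where "T = 1 - Polynomial.smult (1 / \<kappa>) (dist_poly z)"
  obtain q where q: "0 \<le> q" "q < 1" "\<And>f. f \<in> ell2 V \<Longrightarrow> ell2_norm V (op_poly A T f) \<le> q * ell2_norm V f"
    unfolding T_def using \<open>\<exists>q. _ q\<close> by blast
  define G where "G j = op_poly A (T ^ j) g" for j
  have G: "G j \<in> ell2 V" "ell2_norm V (G j) \<le> ell2_norm V g * q ^ j" for j
    using g funpow_contraction[OF g q(1,3), of j] by (auto simp: G_def op_poly_ell2 mult.commute)
  define F where "F x = (\<Sum>j. G j x)" for x
  define S where "S k x = (\<Sum>j<k. G j x)" for k x
  have F: "F \<in> ell2 V" and FS: "ell2_norm V (\<lambda>x. F x - S k x) \<le> ell2_norm V g * q ^ k / (1 - q)" for k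
    unfolding F_def S_def by (rule ell2_geometric_series[OF G q(1,2)])+
  have S: "S k \<in> ell2 V" for k
    unfolding S_def by (intro ell2_sum G)
  have tele: "(\<lambda>x. S k x - op_poly A T (S k) x) = (\<lambda>x. g x - G k x)" for k
  proof -
    have "op_poly A T (S k) = (\<lambda>x. \<Sum>j<k. G (Suc j) x)"
      unfolding S_def linear_op_sum[OF op_poly_linear[OF lin]] by (simp add: G_def op_poly_mult[OF lin])
    then show ?thesis
      using sum_lessThan_telescope'[of "\<lambda>j. G j _" k]
      by (simp add: S_def fun_eq_iff sum_subtractf[symmetric]) (simp add: G_def lin)
  qed
  have id: "(\<lambda>x. f x - op_poly A T f x) = (\<lambda>x. of_real (1 / \<kappa>) * op_poly A (dist_poly z) f x)" for f
    by (simp add: T_def op_poly_diff[OF lin] op_poly_smult[OF lin] lin)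
  \<comment> \<open>The defect of F is compared with the defect of the partial sum
    \<open>S k\<close>, which is -G k; both the difference and G k tend to 0 in norm.\<close>
  let ?d = "\<lambda>x. F x - op_poly A T F x - g x"
  have d: "?d \<in> ell2 V"
    by (intro ell2_diff F g op_poly_ell2)
  have "ell2_norm V ?d \<le> 2 * ell2_norm V g * q ^ k / (1 - q) + ell2_norm V g * q ^ k" for k
  proof -
    let ?e = "\<lambda>x. F x - S k x"
    have e: "?e \<in> ell2 V" by (intro ell2_diff F S)
    have eq: "?d = (\<lambda>x. (?e x - op_poly A T ?e x) - G k x)"
      using tele[of k] by (auto simp: linear_op_diff[OF op_poly_linear[OF lin]] fun_eq_iff algebra_simps)
    have "ell2_norm V ?d \<le> (ell2_norm V ?e + ell2_norm V (op_poly A T ?e)) + ell2_norm V (G k)"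
      unfolding eq using ell2_norm_diff[OF ell2_diff[OF e op_poly_ell2[OF e]] G(1)]
        ell2_norm_diff[OF e op_poly_ell2[OF e]] by (rule order_trans[OF _ add_right_mono])
    also have "ell2_norm V (op_poly A T ?e) \<le> 1 * ell2_norm V ?e"
      using q(3)[OF e] q(2) by (meson ell2_norm_nonneg less_imp_le mult_right_mono order_trans)
    finally have "ell2_norm V ?d \<le> 2 * ell2_norm V ?e + ell2_norm V (G k)" by simp
    then show ?thesis
      using FS[of k] G(2)[of k] by simp
  qed
  moreover have "(\<lambda>k. 2 * ell2_norm V g * q ^ k / (1 - q) + ell2_norm V g * q ^ k) \<longlonglongrightarrow> 
      2 * ell2_norm V g * 0 / (1 - q) + ell2_norm V g * 0"
    using q by (intro tendsto_intros LIMSEQ_power_zero) auto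
  ultimately have "ell2_norm V ?d \<le> 2 * ell2_norm V g * 0 / (1 - q) + ell2_norm V g * 0"
    by (intro LIMSEQ_le_const) auto
  then have "ell2_norm V ?d = 0"
    using ell2_norm_nonneg[of V ?d] by linarith
  from ell2_norm_eq_0[OF d this] have "(\<lambda>x. F x - op_poly A T F x) = g"
    by (simp add: fun_eq_iff)
  then have "op_poly A (dist_poly z) (\<lambda>x. of_real (1 / \<kappa>) * F x) = g"
    unfolding id linear_op_scale[OF op_poly_linear[OF lin]] .
  then show ?thesis
    using ell2_scale[OF F] by blast
qed

lemma bounded_below_inj:
  assumes c: "c > 0" and below: "\<And>f. f \<in> ell2 V \<Longrightarrow> c * ell2_norm V f \<le> ell2_norm V (\<lambda>x. A f x - z * f x)"
  shows "inj_on (\<lambda>f x. A f x - z * f x) (ell2 V)"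
proof (rule inj_onI)
  fix f g assume f: "f \<in> ell2 V" and g: "g \<in> ell2 V"
    and eq: "(\<lambda>x. A f x - z * f x) = (\<lambda>x. A g x - z * g x)"
  let ?h = "\<lambda>x. f x - g x"
  have h: "?h \<in> ell2 V" using f g by (rule ell2_diff)
  have "(\<lambda>x. A ?h x - z * ?h x) = (\<lambda>x. 0)"
    using eq by (simp add: linear_op_diff[OF lin] fun_eq_iff algebra_simps)
  then have "c * ell2_norm V ?h \<le> 0"
    using below[OF h] by simp
  then have "ell2_norm V ?h = 0"
    using c ell2_norm_nonneg[of V ?h] by (simp add: mult_le_0_iff)
  from ell2_norm_eq_0[OF h this] show "f = g"
    by (simp add: fun_eq_iff)
qed

text \<open>Symmetry leaves no residual spectrum: |A - z|^2 is onto and has A - z as its outer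
  factor, so applying the adjoint of A - z to a preimage under |A - z|^2 gives a preimage under A -
  z.\<close>

lemma bounded_below_bij:
  assumes c: "c > 0" and below: "\<And>f. f \<in> ell2 V \<Longrightarrow> c * ell2_norm V f \<le> ell2_norm V (\<lambda>x. A f x - z * f x)"
  shows "bij_betw (\<lambda>f x. A f x - z * f x) (ell2 V) (ell2 V)"
proof (rule bij_betw_imageI[OF bounded_below_inj[OF c below]])
  show "(\<lambda>f x. A f x - z * f x) ` ell2 V = ell2 V"
  proof
    show "ell2 V \<subseteq> (\<lambda>f x. A f x - z * f x) ` ell2 V"
    proof
      fix g assume "g \<in> ell2 V"
      then obtain f where f: "f \<in> ell2 V" "op_poly A (dist_poly z) f = g"
        using bounded_below_surj[OF c below] by blast
      then show "g \<in> (\<lambda>f x. A f x - z * f x) ` ell2 V"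
        by (intro image_eqI[of _ _ "\<lambda>x. A f x - cnj z * f x"])
          (auto simp: op_poly_dist_poly[OF lin] intro: shift_ell2)
    qed
  qed (auto intro: shift_ell2)
qed

end

section \<open>The moment problem\<close>

lemma poly_power_induct [case_names zero add power]:
  fixes P :: "real poly \<Rightarrow> bool"
  assumes "P 0" "\<And>p q. P p \<Longrightarrow> P q \<Longrightarrow> P (p + q)" "\<And>c n. P (Polynomial.smult c ([:0, 1:] ^ n))"
  shows "P p"
proof -
  have "P (\<Sum>i\<in>I. monom (coeff p i) i)" for I
    by (induction I rule: infinite_finite_induct) (auto simp: assms monom_altdef)
  from this[of "{..degree p}"] show ?thesis
    by (simp add: poly_as_sum_of_monoms)
qed

text \<open>The coefficients of the expansion of \<open>j ^ n\<close> in the binomial coefficients of \<open>j\<close>.\<close>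
fun binomial_coords :: "nat \<Rightarrow> nat \<Rightarrow> real" where
  "binomial_coords 0 i = (if i = 0 then 1 else 0)"
| "binomial_coords (Suc n) i = real i * (binomial_coords n i + binomial_coords n (i - 1))"

lemma binomial_coords_gt: "i > n \<Longrightarrow> binomial_coords n i = 0"
  by (induction n arbitrary: i) auto

lemma binomial_coords_same: "binomial_coords n n = fact n"
  by (induction n) (auto simp: binomial_coords_gt)

text \<open>The recursion of \<open>binomial_coords\<close> mirrors j C(j, i) = i C(j, i) + (i + 1)
  C(j, i + 1); its values are i! times the Stirling numbers of the second kind.\<close>

lemma power_eq_sum_binomial: "real j ^ n = (\<Sum>i\<le>n. binomial_coords n i * real (j choose i))"
proof (induction n)
  case (Suc n)
  have 1: "real j * real (j choose i) = real i * real (j choose i) + real (Suc i) * real (j choose Suc i)" for i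
  proof (cases "i \<le> j")
    case True
    have "Suc i * (j choose Suc i) = (j - i) * (j choose i)"
      using binomial_absorption[of i j] binomial_absorb_comp[of j i] by simp
    then have "real (Suc i) * real (j choose Suc i) = (real j - real i) * real (j choose i)"
      unfolding of_nat_diff[OF True, symmetric] of_nat_mult[symmetric] by (rule arg_cong)
    then show ?thesis by (simp add: algebra_simps)
  qed (simp add: binomial_eq_0)
  have "real j ^ Suc n = (\<Sum>i\<le>n. binomial_coords n i * (real j * real (j choose i)))"
    unfolding power_Suc Suc by (simp add: sum_distrib_left mult_ac)
  also have "\<dots> = (\<Sum>i\<le>n. real i * binomial_coords n i * real (j choose i))
      + (\<Sum>i\<le>n. real (Suc i) * binomial_coords n i * real (j choose Suc i))"
    unfolding 1 by (simp add: algebra_simps sum.distrib)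
  also have "(\<Sum>i\<le>n. real i * binomial_coords n i * real (j choose i))
      = (\<Sum>i\<le>Suc n. real i * binomial_coords n i * real (j choose i))"
    by (simp add: binomial_coords_gt)
  also have "(\<Sum>i\<le>n. real (Suc i) * binomial_coords n i * real (j choose Suc i))
      = (\<Sum>i\<le>Suc n. real i * binomial_coords n (i - 1) * real (j choose i))"
    unfolding sum.atMost_Suc_shift by simp
  finally show ?case
    by (simp add: sum.distrib algebra_simps)
qed simp

lemma binomial_over_power_tendsto: "(\<lambda>k. real (k choose i) / real k ^ i) \<longlonglongrightarrow> 1 / fact i"
proof (induction i)
  case 0
  show ?case by simp
next
  case (Suc i)
  have "(\<lambda>k. real (k choose i) / real k ^ i * ((1 - real i / real k) / real (Suc i)))
    \<longlonglongrightarrow> 1 / fact i * ((1 - 0) / real (Suc i))"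
    by (intro tendsto_intros Suc lim_const_over_n) auto
  moreover have "\<forall>\<^sub>F k in sequentially. real (k choose i) / real k ^ i * ((1 - real i / real k) / real (Suc i))
      = real (k choose Suc i) / real k ^ Suc i"
    using eventually_gt_at_top[of "Suc i"]
  proof eventually_elim
    case (elim k)
    then have ik: "i \<le> k" by simp
    have "Suc i * (k choose Suc i) = (k - i) * (k choose i)"
      using binomial_absorption[of i k] binomial_absorb_comp[of k i] by simp
    then have "real (Suc i) * real (k choose Suc i) = (real k - real i) * real (k choose i)"
      unfolding of_nat_diff[OF ik, symmetric] of_nat_mult[symmetric] by (rule arg_cong)
    then have "real (k choose Suc i) = (real k - real i) * real (k choose i) / real (Suc i)"
      by (simp add: nonzero_eq_divide_eq mult.commute)
    moreover have "1 - real i / real k = (real k - real i) / real k"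
      using elim by (simp add: diff_divide_distrib)
    ultimately show ?case
      by (simp add: mult_ac)
  qed
  ultimately show ?case
    using Lim_transform_eventually[where F=sequentially] by (simp add: mult.commute)
qed

text \<open>Bernstein's construction: at stage k the point j/k gets the mass C(k, j) L(x^j (1 -
  x)^(k - j)). These masses are probabilities whose binomial moments are exact, their power moments
  converge to those of L, and tightness supplies a weak limit.\<close>

theorem Hausdorff_moment:
  fixes L :: "real poly \<Rightarrow> real"
  assumes add: "\<And>p q. L (p + q) = L p + L q"
    and scale: "\<And>c p. L (Polynomial.smult c p) = c * L p"
    and pos: "\<And>j k. 0 \<le> L ([:0, 1:] ^ j * [:1, -1:] ^ k)"
    and one: "L 1 = 1"
  obtains M where "real_distribution M" "AE x in M. 0 \<le> x \<and> x \<le> 1"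
    "\<And>n. (\<integral>x. x ^ n \<partial>M) = L ([:0, 1:] ^ n)"
proof -
  have L0: "L 0 = 0" using scale[of 0 0] by simp
  have L_sum: "L (\<Sum>i\<in>I. p i) = (\<Sum>i\<in>I. L (p i))" for p :: "nat \<Rightarrow> real poly" and I
    by (induction I rule: infinite_finite_induct) (auto simp: L0 add)
  define b :: "nat \<Rightarrow> nat \<Rightarrow> real poly" where "b k j = [:0, 1:] ^ j * [:1, -1:] ^ (k - j)" for k j
  define w where "w k j = (if j \<le> k then real (k choose j) * L (b k j) else 0)" for k j
  have w0: "0 \<le> w k j" for k j
    using pos by (simp add: w_def b_def)
  \<comment> \<open>Averaging C(j, i) against the Bernstein polynomials leaves C(k, i) x^i, since
    the remaining factor is (x + (1 - x))^(k - i) = 1.\<close>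
  have sum_b: "(\<Sum>j\<le>k. Polynomial.smult (real (k choose j) * real (j choose i)) (b k j))
      = Polynomial.smult (real (k choose i)) ([:0, 1:] ^ i)" if "i \<le> k" for i k
  proof -
    have "(\<Sum>j\<le>k. Polynomial.smult (real (k choose j) * real (j choose i)) (b k j))
      = (\<Sum>j\<in>{i..k}. Polynomial.smult (real (k choose j) * real (j choose i)) (b k j))"
      by (intro sum.mono_neutral_right) auto
    also have "\<dots> = (\<Sum>j\<in>{i..k}. Polynomial.smult (real (k choose i) * real ((k - i) choose (j - i))) (b k j))"
      using choose_mult[of i _ k] by (intro sum.cong) (auto simp flip: of_nat_mult)
    also have "\<dots> = (\<Sum>j\<le>k - i. Polynomial.smult (real (k choose i) * real ((k - i) choose j)) (b k (j + i)))"
      using that sum.shift_bounds_cl_nat_ivl[of "\<lambda>j. Polynomial.smult (real (k choose i) * real ((k - i) choose (j - i))) (b k j)" 0 i "k - i"]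
      by (simp add: atMost_atLeast0)
    also have "\<dots> = (\<Sum>j\<le>k - i. Polynomial.smult (real (k choose i)) ([:0, 1:] ^ i) *
        (of_nat ((k - i) choose j) * [:0, 1:] ^ j * [:1, -1:] ^ (k - i - j)))"
      by (intro sum.cong refl) (simp add: b_def power_add of_nat_poly mult_ac add.commute[of i])
    also have "\<dots> = Polynomial.smult (real (k choose i)) ([:0, 1:] ^ i) * ([:0, 1:] + [:1, -1:]) ^ (k - i)"
      unfolding binomial_ring sum_distrib_left ..
    also have "[:0, 1:] + [:1, -1:] = (1 :: real poly)"
      by (simp add: one_pCons)
    finally show ?thesis by simp
  qed
  have sum_w: "(\<Sum>j\<le>k. w k j * real (j choose i)) = real (k choose i) * L ([:0, 1:] ^ i)" if "i \<le> k" for i k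
  proof -
    have "(\<Sum>j\<le>k. w k j * real (j choose i))
      = L (\<Sum>j\<le>k. Polynomial.smult (real (k choose j) * real (j choose i)) (b k j))"
      unfolding L_sum scale by (intro sum.cong) (auto simp: w_def)
    then show ?thesis
      unfolding sum_b[OF that] scale .
  qed
  have w1: "(\<Sum>j\<le>k. w k j) = 1" for k
    using sum_w[of 0 k] by (simp add: one)
  have pmf_w: "(\<integral>\<^sup>+ j. ennreal (w k j) \<partial>count_space UNIV) = 1" for k
  proof -
    have "(\<integral>\<^sup>+ j. ennreal (w k j) \<partial>count_space UNIV) = (\<Sum>j\<le>k. ennreal (w k j))"
      by (intro nn_integral_count_space') (auto simp: w_def)
    also have "\<dots> = ennreal (\<Sum>j\<le>k. w k j)"
      by (intro sum_ennreal) (auto simp: w0)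
    finally show ?thesis
      by (simp add: w1)
  qed
  define P where "P k = embed_pmf (w k)" for k
  have pmf_P: "pmf (P k) j = w k j" for k j
    unfolding P_def by (rule pmf_embed_pmf[OF w0 pmf_w])
  have P_supp: "j \<le> k" if "j \<in> set_pmf (P k)" for j k
    using that by (auto simp: set_pmf_iff pmf_P w_def split: if_splits)
  define \<mu> where "\<mu> k = distr (measure_pmf (P k)) borel (\<lambda>j. real j / real k)" for k
  have \<mu>: "real_distribution (\<mu> k)" for k
    unfolding \<mu>_def by (intro prob_space.real_distribution_distr measure_pmf.prob_space_axioms) auto
  have \<mu>01: "AE x in \<mu> k. 0 \<le> x \<and> x \<le> 1" for k
    unfolding \<mu>_def by (subst AE_distr_iff) (auto simp: AE_measure_pmf_iff divide_le_eq_1 dest!: P_supp)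
  have int_\<mu>: "(\<integral>x. g x \<partial>\<mu> k) = (\<Sum>j\<le>k. w k j * g (real j / real k))"
    if [measurable]: "g \<in> borel_measurable borel" for g :: "real \<Rightarrow> real" and k
  proof -
    have "(\<integral>x. g x \<partial>\<mu> k) = (\<integral>j. g (real j / real k) \<partial>measure_pmf (P k))"
      unfolding \<mu>_def by (intro integral_distr) auto
    also have "\<dots> = (\<Sum>j\<le>k. g (real j / real k) * pmf (P k) j)"
      by (intro integral_measure_pmf_real) (auto dest: P_supp)
    finally show ?thesis
      by (simp add: pmf_P mult.commute)
  qed
  have moments: "(\<lambda>k. \<integral>x. x ^ n \<partial>\<mu> k) \<longlonglongrightarrow> L ([:0, 1:] ^ n)" for n
  proof -
    \<comment> \<open>Only i = n survives, as the other terms carry a power of 1/k. The surviving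
      coefficient n! cancels the limit 1/n! of C(k, n) / k^n.\<close>
    have "(\<lambda>k. \<Sum>i\<le>n. binomial_coords n i * L ([:0, 1:] ^ i) *
        (real (k choose i) / real k ^ i * (1 / real k) ^ (n - i)))
      \<longlonglongrightarrow> (\<Sum>i\<le>n. binomial_coords n i * L ([:0, 1:] ^ i) * (1 / fact i * 0 ^ (n - i)))"
      by (intro tendsto_intros binomial_over_power_tendsto lim_1_over_n)
    also have "(\<Sum>i\<le>n. binomial_coords n i * L ([:0, 1:] ^ i) * (1 / fact i * 0 ^ (n - i)))
      = (\<Sum>i\<in>{n}. binomial_coords n i * L ([:0, 1:] ^ i) * (1 / fact i * 0 ^ (n - i)))"
      by (intro sum.mono_neutral_right) auto
    also have "\<dots> = L ([:0, 1:] ^ n)"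
      by (simp add: binomial_coords_same)
    finally show ?thesis
    proof (rule Lim_transform_eventually)
      show "\<forall>\<^sub>F k in sequentially. (\<Sum>i\<le>n. binomial_coords n i * L ([:0, 1:] ^ i) *
        (real (k choose i) / real k ^ i * (1 / real k) ^ (n - i))) = (\<integral>x. x ^ n \<partial>\<mu> k)"
        using eventually_gt_at_top[of n]
      proof eventually_elim
        case (elim k)
        have "(\<integral>x. x ^ n \<partial>\<mu> k) = (\<Sum>j\<le>k. w k j * (real j / real k) ^ n)"
          by (rule int_\<mu>) auto
        also have "\<dots> = (\<Sum>j\<le>k. \<Sum>i\<le>n. w k j * real (j choose i) * (binomial_coords n i / real k ^ n))"
          by (simp add: power_divide power_eq_sum_binomial sum_divide_distrib sum_distrib_left mult_ac)
        also have "\<dots> = (\<Sum>i\<le>n. (\<Sum>j\<le>k. w k j * real (j choose i)) * (binomial_coords n i / real k ^ n))"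
          unfolding sum_distrib_right by (rule sum.swap)
        also have "\<dots> = (\<Sum>i\<le>n. binomial_coords n i * L ([:0, 1:] ^ i) *
          (real (k choose i) / real k ^ i * (1 / real k) ^ (n - i)))"
        proof (intro sum.cong refl)
          fix i assume "i \<in> {..n}"
          then have "real k ^ n = real k ^ i * real k ^ (n - i)"
            by (simp flip: power_add)
          then show "(\<Sum>j\<le>k. w k j * real (j choose i)) * (binomial_coords n i / real k ^ n) =
            binomial_coords n i * L ([:0, 1:] ^ i) * (real (k choose i) / real k ^ i * (1 / real k) ^ (n - i))"
            using sum_w[of i k] elim \<open>i \<in> {..n}\<close> by (simp add: power_divide)
        qed
        finally show ?case ..
      qed
    qed
  qed
  have "tight \<mu>"
    unfolding tight_def
  proof (intro conjI allI impI)
    fix e :: real assume e: "e > 0"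
    have "measure (\<mu> k) {-1<..1} = 1" for k
    proof -
      interpret real_distribution "\<mu> k" by (rule \<mu>)
      show ?thesis
        using \<mu>01[of k] by (subst prob_eq_1) (auto elim!: eventually_mono)
    qed
    with e show "\<exists>a b. a < b \<and> (\<forall>k. 1 - e < measure (\<mu> k) {a<..b})"
      by (intro exI[of _ "-1"] exI[of _ 1]) auto
  qed (rule \<mu>)
  from tight_imp_convergent_subsubsequence[OF this strict_mono_id]
  obtain r M where r: "strict_mono (r :: nat \<Rightarrow> nat)" and M: "real_distribution M"
    and lim: "weak_conv_m (\<mu> \<circ> id \<circ> r) M" by blast
  have conv: "(\<lambda>k. \<integral>x. g x \<partial>\<mu> (r k)) \<longlonglongrightarrow> (\<integral>x. g x \<partial>M)"
    if "\<And>x. isCont g x" "\<And>x. norm (g x) \<le> B" for g :: "real \<Rightarrow> real" and B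
    using weak_conv_imp_integral_bdd_continuous_conv[OF _ M lim that] \<mu> by simp
  interpret M: real_distribution M by (rule M)
  \<comment> \<open>Weak convergence only sees bounded continuous functions, while powers are
    unbounded on the line. Clamping to [0, 1] changes nothing on the supports of the approximants,
    and integrating min 1 |x - cl x| carries the support over to the limit.\<close>
  define cl where "cl x = max 0 (min 1 x)" for x :: real
  have cl: "0 \<le> cl x" "cl x \<le> 1" "isCont cl x" "0 \<le> x \<and> x \<le> 1 \<Longrightarrow> cl x = x" for x
    unfolding cl_def by (auto intro!: continuous_intros)
  have [measurable]: "cl \<in> borel_measurable borel"
    unfolding cl_def by measurable
  have "(\<lambda>k. \<integral>x. min 1 \<bar>x - cl x\<bar> \<partial>\<mu> (r k)) \<longlonglongrightarrow> (\<integral>x. min 1 \<bar>x - cl x\<bar> \<partial>M)"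
    by (rule conv[of _ 1]) (auto intro!: continuous_intros cl)
  moreover have "(\<integral>x. min 1 \<bar>x - cl x\<bar> \<partial>\<mu> k) = 0" for k
    by (intro integral_eq_zero_AE eventually_mono[OF \<mu>01[of k]]) (simp add: cl)
  ultimately have "(\<integral>x. min 1 \<bar>x - cl x\<bar> \<partial>M) = 0"
    by (simp add: LIMSEQ_const_iff)
  moreover have "integrable M (\<lambda>x. min 1 \<bar>x - cl x\<bar>)"
    by (rule M.integrable_const_bound[of _ 1]) auto
  ultimately have "AE x in M. min 1 \<bar>x - cl x\<bar> = 0"
    by (subst (asm) integral_nonneg_eq_0_iff_AE) auto
  then have AE: "AE x in M. 0 \<le> x \<and> x \<le> 1"
  proof eventually_elim
    case (elim x)
    then have "x = cl x" by (auto simp: min_def split: if_splits)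
    then show ?case using cl(1)[of x] cl(2)[of x] by simp
  qed
  show ?thesis
  proof (rule that[OF M AE])
    fix n
    have "(\<lambda>k. \<integral>x. cl x ^ n \<partial>\<mu> (r k)) \<longlonglongrightarrow> (\<integral>x. cl x ^ n \<partial>M)"
      by (rule conv[of _ 1]) (use cl in \<open>auto intro!: continuous_intros power_le_one simp: power_abs\<close>)
    moreover have "(\<integral>x. cl x ^ n \<partial>\<mu> k) = (\<integral>x. x ^ n \<partial>\<mu> k)" for k
      by (intro integral_cong_AE eventually_mono[OF \<mu>01[of k]]) (simp_all add: cl \<mu>_def)
    moreover have "(\<integral>x. cl x ^ n \<partial>M) = (\<integral>x. x ^ n \<partial>M)"
      by (intro integral_cong_AE eventually_mono[OF AE]) (simp_all add: cl)
    ultimately show "(\<integral>x. x ^ n \<partial>M) = L ([:0, 1:] ^ n)"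
      using LIMSEQ_unique[OF _ LIMSEQ_subseq_LIMSEQ[OF moments[of n] r, unfolded o_def]] by simp
  qed
qed

lemma bounded_integrable_poly:
  fixes M :: "real measure"
  assumes "finite_measure M" "sets M = sets borel" "AE x in M. \<bar>x\<bar> \<le> C"
  shows "integrable M (\<lambda>x. poly p x)"
proof -
  interpret finite_measure M by fact
  have cont: "continuous_on X (poly p)" for X
    by (intro continuous_at_imp_continuous_on) auto
  have "bounded (poly p ` {-C..C})"
    by (intro compact_imp_bounded compact_continuous_image cont compact_Icc)
  then obtain B where "\<And>x. x \<in> {-C..C} \<Longrightarrow> norm (poly p x) \<le> B"
    unfolding bounded_iff by blast
  then have "AE x in M. norm (poly p x) \<le> B"
    by (intro eventually_mono[OF assms(3)]) (simp add: abs_le_iff)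
  moreover have "poly p \<in> borel_measurable M"
    unfolding measurable_cong_sets[OF assms(2) refl] by (intro borel_measurable_continuous_onI cont)
  ultimately show ?thesis
    by (rule integrable_const_bound)
qed

text \<open>For a support in [-C, C] the Taylor remainder of the characteristic function is at most
  2 (C |t|)^n / n!, so the moments determine it, and by Levy's theorem the distribution.\<close>

lemma real_distribution_moments_unique:
  assumes "real_distribution M1" "real_distribution M2"
    and "AE x in M1. \<bar>x\<bar> \<le> C" "AE x in M2. \<bar>x\<bar> \<le> C"
    and eq: "\<And>n. (\<integral>x. x ^ n \<partial>M1) = (\<integral>x. x ^ n \<partial>M2)"
  shows "M1 = M2"
proof (rule Levy_uniqueness[OF assms(1,2)], rule ext)
  fix t :: real
  define e where "e n = 2 * ((\<bar>C\<bar> * \<bar>t\<bar>) ^ n / fact n)" for n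
  have approx: "cmod (char M t - (\<Sum>k\<le>n. ((\<i> * t) ^ k / fact k) * (\<integral>x. x ^ k \<partial>M))) \<le> e n"
    if M: "real_distribution M" and b: "AE x in M. \<bar>x\<bar> \<le> C" for M n
  proof -
    interpret real_distribution M by fact
    have int: "integrable M (\<lambda>x. x ^ k)" for k
      using bounded_integrable_poly[OF _ _ b, of "monom 1 k"] 
      by (simp add: poly_monom finite_measure_axioms)
    have "AE x in M. \<bar>x\<bar> ^ n \<le> \<bar>C\<bar> ^ n"
      by (intro eventually_mono[OF b] power_mono) auto
    then have "(\<integral>x. \<bar>x\<bar> ^ n \<partial>M) \<le> (\<integral>x. \<bar>C\<bar> ^ n \<partial>M)"
      using integrable_abs[OF int[of n]] by (intro integral_mono_AE) (auto simp: power_abs)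
    then have "(\<integral>x. \<bar>x\<bar> ^ n \<partial>M) \<le> \<bar>C\<bar> ^ n"
      using prob_space by simp
    then have "(2 * \<bar>t\<bar> ^ n / fact n) * (\<integral>x. \<bar>x\<bar> ^ n \<partial>M) \<le> (2 * \<bar>t\<bar> ^ n / fact n) * \<bar>C\<bar> ^ n"
      by (intro mult_left_mono) auto
    also have "\<dots> = e n"
      by (simp add: e_def power_mult_distrib)
    finally show ?thesis
      using char_approx1[of n t, OF int] by linarith
  qed
  have "cmod (char M1 t - char M2 t) \<le> e n + e n" for n
    using approx[OF assms(1,3), of n] approx[OF assms(2,4), of n]
      dist_triangle2[of "char M1 t" "char M2 t" "\<Sum>k\<le>n. ((\<i> * t) ^ k / fact k) * (\<integral>x. x ^ k \<partial>M2)"]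
    unfolding eq dist_norm by linarith
  moreover have "e \<longlonglongrightarrow> 0"
    using tendsto_mult_right_zero[OF summable_LIMSEQ_zero[OF summable_exp[of "\<bar>C\<bar> * \<bar>t\<bar>"]], of 2]
    by (simp add: e_def[abs_def] divide_inverse mult_ac)
  ultimately have "cmod (char M1 t - char M2 t) \<le> 0 + 0"
    by (intro LIMSEQ_le_const[OF tendsto_add]) auto
  then show "char M1 t = char M2 t"
    by simp
qed

section \<open>Spectral measures\<close>

lemma integral_poly_eqI:
  fixes L :: "real poly \<Rightarrow> real"
  assumes "finite_measure M1" "sets M1 = sets borel" "AE x in M1. \<bar>x\<bar> \<le> C1"
    and add: "\<And>p q. L (p + q) = L p + L q" and scale: "\<And>c p. L (Polynomial.smult c p) = c * L p"
    and eq: "\<And>n. (\<integral>x. x ^ n \<partial>M1) = L ([:0, 1:] ^ n)"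
  shows "(\<integral>x. poly p x \<partial>M1) = L p"
proof (induction p rule: poly_power_induct)
  case zero
  show ?case using scale[of 0 0] by simp
next
  case (add p q)
  then show ?case
    using bounded_integrable_poly[OF assms(1-3)] by (simp add: assms(4))
next
  case (power c n)
  then show ?case
    by (simp add: scale eq)
qed

text \<open>The zeroth moments equate the total masses, so both measures can be normalised by the
  same factor; mass zero is treated apart.\<close>

lemma finite_moments_unique:
  fixes M1 M2 :: "real measure"
  assumes M1: "finite_measure M1" "sets M1 = sets borel" "AE x in M1. \<bar>x\<bar> \<le> C"
    and M2: "finite_measure M2" "sets M2 = sets borel" "AE x in M2. \<bar>x\<bar> \<le> C"
    and eq: "\<And>n. (\<integral>x. x ^ n \<partial>M1) = (\<integral>x. x ^ n \<partial>M2)"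
  shows "M1 = M2"
proof -
  interpret M1: finite_measure M1 by fact
  interpret M2: finite_measure M2 by fact
  have sp: "space M1 = UNIV" "space M2 = UNIV"
    using sets_eq_imp_space_eq[OF M1(2)] sets_eq_imp_space_eq[OF M2(2)] by auto
  define m where "m = measure M1 UNIV"
  have m2: "measure M2 UNIV = m"
    using eq[of 0] by (simp add: m_def sp)
  show ?thesis
  proof (cases "m = 0")
    case True
    have "emeasure M1 X = 0" "emeasure M2 X = 0" for X
      using True m2 emeasure_mono[of X UNIV M1] emeasure_mono[of X UNIV M2] sets.top[of M1] sets.top[of M2]
      by (auto simp: m_def M1.emeasure_eq_measure M2.emeasure_eq_measure sp measure_le_0_iff
          intro: antisym[OF order_trans[OF M1.bounded_measure] measure_nonneg]
            antisym[OF order_trans[OF M2.bounded_measure] measure_nonneg])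
    then show ?thesis
      by (intro measure_eqI) (simp_all add: M1(2) M2(2))
  next
    case False
    then have m: "m > 0"
      by (simp add: m_def zero_less_measure_iff)
    define N where "N M = density M (\<lambda>_. ennreal (1 / m))" for M :: "real measure"
    have N: "real_distribution (N M)" "AE x in N M. \<bar>x\<bar> \<le> C" "(\<integral>x. x ^ n \<partial>N M) = (1 / m) * (\<integral>x. x ^ n \<partial>M)"
      "X \<in> sets M \<Longrightarrow> emeasure (N M) X = ennreal (1 / m) * emeasure M X"
      if M: "finite_measure M" "sets M = sets borel" "AE x in M. \<bar>x\<bar> \<le> C" "measure M UNIV = m" for M n X
    proof -
      interpret finite_measure M by fact
      have sp: "space M = UNIV"
        using sets_eq_imp_space_eq[OF M(2)] by auto
      show em: "X \<in> sets M \<Longrightarrow> emeasure (N M) X = ennreal (1 / m) * emeasure M X" for X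
        by (simp add: N_def emeasure_density_const)
      have "emeasure (N M) UNIV = 1"
        using em[of UNIV] sets.top[of M] m
        by (simp add: sp emeasure_eq_measure M(4) ennreal_mult'[symmetric])
      then have "prob_space (N M)"
        by (intro prob_spaceI) (simp add: N_def sp)
      then show "real_distribution (N M)"
        by (simp add: real_distribution_def real_distribution_axioms_def N_def M(2))
      show "AE x in N M. \<bar>x\<bar> \<le> C"
        unfolding N_def using M(3) m by (subst AE_density) (auto elim: eventually_mono)
      show "(\<integral>x. x ^ n \<partial>N M) = (1 / m) * (\<integral>x. x ^ n \<partial>M)"
        unfolding N_def using m by (subst integral_density) (auto simp: measurable_cong_sets[OF M(2) refl])
    qed
    have "N M1 = N M2"
      using N[OF M1] N[OF M2] m2 eq by (intro real_distribution_moments_unique) (auto simp: m_def)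
    then have "ennreal (1 / m) * emeasure M1 X = ennreal (1 / m) * emeasure M2 X" if "X \<in> sets M1" for X
      using N(4)[OF M1, of X] N(4)[OF M2 m2, of X] that by (simp add: m_def M1(2) M2(2))
    then have "emeasure M1 X = emeasure M2 X" if "X \<in> sets M1" for X
      using that m by (simp add: ennreal_mult_cancel_left)
    then show ?thesis
      by (intro measure_eqI) (simp_all add: M1(2) M2(2))
  qed
qed

text \<open>The polynomials \<open>(1 - q / B) ^ k\<close> concentrate where \<open>q\<close> is small.\<close>
lemma AE_poly_ge:
  fixes M :: "real measure"
  assumes M: "finite_measure M" "sets M = sets borel" "AE x in M. \<bar>x\<bar> \<le> C"
    and q: "\<And>x. 0 \<le> poly q x" and c: "c > 0"
    and le: "\<And>p. c * (\<integral>x. (poly p x)\<^sup>2 \<partial>M) \<le> (\<integral>x. poly q x * (poly p x)\<^sup>2 \<partial>M)"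
  shows "AE x in M. c / 2 \<le> poly q x"
proof -
  interpret finite_measure M by fact
  have sp: "space M = UNIV"
    using sets_eq_imp_space_eq[OF M(2)] by auto
  note int = bounded_integrable_poly[OF M]
  have meas [measurable]: "poly p \<in> borel_measurable M" for p
    using int by (rule borel_measurable_integrable)
  have "bounded (poly q ` {-C..C})"
    by (intro compact_imp_bounded compact_continuous_image continuous_at_imp_continuous_on compact_Icc) auto
  then obtain B0 where B0: "\<And>x. x \<in> {-C..C} \<Longrightarrow> norm (poly q x) \<le> B0"
    unfolding bounded_iff by blast
  define B where "B = max B0 (2 * c)"
  have B: "B > 0" "B \<ge> 2 * c" "\<And>x. \<bar>x\<bar> \<le> C \<Longrightarrow> poly q x \<le> B"
  proof -
    show "\<bar>x\<bar> \<le> C \<Longrightarrow> poly q x \<le> B" for x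
      using B0[of x] by (auto simp: B_def abs_le_iff)
  qed (use c in \<open>auto simp: B_def\<close>)
  define N where "N = {x. poly q x < c / 2}"
  have N: "N \<in> sets M"
    unfolding N_def M(2)
    by (intro borel_open open_Collect_less continuous_at_imp_continuous_on) auto
  \<comment> \<open>1 - q/B exceeds r where q < c/2 and lies between 0 and s < r where q > c. In the
    integral of (c - q) p^2, which is at most 0, the contribution of N is at least of order r^(2k)
    and the negative part at most of order s^(2k); this forces N to be null.\<close>
  define r where "r = 1 - c / (2 * B)"
  define s where "s = 1 - c / B"
  have rs: "0 \<le> s" "s < r" "0 < r"
    using B c by (auto simp: r_def s_def field_simps)
  have main: "c / 2 * r ^ (2 * k) * measure M N \<le> B * s ^ (2 * k) * measure M UNIV" for k
  proof -
    define p where "p = (1 - Polynomial.smult (1 / B) q) ^ k"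
    have p: "(poly p x)\<^sup>2 = (1 - poly q x / B) ^ (2 * k)" for x
      by (simp add: p_def poly_power power_mult mult.commute[of 2])
    have "AE x in M. c / 2 * r ^ (2 * k) * indicator N x - B * s ^ (2 * k) \<le> (c - poly q x) * (poly p x)\<^sup>2"
      using M(3)
    proof eventually_elim
      case (elim x)
      define y where "y = poly q x"
      have y: "0 \<le> y" "y \<le> B" using B(3)[OF elim] q by (auto simp: y_def)
      have Bs: "0 \<le> B * s ^ (2 * k)" using B rs by simp
      have pw: "0 \<le> (1 - y / B) ^ (2 * k)" by simp
      have "c / 2 * r ^ (2 * k) * indicator N x - B * s ^ (2 * k) \<le> (c - y) * (1 - y / B) ^ (2 * k)"
      proof (cases "x \<in> N")
        case True
        then have y2: "y < c / 2" by (simp add: N_def y_def)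
        have "r ^ (2 * k) \<le> (1 - y / B) ^ (2 * k)"
          using y2 rs(3) B(1) by (intro power_mono) (auto simp: r_def field_simps)
        then have "c / 2 * r ^ (2 * k) \<le> (c - y) * (1 - y / B) ^ (2 * k)"
          using y2 c rs by (intro mult_mono) auto
        then show ?thesis using True Bs by simp
      next
        case False
        show ?thesis
        proof (cases "y \<le> c")
          case True
          then have "0 \<le> (c - y) * (1 - y / B) ^ (2 * k)"
            using pw by (intro mult_nonneg_nonneg) auto
          then show ?thesis using False Bs by simp
        next
          case False': False
          have "(1 - y / B) ^ (2 * k) \<le> s ^ (2 * k)"
            using False' y B(1) by (intro power_mono) (auto simp: s_def field_simps)
          then have "(y - c) * (1 - y / B) ^ (2 * k) \<le> B * s ^ (2 * k)"
            using False' y pw c by (intro mult_mono) auto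
          then show ?thesis using False by (simp add: algebra_simps)
        qed
      qed
      then show ?case by (simp add: p y_def)
    qed
    moreover have i1: "integrable M (\<lambda>x. c / 2 * r ^ (2 * k) * indicator N x)"
      using N by (intro integrable_mult_right integrable_real_indicator) (auto simp: less_top[symmetric])
    moreover have i2: "integrable M (\<lambda>x. (c - poly q x) * (poly p x)\<^sup>2)"
      using int[of "([:c:] - q) * p\<^sup>2"] by simp
    ultimately have "(\<integral>x. c / 2 * r ^ (2 * k) * indicator N x - B * s ^ (2 * k) \<partial>M)
        \<le> (\<integral>x. (c - poly q x) * (poly p x)\<^sup>2 \<partial>M)"
      by (intro integral_mono_AE) auto
    also have "\<dots> = c * (\<integral>x. (poly p x)\<^sup>2 \<partial>M) - (\<integral>x. poly q x * (poly p x)\<^sup>2 \<partial>M)"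
      using int[of "p\<^sup>2"] int[of "q * p\<^sup>2"] by (simp add: left_diff_distrib)
    also have "\<dots> \<le> 0" using le[of p] by simp
    also have "(\<integral>x. c / 2 * r ^ (2 * k) * indicator N x - B * s ^ (2 * k) \<partial>M)
        = c / 2 * r ^ (2 * k) * measure M N - B * s ^ (2 * k) * measure M UNIV"
      using i1 N by (subst Bochner_Integration.integral_diff) (auto simp: sp)
    finally show ?thesis by simp
  qed
  have "c / 2 * measure M N \<le> B * measure M UNIV * ((s / r)\<^sup>2) ^ k" for k
    using main[of k, unfolded power_mult] rs by (simp add: field_simps power_divide)
  moreover have "(\<lambda>k. B * measure M UNIV * ((s / r)\<^sup>2) ^ k) \<longlonglongrightarrow> B * measure M UNIV * 0"
    using rs by (intro tendsto_intros LIMSEQ_power_zero) (simp add: abs_square_less_1)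
  ultimately have "c / 2 * measure M N \<le> B * measure M UNIV * 0"
    by (intro LIMSEQ_le_const) auto
  then have "measure M N = 0"
    using c measure_nonneg[of M N] by (simp add: mult_le_0_iff)
  then have "N \<in> null_sets M"
    using N by (simp add: null_sets_def emeasure_eq_measure)
  then show ?thesis
    by (rule AE_I') (auto simp: N_def)
qed

section \<open>Polynomials of the operator in terms of a spectral measure\<close>

context bounded_symmetric
begin

lemma spectral_integral:
  assumes f: "f \<in> ell2 V" and M: "is_spectral_measure V A f M"
  shows "ell2_inner V (op_poly A p f) f = of_real (\<integral>x. poly p x \<partial>M)"
proof -
  obtain C where C: "AE x in M. \<bar>x\<bar> \<le> C"
    using M by (auto simp: is_spectral_measure_def)
  have eq: "ell2_inner V ((A ^^ n) f) f = complex_of_real (\<integral>x. x ^ n \<partial>M)" for n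
    using M by (auto simp: is_spectral_measure_def)
  have i: "integrable M (poly p)" for p
    using M C by (intro bounded_integrable_poly) (auto simp: is_spectral_measure_def)
  show ?thesis
  proof (induction p rule: poly_power_induct)
    case (add p q)
    then show ?case
      using ell2_inner_lincomb_left[OF op_poly_ell2[OF f] op_poly_ell2[OF f] f, of 1 p 1 q] i
      by (simp add: op_poly_add[OF lin])
  next
    case (power c n)
    show ?case
      using ell2_inner_lincomb_left[OF op_poly_ell2[OF f] f f, of "of_real c" "[:0, 1:] ^ n" 0] eq[of n]
      by (simp add: op_poly_smult[OF lin] op_poly_X_power[OF lin])
  qed simp
qed

lemma spectral_norm:
  assumes f: "f \<in> ell2 V" and M: "is_spectral_measure V A f M"
  shows "(ell2_norm V (op_poly A p f))\<^sup>2 = (\<integral>x. (poly p x)\<^sup>2 \<partial>M)"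
proof -
  have "complex_of_real ((ell2_norm V (op_poly A p f))\<^sup>2) = of_real (\<integral>x. poly (p * p) x \<partial>M)"
    unfolding spectral_integral[OF f M, symmetric] inner_power2[OF f, symmetric]
    by (rule ell2_inner_self[OF op_poly_ell2[OF f], symmetric])
  then show ?thesis
    unfolding of_real_eq_iff by (simp add: power2_eq_square poly_mult[abs_def])
qed

lemma spectral_norm_shift:
  assumes f: "f \<in> ell2 V" and M: "is_spectral_measure V A f M"
  shows "(ell2_norm V (\<lambda>x. A (op_poly A p f) x - z * op_poly A p f x))\<^sup>2
    = (\<integral>x. poly (dist_poly z) x * (poly p x)\<^sup>2 \<partial>M)"
proof -
  have "complex_of_real ((ell2_norm V (\<lambda>x. A (op_poly A p f) x - z * op_poly A p f x))\<^sup>2)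
    = of_real (\<integral>x. poly (p * (dist_poly z * p)) x \<partial>M)"
    unfolding spectral_integral[OF f M, symmetric] inner_power2[OF f, symmetric]
    using norm_shift_power2[OF op_poly_ell2[OF f], of z p] by (simp add: op_poly_mult[OF lin])
  then show ?thesis
    unfolding of_real_eq_iff by (simp add: power2_eq_square mult_ac poly_mult[abs_def])
qed

text \<open>Sending p(A) f to p is isometric into the square-integrable functions of M and turns A -
  z into multiplication by x - z, so the estimate is asked of the vectors p(A) f. It becomes an
  integral inequality for p^2, by which M cannot charge the points near z.\<close>

lemma spectral_measure_away:
  assumes f: "f \<in> ell2 V" and M: "is_spectral_measure V A f M" and c: "c > 0"
    and below: "\<And>p. c * ell2_norm V (op_poly A p f) \<le> ell2_norm V (\<lambda>x. A (op_poly A p f) x - z * op_poly A p f x)"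
  shows "AE x in M. c\<^sup>2 / 2 \<le> poly (dist_poly z) x"
proof -
  obtain C where C: "AE x in M. \<bar>x\<bar> \<le> C"
    using M by (auto simp: is_spectral_measure_def)
  show ?thesis
  proof (rule AE_poly_ge[OF _ _ C])
    fix p
    show "c\<^sup>2 * (\<integral>x. (poly p x)\<^sup>2 \<partial>M) \<le> (\<integral>x. poly (dist_poly z) x * (poly p x)\<^sup>2 \<partial>M)"
      using power_mono[OF below[of p], of 2] c
      by (simp add: power_mult_distrib spectral_norm[OF f M] spectral_norm_shift[OF f M])
  qed (use M c in \<open>auto simp: is_spectral_measure_def poly_dist_poly\<close>)
qed

text \<open>The polynomials (1 - (x - \<mu>)^2 / B)^k equal 1 at \<mu>, so their operators fix e,
  and they tend to 0 elsewhere on the support of M. As M does not charge the point \<mu>, dominated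
  convergence sends p_k(A) f to 0 while its inner product with e remains <f, e>.\<close>

lemma inner_eigenvector_zero:
  assumes f: "f \<in> ac_subspace V A" and e: "e \<in> ell2 V" "A e = (\<lambda>x. of_real \<mu> * e x)"
  shows "ell2_inner V f e = 0"
proof -
  from f obtain M where M: "is_spectral_measure V A f M" "absolutely_continuous lborel M" and f: "f \<in> ell2 V"
    by (auto simp: ac_subspace_def)
  obtain C where C: "AE x in M. \<bar>x\<bar> \<le> C" and fin: "finite_measure M" and sets: "sets M = sets borel"
    using M by (auto simp: is_spectral_measure_def)
  interpret finite_measure M by fact
  define B where "B = (\<bar>C\<bar> + \<bar>\<mu>\<bar>)\<^sup>2 + 1"
  have B: "B > 0" by (simp add: B_def add_nonneg_pos)
  have rng: "0 \<le> 1 - (x - \<mu>)\<^sup>2 / B \<and> 1 - (x - \<mu>)\<^sup>2 / B \<le> 1" if "\<bar>x\<bar> \<le> C" for x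
  proof -
    have "\<bar>x - \<mu>\<bar>\<^sup>2 \<le> (\<bar>C\<bar> + \<bar>\<mu>\<bar>)\<^sup>2"
      using that by (intro power_mono) auto
    then show ?thesis using B by (simp add: B_def)
  qed
  define p where "p k = (1 - Polynomial.smult (1 / B) ([:-\<mu>, 1:]\<^sup>2)) ^ k" for k :: nat
  have p: "poly (p k) x = (1 - (x - \<mu>)\<^sup>2 / B) ^ k" for k x
    by (simp add: p_def poly_power)
  have le: "cmod (ell2_inner V f e) \<le> ell2_norm V (op_poly A (p k) f) * ell2_norm V e" for k
  proof -
    have "ell2_inner V (op_poly A (p k) f) e = ell2_inner V f (op_poly A (p k) e)"
      using f e by (intro op_poly_sym) auto
    also have "op_poly A (p k) e = e"
      unfolding op_poly_eigenvector[OF lin e(2)] by (simp add: p)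
    finally show ?thesis
      using ell2_Cauchy_Schwarz[OF op_poly_ell2[OF f] e(1)] by metis
  qed
  have "{\<mu>} \<in> null_sets M"
    using M(2) finite_imp_null_set_lborel[of "{\<mu>}"] unfolding absolutely_continuous_def by blast
  then have ne: "AE x in M. x \<noteq> \<mu>"
    by (rule AE_I') auto
  have "(\<lambda>k. \<integral>x. (poly (p k) x)\<^sup>2 \<partial>M) \<longlonglongrightarrow> (\<integral>x. 0 \<partial>M)"
  proof (rule integral_dominated_convergence[where w = "\<lambda>_. 1"])
    show "AE x in M. (\<lambda>k. (poly (p k) x)\<^sup>2) \<longlonglongrightarrow> 0"
      using ne C
    proof eventually_elim
      case (elim x)
      have "(x - \<mu>)\<^sup>2 / B > 0" using elim B by auto
      then have "(\<lambda>k. poly (p k) x) \<longlonglongrightarrow> 0"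
        unfolding p using rng[OF elim(2)] by (intro LIMSEQ_power_zero) auto
      then have "(\<lambda>k. (poly (p k) x)\<^sup>2) \<longlonglongrightarrow> 0\<^sup>2"
        by (rule tendsto_power)
      then show ?case by simp
    qed
    show "AE x in M. norm ((poly (p k) x)\<^sup>2) \<le> 1" for k
      using C by eventually_elim (use rng in \<open>auto simp: p power_le_one\<close>)
  qed (use sets in \<open>auto simp: measurable_cong_sets[OF sets refl] intro!: borel_measurable_power
      borel_measurable_continuous_onI continuous_at_imp_continuous_on\<close>)
  then have "(\<lambda>k. (ell2_norm V (op_poly A (p k) f))\<^sup>2) \<longlonglongrightarrow> 0"
    unfolding spectral_norm[OF f M(1)] by simp
  then have "(\<lambda>k. sqrt ((ell2_norm V (op_poly A (p k) f))\<^sup>2)) \<longlonglongrightarrow> sqrt 0"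
    by (rule tendsto_real_sqrt)
  then have "(\<lambda>k. ell2_norm V (op_poly A (p k) f) * ell2_norm V e) \<longlonglongrightarrow> 0 * ell2_norm V e"
    by (intro tendsto_intros) simp
  then have "cmod (ell2_inner V f e) \<le> 0 * ell2_norm V e"
    by (rule LIMSEQ_le_const) (use le in auto)
  then show ?thesis by simp
qed

end

section \<open>Invariance of the absolutely continuous subspace by change of density\<close>

lemma
  fixes M :: "real measure" and g :: "real \<Rightarrow> real"
  assumes M: "finite_measure M" "sets M = sets borel" "AE x in M. \<bar>x\<bar> \<le> C"
    and w: "w \<in> borel_measurable borel" "\<And>x. 0 \<le> w x" "AE x in M. w x \<le> W"
  defines "N \<equiv> density M (\<lambda>x. ennreal (w x))"
  shows finite_measure_weighted: "finite_measure N" and sets_weighted: "sets N = sets borel"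
    and AE_weighted: "AE x in N. \<bar>x\<bar> \<le> C"
    and ac_weighted: "absolutely_continuous lborel M \<Longrightarrow> absolutely_continuous lborel N"
    and integral_weighted: "g \<in> borel_measurable borel \<Longrightarrow> (\<integral>x. g x \<partial>N) = (\<integral>x. w x * g x \<partial>M)"
proof -
  interpret finite_measure M by fact
  have wM: "w \<in> borel_measurable M"
    using w(1) unfolding measurable_cong_sets[OF M(2) refl] .
  have "emeasure N (space N) = (\<integral>\<^sup>+x. ennreal (w x) \<partial>M)"
    unfolding N_def space_density using wM
    by (subst emeasure_density[OF measurable_compose[OF wM measurable_ennreal] sets.top])
      (simp cong: nn_integral_cong)
  also have "\<dots> \<le> (\<integral>\<^sup>+x. ennreal W \<partial>M)"
    by (intro nn_integral_mono_AE eventually_mono[OF w(3)] ennreal_leI)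
  also have "\<dots> < \<infinity>"
    by (simp add: emeasure_eq_measure ennreal_mult_less_top)
  finally show "finite_measure N"
    by (intro finite_measureI) auto
  show "sets N = sets borel"
    by (simp add: N_def M(2))
  show "AE x in N. \<bar>x\<bar> \<le> C"
    unfolding N_def by (subst AE_density[OF measurable_compose[OF wM measurable_ennreal]])
      (auto intro: eventually_mono[OF M(3)])
  show "absolutely_continuous lborel N" if "absolutely_continuous lborel M"
    using that absolutely_continuousI_density[OF measurable_compose[OF wM measurable_ennreal]]
    unfolding absolutely_continuous_def N_def by blast
  show "(\<integral>x. g x \<partial>N) = (\<integral>x. w x * g x \<partial>M)" if "g \<in> borel_measurable borel"
    unfolding N_def using w(2) wM that
    by (subst integral_density) (auto simp: measurable_cong_sets[OF M(2) refl])
qed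

context bounded_symmetric
begin

text \<open>All moments of (A - z) f are those of f against the density |x - z|^2. This is the
  source of \<open>ac_shift\<close> and, read backwards, of \<open>ac_shift_inverse\<close>.\<close>

lemma inner_shift:
  assumes f: "f \<in> ell2 V"
  shows "ell2_inner V (op_poly A p (\<lambda>x. A f x - z * f x)) (\<lambda>x. A f x - z * f x)
    = ell2_inner V (op_poly A (dist_poly z * p) f) f"
proof -
  let ?h = "\<lambda>x. A f x - z * f x"
  note opl = op_poly_linear[OF lin]
  have u: "op_poly A p f \<in> ell2 V" by (rule op_poly_ell2[OF f])
  have "op_poly A p ?h = (\<lambda>x. A (op_poly A p f) x - z * op_poly A p f x)"
    by (simp add: linear_op_diff[OF opl] linear_op_scale[OF opl] op_poly_commute[OF lin lin])
  then have "ell2_inner V (op_poly A p ?h) ?h = ell2_inner V (op_poly A p f) (\<lambda>x. A ?h x - cnj z * ?h x)"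
    using shift_adjoint[OF u shift_ell2[OF f], of z z] by simp
  also have "(\<lambda>x. A ?h x - cnj z * ?h x) = op_poly A (dist_poly z) f"
    using op_poly_dist_poly[OF lin, of "cnj z" f] by simp
  also have "ell2_inner V (op_poly A p f) \<dots> = ell2_inner V (op_poly A (dist_poly z * p) f) f"
    by (rule inner_power2[OF f])
  finally show ?thesis .
qed

lemma ac_shift:
  assumes f: "f \<in> ac_subspace V A"
  shows "(\<lambda>x. A f x - z * f x) \<in> ac_subspace V A"
proof -
  from f obtain M where M: "is_spectral_measure V A f M" "absolutely_continuous lborel M" and f: "f \<in> ell2 V"
    by (auto simp: ac_subspace_def)
  obtain C where C: "AE x in M. \<bar>x\<bar> \<le> C" and fin: "finite_measure M" and sets: "sets M = sets borel"
    using M by (auto simp: is_spectral_measure_def)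
  let ?w = "poly (dist_poly z)"
  have cont: "continuous_on X ?w" for X
    by (intro continuous_at_imp_continuous_on) auto
  have "bounded (?w ` {-C..C})"
    by (intro compact_imp_bounded compact_continuous_image cont compact_Icc)
  then obtain W where W: "\<And>x. x \<in> {-C..C} \<Longrightarrow> norm (?w x) \<le> W"
    unfolding bounded_iff by blast
  have w: "?w \<in> borel_measurable borel" "\<And>x. 0 \<le> ?w x"
    by (auto simp: poly_dist_poly intro: borel_measurable_continuous_onI cont)
  have wW: "AE x in M. ?w x \<le> W"
  proof (rule eventually_mono[OF C])
    show "\<bar>x\<bar> \<le> C \<Longrightarrow> ?w x \<le> W" for x
      using W[of x] by (auto simp: abs_le_iff)
  qed
  note wt = finite_measure_weighted[OF fin sets C w wW] sets_weighted[OF fin sets C w wW]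
    AE_weighted[OF fin sets C w wW] ac_weighted[OF fin sets C w wW M(2)] integral_weighted[OF fin sets C w wW]
  let ?N = "density M (\<lambda>x. ennreal (?w x))"
  let ?h = "\<lambda>x. A f x - z * f x"
  have "ell2_inner V ((A ^^ n) ?h) ?h = of_real (\<integral>x. x ^ n \<partial>?N)" for n
  proof -
    have "ell2_inner V ((A ^^ n) ?h) ?h = ell2_inner V (op_poly A (dist_poly z * [:0, 1:] ^ n) f) f"
      unfolding op_poly_X_power[OF lin, symmetric] by (rule inner_shift[OF f])
    also have "\<dots> = of_real (\<integral>x. ?w x * x ^ n \<partial>M)"
      unfolding spectral_integral[OF f M(1)] by (simp add: poly_mult[abs_def] poly_power)
    also have "(\<integral>x. ?w x * x ^ n \<partial>M) = (\<integral>x. x ^ n \<partial>?N)"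
      by (rule wt(5)[symmetric]) auto
    finally show ?thesis .
  qed
  then have "is_spectral_measure V A ?h ?N"
    using wt(1-3) by (auto simp: is_spectral_measure_def)
  then show ?thesis
    using wt(4) shift_ell2[OF f] by (auto simp: ac_subspace_def)
qed

text \<open>The candidate measure is that of g = (A - z) f divided by |x - z|^2, which is bounded
  away from 0 almost everywhere. As 1/|x - z|^2 is no polynomial, the moments are matched through
  polynomials approximating it: the error is controlled by the contraction T on the operator side
  and by dominated convergence on the side of the measure.\<close>

lemma ac_shift_inverse:
  assumes f: "f \<in> ell2 V" and g: "(\<lambda>x. A f x - z * f x) \<in> ac_subspace V A"
    and c: "c > 0" and below: "\<And>f. f \<in> ell2 V \<Longrightarrow> c * ell2_norm V f \<le> ell2_norm V (\<lambda>x. A f x - z * f x)"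
  shows "f \<in> ac_subspace V A"
proof -
  let ?g = "\<lambda>x. A f x - z * f x"
  let ?Q = "poly (dist_poly z)"
  from g obtain M where M: "is_spectral_measure V A ?g M" "absolutely_continuous lborel M" and g: "?g \<in> ell2 V"
    by (auto simp: ac_subspace_def)
  obtain C where C: "AE x in M. \<bar>x\<bar> \<le> C" and fin: "finite_measure M" and sets: "sets M = sets borel"
    using M by (auto simp: is_spectral_measure_def)
  interpret finite_measure M by fact
  have away: "AE x in M. c\<^sup>2 / 2 \<le> ?Q x"
    by (rule spectral_measure_away[OF g M(1) c]) (rule below, rule op_poly_ell2[OF g])
  \<comment> \<open>The maximum leaves the density unchanged almost everywhere but makes it bounded
    at every point.\<close>
  define w where "w x = 1 / max (c\<^sup>2 / 2) (?Q x)" for x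
  have cont: "continuous_on X ?Q" for X
    by (intro continuous_at_imp_continuous_on) auto
  have [measurable]: "?Q \<in> borel_measurable borel"
    by (intro borel_measurable_continuous_onI cont)
  have w: "w \<in> borel_measurable borel" "\<And>x. 0 \<le> w x"
    using c by (auto simp: w_def[abs_def] poly_dist_poly le_max_iff_disj)
  have wW: "AE x in M. w x \<le> 2 / c\<^sup>2"
  proof (intro AE_I2)
    fix x
    have "1 / max (c\<^sup>2 / 2) (?Q x) \<le> 1 / (c\<^sup>2 / 2)"
      using c by (intro divide_left_mono mult_pos_pos) (auto simp: less_max_iff_disj)
    then show "w x \<le> 2 / c\<^sup>2" by (simp add: w_def)
  qed
  note wt = finite_measure_weighted[OF fin sets C w wW] sets_weighted[OF fin sets C w wW]
    AE_weighted[OF fin sets C w wW] ac_weighted[OF fin sets C w wW M(2)] integral_weighted[OF fin sets C w wW]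
  let ?N = "density M (\<lambda>x. ennreal (w x))"
  have "bounded (?Q ` {-C..C})"
    by (intro compact_imp_bounded compact_continuous_image cont compact_Icc)
  then obtain W where W: "\<And>x. x \<in> {-C..C} \<Longrightarrow> norm (?Q x) \<le> W"
    unfolding bounded_iff by blast
  obtain \<kappa>0 where \<kappa>0: "\<kappa>0 > 0" "\<And>\<kappa>. \<kappa> \<ge> \<kappa>0 \<Longrightarrow> \<exists>q. 0 \<le> q \<and> q < 1 \<and>
      (\<forall>f\<in>ell2 V. ell2_norm V (op_poly A (1 - Polynomial.smult (1 / \<kappa>) (dist_poly z)) f) \<le> q * ell2_norm V f)"
    using contraction[OF c below] by metis
  \<comment> \<open>Besides the contraction property, \<kappa> must dominate |x - z|^2 on [-C, C],
    so that T takes values in [0, 1] there and its powers are dominated.\<close>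
  define \<kappa> where "\<kappa> = max \<kappa>0 W"
  have \<kappa>: "\<kappa> > 0" "\<kappa> \<ge> \<kappa>0" "\<kappa> \<ge> W" using \<kappa>0(1) by (auto simp: \<kappa>_def)
  define T where "T = 1 - Polynomial.smult (1 / \<kappa>) (dist_poly z)"
  obtain q where q: "0 \<le> q" "q < 1" "\<And>f. f \<in> ell2 V \<Longrightarrow> ell2_norm V (op_poly A T f) \<le> q * ell2_norm V f"
    unfolding T_def using \<kappa>0(2)[OF \<kappa>(2)] by blast
  have T: "poly T x = 1 - ?Q x / \<kappa>" for x by (simp add: T_def)
  have T01: "0 \<le> poly T x \<and> poly T x \<le> 1" if "\<bar>x\<bar> \<le> C" for x
    using W[of x] that \<kappa> by (auto simp: T abs_le_iff divide_le_eq poly_dist_poly)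
  \<comment> \<open>Partial Neumann sums for 1/|x - z|^2: the geometric sum gives |x - z|^2
    \<sigma>_k = 1 - T^k.\<close>
  define \<sigma> where "\<sigma> k = Polynomial.smult (1 / \<kappa>) (\<Sum>j<k. T ^ j)" for k
  have \<sigma>: "dist_poly z * \<sigma> k = 1 - T ^ k" for k
    unfolding one_diff_power_eq by (simp add: \<sigma>_def T_def)
  have "ell2_inner V ((A ^^ n) f) f = of_real (\<integral>x. x ^ n \<partial>?N)" for n
  proof (rule LIMSEQ_unique)
    let ?p = "\<lambda>k. [:0, 1:] ^ n * (1 - T ^ k)"
    let ?I = "\<lambda>k. ell2_inner V (op_poly A (?p k) f) f"
    have fn: "(A ^^ n) f \<in> ell2 V"
      unfolding op_poly_X_power[OF lin, symmetric] by (rule op_poly_ell2[OF f])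
    have "?I k - ell2_inner V ((A ^^ n) f) f = - ell2_inner V (op_poly A (T ^ k) f) ((A ^^ n) f)" for k
    proof -
      have "op_poly A (?p k) f = (\<lambda>x. 1 * (A ^^ n) f x + (-1) * op_poly A ([:0, 1:] ^ n * T ^ k) f x)"
        by (simp add: right_diff_distrib op_poly_diff[OF lin] op_poly_X_power[OF lin])
      then show ?thesis
        using ell2_inner_lincomb_left[OF fn op_poly_ell2[OF f] f, of 1 "-1" "[:0, 1:] ^ n * T ^ k"]
          inner_power2[OF f, of "T ^ k" "[:0, 1:] ^ n"]
        by (simp add: op_poly_X_power[OF lin])
    qed
    moreover have "cmod (ell2_inner V (op_poly A (T ^ k) f) ((A ^^ n) f)) \<le> q ^ k * ell2_norm V f * ell2_norm V ((A ^^ n) f)" for k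
      using ell2_Cauchy_Schwarz[OF op_poly_ell2[OF f] fn, of "T ^ k"]
        mult_right_mono[OF funpow_contraction[OF f q(1,3), of k] ell2_norm_nonneg[of V "(A ^^ n) f"]]
      by linarith
    ultimately have b: "norm (?I k - ell2_inner V ((A ^^ n) f) f) \<le> q ^ k * ell2_norm V f * ell2_norm V ((A ^^ n) f)" for k
      by simp
    have "(\<lambda>k. q ^ k * ell2_norm V f * ell2_norm V ((A ^^ n) f)) \<longlonglongrightarrow> 0 * ell2_norm V f * ell2_norm V ((A ^^ n) f)"
      using q by (intro tendsto_intros LIMSEQ_power_zero) auto
    then have "(\<lambda>k. q ^ k * ell2_norm V f * ell2_norm V ((A ^^ n) f)) \<longlonglongrightarrow> 0"
      by simp
    then have "(\<lambda>k. ?I k - ell2_inner V ((A ^^ n) f) f) \<longlonglongrightarrow> 0"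
      by (rule Lim_null_comparison[rotated]) (rule always_eventually, rule allI, rule b)
    then show "?I \<longlonglongrightarrow> ell2_inner V ((A ^^ n) f) f"
      by (rule LIM_zero_cancel)
    have I: "?I k = of_real (\<integral>x. x ^ n * poly (\<sigma> k) x \<partial>M)" for k
    proof -
      have "?I k = ell2_inner V (op_poly A (dist_poly z * ([:0, 1:] ^ n * \<sigma> k)) f) f"
        unfolding \<sigma>[symmetric] by (simp add: mult_ac)
      also have "\<dots> = ell2_inner V (op_poly A ([:0, 1:] ^ n * \<sigma> k) ?g) ?g"
        by (rule inner_shift[OF f, symmetric])
      also have "\<dots> = of_real (\<integral>x. x ^ n * poly (\<sigma> k) x \<partial>M)"
        unfolding spectral_integral[OF g M(1)] by (simp add: poly_mult[abs_def] poly_power)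
      finally show ?thesis .
    qed
    have "(\<lambda>k. \<integral>x. x ^ n * poly (\<sigma> k) x \<partial>M) \<longlonglongrightarrow> (\<integral>x. x ^ n * w x \<partial>M)"
    proof (rule integral_dominated_convergence[where w = "\<lambda>_. \<bar>C\<bar> ^ n * (2 / c\<^sup>2)"])
      have \<sigma>w: "poly (\<sigma> k) x = (1 - poly T x ^ k) * w x" if "c\<^sup>2 / 2 \<le> ?Q x" for k x
      proof -
        have "?Q x * poly (\<sigma> k) x = 1 - poly T x ^ k"
          using arg_cong[OF \<sigma>[of k], of "\<lambda>p. poly p x"] by (simp add: poly_power)
        moreover have w: "w x = 1 / ?Q x" and "?Q x \<noteq> 0"
          using that c by (auto simp: w_def)
        ultimately have "poly (\<sigma> k) x = (1 - poly T x ^ k) / ?Q x"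
          by (simp add: nonzero_eq_divide_eq mult.commute)
        then show ?thesis by (simp add: w)
      qed
      show "AE x in M. (\<lambda>k. x ^ n * poly (\<sigma> k) x) \<longlonglongrightarrow> x ^ n * w x"
        using away C
      proof eventually_elim
        case (elim x)
        have "0 < c\<^sup>2 / 2" using c by simp
        then have "0 < ?Q x" using elim by linarith
        then have "poly T x < 1" unfolding T using \<kappa> by simp
        then have "(\<lambda>k. x ^ n * ((1 - poly T x ^ k) * w x)) \<longlonglongrightarrow> x ^ n * ((1 - 0) * w x)"
          using T01[OF elim(2)] by (intro tendsto_intros LIMSEQ_power_zero) auto
        then show ?case by (simp add: \<sigma>w[OF elim(1)])
      qed
      show "AE x in M. norm (x ^ n * poly (\<sigma> k) x) \<le> \<bar>C\<bar> ^ n * (2 / c\<^sup>2)" for k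
        using away C wW
      proof eventually_elim
        case (elim x)
        have "\<bar>1 - poly T x ^ k\<bar> \<le> 1"
          using T01[OF elim(2)] by (auto simp: abs_le_iff power_le_one)
        then have "\<bar>1 - poly T x ^ k\<bar> * w x \<le> 1 * (2 / c\<^sup>2)"
          using elim w(2)[of x] by (intro mult_mono) auto
        moreover have "\<bar>x\<bar> ^ n \<le> \<bar>C\<bar> ^ n"
          using elim by (intro power_mono) auto
        ultimately have "\<bar>x\<bar> ^ n * (\<bar>1 - poly T x ^ k\<bar> * w x) \<le> \<bar>C\<bar> ^ n * (2 / c\<^sup>2)"
          using w(2)[of x] by (intro mult_mono) auto
        then show ?case
          using w(2)[of x] by (simp add: \<sigma>w[OF elim(1)] abs_mult power_abs)
      qed
    qed (use sets w(1) in \<open>auto simp: measurable_cong_sets[OF sets refl] intro!: borel_measurable_times borel_measurable_power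
      borel_measurable_continuous_onI[of "poly _"] continuous_at_imp_continuous_on\<close>)
    then show "?I \<longlonglongrightarrow> of_real (\<integral>x. x ^ n \<partial>?N)"
      unfolding I by (intro tendsto_of_real) (simp add: wt(5) mult.commute)
  qed
  then have "is_spectral_measure V A f ?N"
    using wt(1-3) by (auto simp: is_spectral_measure_def)
  then show ?thesis
    using wt(4) f by (auto simp: ac_subspace_def)
qed

text \<open>On \<open>ac_subspace V A\<close> surjectivity does not follow by restriction: the
  preimage found in \<open>ell2 V\<close> has to be absolutely continuous again, which is
  \<open>ac_shift_inverse\<close>.\<close>

lemma resolvent_set:
  assumes c: "c > 0" and below: "\<And>f. f \<in> ell2 V \<Longrightarrow> c * ell2_norm V f \<le> ell2_norm V (\<lambda>x. A f x - z * f x)"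
  shows "z \<notin> op_spectrum V A" and "z \<notin> ac_spectrum V A"
proof -
  have bd: "\<exists>C. \<forall>f\<in>S. ell2_norm V f \<le> C * ell2_norm V (\<lambda>x. A f x - z * f x)" if "S \<subseteq> ell2 V" for S
    using below that c by (intro exI[of _ "1 / c"]) (auto simp: field_simps)
  have bij: "bij_betw (\<lambda>f x. A f x - z * f x) (ell2 V) (ell2 V)"
    by (rule bounded_below_bij[OF c below])
  show "z \<notin> op_spectrum V A"
    using bij bd[of "ell2 V"] by (auto simp: op_spectrum_def spectrum_on_def)
  have S: "ac_subspace V A \<subseteq> ell2 V"
    by (auto simp: ac_subspace_def)
  have "bij_betw (\<lambda>f x. A f x - z * f x) (ac_subspace V A) (ac_subspace V A)"
  proof (rule bij_betw_imageI)
    show "inj_on (\<lambda>f x. A f x - z * f x) (ac_subspace V A)"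
      by (rule inj_on_subset[OF bounded_below_inj[OF c below] S])
    show "(\<lambda>f x. A f x - z * f x) ` ac_subspace V A = ac_subspace V A"
    proof (intro equalityI subsetI)
      fix g assume g: "g \<in> ac_subspace V A"
      then have "g \<in> (\<lambda>f x. A f x - z * f x) ` ell2 V"
        using S bij by (auto simp: bij_betw_def)
      then obtain f where f: "f \<in> ell2 V" "g = (\<lambda>x. A f x - z * f x)"
        by auto
      then show "g \<in> (\<lambda>f x. A f x - z * f x) ` ac_subspace V A"
        using ac_shift_inverse[OF f(1) _ c below] g by blast
    qed (auto intro: ac_shift)
  qed
  then show "z \<notin> ac_spectrum V A"
    using bd[OF S] by (auto simp: ac_spectrum_def spectrum_on_def)
qed

text \<open>The affine change of variable R carries [-K', K'] to [0, 1] and makes the normalised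
  quadratic form of f a functional that is nonnegative on x^j (1 - x)^k, so Hausdorff's theorem
  applies. Undoing the change of variable and restoring the mass give the measure.\<close>

theorem exists_spectral_measure:
  assumes f: "f \<in> ell2 V"
  shows "\<exists>M. is_spectral_measure V A f M"
proof (cases "ell2_norm V f = 0")
  case True
  then have "f = (\<lambda>x. 0)" using f by (rule ell2_norm_eq_0[rotated])
  then have "(A ^^ n) f = (\<lambda>x. 0)" for n
    by (induction n) (simp_all add: linear_op_zero[OF lin])
  then have "is_spectral_measure V A f (null_measure borel)"
    by (auto simp: is_spectral_measure_def intro!: finite_measureI AE_I[of _ _ UNIV])
  then show ?thesis ..
next
  case False
  define n2 where "n2 = (ell2_norm V f)\<^sup>2"
  have n2: "n2 > 0" using False by (simp add: n2_def)
  define K' where "K' = \<bar>K\<bar> + 1"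
  have K': "K' > 0" by (simp add: K'_def)
  have bK: "ell2_norm V (A g) \<le> K' * ell2_norm V g" if "g \<in> ell2 V" for g
  proof -
    have "K \<le> K'" by (simp add: K'_def)
    then have "K * ell2_norm V g \<le> K' * ell2_norm V g" by (rule mult_right_mono) simp
    then show ?thesis using bounded[OF that] by linarith
  qed
  define R where "R = [:1 / 2, 1 / (2 * K'):]"
  define L where "L p = Re (ell2_inner V (op_poly A (pcompose p R) f) f) / n2" for p
  have add: "L (p + q) = L p + L q" for p q
    using ell2_inner_lincomb_left[OF op_poly_ell2[OF f] op_poly_ell2[OF f] f, of 1 "pcompose p R" 1 "pcompose q R"]
    by (simp add: L_def pcompose_add op_poly_add[OF lin] add_divide_distrib)
  have scale: "L (Polynomial.smult c p) = c * L p" for c p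
    using ell2_inner_lincomb_left[OF op_poly_ell2[OF f] f f, of "of_real c" "pcompose p R" 0]
    by (simp add: L_def pcompose_smult op_poly_smult[OF lin])
  have one: "L 1 = 1"
    using n2 ell2_inner_self[OF f] by (simp add: L_def pcompose_1 lin n2_def)
  \<comment> \<open>Four polynomials suffice because squares of R and 1 - R are split off below. R
    and 1 - R are handled by |<A v, v>| \<le> K' |v|^2, and R (1 - R) = (1 - x^2 / K'^2) / 4 by |A
    v| \<le> K' |v|.\<close>
  have pos2: "0 \<le> Re (ell2_inner V (op_poly A p v) v)"
    if p: "p \<in> {1, R, 1 - R, R * (1 - R)}" and v: "v \<in> ell2 V" for p v
  proof -
    have vv: "ell2_inner V v v = of_real ((ell2_norm V v)\<^sup>2)" by (rule ell2_inner_self[OF v])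
    have AA: "ell2_inner V (A (A v)) v = of_real ((ell2_norm V (A v))\<^sup>2)"
      using sym[OF maps[OF v] v] ell2_inner_self[OF maps[OF v]] by simp
    have "\<bar>Re (ell2_inner V (A v) v)\<bar> \<le> ell2_norm V (A v) * ell2_norm V v"
      using ell2_Cauchy_Schwarz[OF maps[OF v] v] abs_Re_le_cmod order_trans by blast
    also have "\<dots> \<le> K' * (ell2_norm V v)\<^sup>2"
      using mult_right_mono[OF bK[OF v] ell2_norm_nonneg[of V v]] by (simp add: power2_eq_square mult.assoc)
    finally have a: "Re (ell2_inner V (A v) v) / K' \<le> (ell2_norm V v)\<^sup>2"
      "- (ell2_norm V v)\<^sup>2 \<le> Re (ell2_inner V (A v) v) / K'"
      using K' by (auto simp: abs_le_iff field_simps)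
    have "(ell2_norm V (A v))\<^sup>2 \<le> (K' * ell2_norm V v)\<^sup>2"
      using bK[OF v] by (intro power_mono) auto
    then have b: "(ell2_norm V (A v))\<^sup>2 / K'\<^sup>2 \<le> (ell2_norm V v)\<^sup>2"
      using K' by (simp add: power_mult_distrib field_simps)
    have lc: "Re (ell2_inner V (op_poly A [:\<alpha>, \<beta>, \<gamma>:] v) v)
      = \<alpha> * (ell2_norm V v)\<^sup>2 + \<beta> * Re (ell2_inner V (A v) v) + \<gamma> * (ell2_norm V (A v))\<^sup>2" for \<alpha> \<beta> \<gamma>
    proof -
      have "op_poly A [:\<alpha>, \<beta>, \<gamma>:] v = (\<lambda>x. of_real \<alpha> * v x + 1 * (\<lambda>x. of_real \<beta> * A v x + of_real \<gamma> * A (A v) x) x)"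
        by (simp add: op_poly_pCons[OF lin] linear_op_zero[OF lin] linear_op_add[OF lin] linear_op_scale[OF lin])
      then show ?thesis
        using ell2_inner_lincomb_left[OF v ell2_lincomb[OF maps[OF v] maps[OF maps[OF v]]] v, of "of_real \<alpha>" 1 "of_real \<beta>" "of_real \<gamma>"]
          ell2_inner_lincomb_left[OF maps[OF v] maps[OF maps[OF v]] v, of "of_real \<beta>" "of_real \<gamma>"] vv AA
        by simp
    qed
    have R: "1 = [:1, 0, 0::real:]" "R = [:1 / 2, 1 / (2 * K'), 0:]" "1 - R = [:1 / 2, - 1 / (2 * K'), 0:]"
      "R * (1 - R) = [:1 / 4, 0, - 1 / (4 * K'\<^sup>2):]"
      by (simp_all add: R_def one_pCons power2_eq_square)
    have "0 \<le> Re (ell2_inner V (op_poly A 1 v) v)"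
      unfolding R(1) lc by simp
    moreover have "0 \<le> Re (ell2_inner V (op_poly A R v) v)"
      unfolding R(2) lc using a by (simp add: field_simps)
    moreover have "0 \<le> Re (ell2_inner V (op_poly A (1 - R) v) v)"
      unfolding R(3) lc using a by (simp add: field_simps)
    moreover have "0 \<le> Re (ell2_inner V (op_poly A (R * (1 - R)) v) v)"
      unfolding R(4) lc using b by (simp add: field_simps)
    ultimately show ?thesis using p by auto
  qed
  have pcR: "pcompose (p ^ k) R = pcompose p R ^ k" for p k
    by (induction k) (simp_all add: pcompose_1 pcompose_mult)
  have pos: "0 \<le> L ([:0, 1:] ^ j * [:1, -1:] ^ k)" for j k
  proof -
    have c1: "pcompose [:0, 1:] R = R" "pcompose [:1, -1:] R = 1 - R"
      by (simp_all add: pcompose_pCons one_pCons)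
    \<comment> \<open>Halving the exponents writes the polynomial as r s r, where s depends only on
      the parities of j and k and is one of the four polynomials of \<open>pos2\<close>.\<close>
    define r where "r = R ^ (j div 2) * (1 - R) ^ (k div 2)"
    define s where "s = R ^ (j mod 2) * (1 - R) ^ (k mod 2)"
    have "R ^ j = R ^ (j div 2) * R ^ (j div 2) * R ^ (j mod 2)"
      "(1 - R) ^ k = (1 - R) ^ (k div 2) * (1 - R) ^ (k div 2) * (1 - R) ^ (k mod 2)"
      unfolding power_add[symmetric] by (simp_all add: mult_2[symmetric])
    then have eq: "pcompose ([:0, 1:] ^ j * [:1, -1:] ^ k) R = r * (s * r)"
      unfolding pcompose_mult pcR c1 r_def s_def by (simp only: mult_ac)
    have "s \<in> {1, R, 1 - R, R * (1 - R)}"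
      by (auto simp: s_def mod_2_eq_odd)
    then have "0 \<le> Re (ell2_inner V (op_poly A s (op_poly A r f)) (op_poly A r f))"
      by (intro pos2 op_poly_ell2[OF f])
    also have "ell2_inner V (op_poly A s (op_poly A r f)) (op_poly A r f) = ell2_inner V (op_poly A (r * (s * r)) f) f"
      using inner_power2[OF f, of "s * r" r] by (simp add: op_poly_mult[OF lin])
    finally show ?thesis
      using n2 by (simp add: L_def eq)
  qed
  obtain N where N: "real_distribution N" "AE x in N. 0 \<le> x \<and> x \<le> 1" "\<And>n. (\<integral>x. x ^ n \<partial>N) = L ([:0, 1:] ^ n)"
    using Hausdorff_moment[of L, OF add scale pos one] by blast
  interpret N: real_distribution N by (rule N(1))
  have intN: "(\<integral>x. poly p x \<partial>N) = L p" for p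
    using N(2) by (intro integral_poly_eqI[of _ 1] N.finite_measure_axioms add scale N(3)) (auto elim: eventually_mono)
  define M0 where "M0 = distr N borel (\<lambda>y. 2 * K' * y - K')"
  have M0: "finite_measure M0" "sets M0 = sets borel"
    unfolding M0_def by (auto intro!: N.finite_measure_distr)
  have M0b: "AE x in M0. \<bar>x\<bar> \<le> K'"
    unfolding M0_def
  proof (subst AE_distr_iff)
    show "AE y in N. \<bar>2 * K' * y - K'\<bar> \<le> K'"
      using N(2) by eventually_elim (use K' in \<open>auto simp: abs_le_iff\<close>)
  qed auto
  have w: "(\<lambda>_. n2) \<in> borel_measurable borel" "\<And>x::real. 0 \<le> n2" "AE x in M0. n2 \<le> n2"
    using n2 by auto
  note wt = finite_measure_weighted[OF M0 M0b w] sets_weighted[OF M0 M0b w]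
    AE_weighted[OF M0 M0b w] integral_weighted[OF M0 M0b w]
  have "ell2_inner V ((A ^^ n) f) f = of_real (\<integral>x. x ^ n \<partial>density M0 (\<lambda>x. ennreal n2))" for n
  proof -
    have "(\<integral>x. x ^ n \<partial>density M0 (\<lambda>x. ennreal n2)) = n2 * (\<integral>x. x ^ n \<partial>M0)"
      by (subst wt(4)) auto
    also have "(\<integral>x. x ^ n \<partial>M0) = (\<integral>y. poly ([:- K', 2 * K':] ^ n) y \<partial>N)"
    proof -
      have "poly ([:- K', 2 * K':] ^ n) = (\<lambda>y. (2 * K' * y - K') ^ n)"
        by (simp add: fun_eq_iff poly_power mult.commute)
      then show ?thesis
        unfolding M0_def by (subst integral_distr) auto
    qed
    also have "\<dots> = L ([:- K', 2 * K':] ^ n)" by (rule intN)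
    also have "pcompose ([:- K', 2 * K':] ^ n) R = [:0, 1:] ^ n"
      unfolding pcR using K' by (simp add: R_def pcompose_pCons)
    then have "n2 * L ([:- K', 2 * K':] ^ n) = Re (ell2_inner V ((A ^^ n) f) f)"
      using n2 by (simp add: L_def op_poly_X_power[OF lin])
    finally have "(\<integral>x. x ^ n \<partial>density M0 (\<lambda>x. ennreal n2)) = Re (ell2_inner V ((A ^^ n) f) f)" .
    moreover have "Im (ell2_inner V ((A ^^ n) f) f) = 0"
      using op_poly_sym[OF f f, of "[:0, 1:] ^ n"] ell2_inner_commute[of V f "(A ^^ n) f"]
      by (simp add: op_poly_X_power[OF lin] complex_eq_iff)
    ultimately show ?thesis by (simp add: complex_eq_iff)
  qed
  then show ?thesis
    using wt(1-3) by (auto simp: is_spectral_measure_def intro!: exI[of _ "density M0 (\<lambda>x. ennreal n2)"])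
qed

end

section \<open>The adjacency operator of the lattice\<close>

lemma int_points_0 [simp]: "0 \<in> int_points"
  by (simp add: int_points_def)

lemma int_points_add: "m \<in> int_points \<Longrightarrow> n \<in> int_points \<Longrightarrow> m + n \<in> int_points"
  by (simp add: int_points_def)

lemma int_points_uminus: "m \<in> int_points \<Longrightarrow> - m \<in> int_points"
  by (simp add: int_points_def)

lemma int_points_diff: "m \<in> int_points \<Longrightarrow> n \<in> int_points \<Longrightarrow> m - n \<in> int_points"
  by (simp add: int_points_def)

lemma axis_int_points [simp]: "axis s 1 \<in> int_points"
  by (simp add: int_points_def axis_def)

lemma int_part_int_points [simp]: "int_part x \<in> int_points"
  by (simp add: int_points_def int_part_def)

lemma int_part_add: "m \<in> int_points \<Longrightarrow> int_part (x + m) = int_part x + m"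
  by (auto simp: int_points_def int_part_def vec_eq_iff elim!: Ints_cases dest!: spec)

lemma frac_part_add: "m \<in> int_points \<Longrightarrow> frac_part (x + m) = frac_part x"
  by (simp add: frac_part_def int_part_add)

lemma int_frac_part: "int_part x + frac_part x = x"
  by (simp add: frac_part_def)

lemma int_part_eq_self: "m \<in> int_points \<Longrightarrow> int_part m = m"
  using int_part_add[of m 0] by (simp add: int_part_def vec_eq_iff)

text \<open>Defined for functions on all of space, so that it acts on every translation orbit of
  vertices, added ones included, and can be compared with polynomials of the Laplacian on all of
  V.\<close>

definition shift_op :: "(real ^ 'd::finite \<Rightarrow> complex) \<Rightarrow> real ^ 'd \<Rightarrow> complex" where
  "shift_op f x = (\<Sum>s\<in>UNIV. f (x + axis s 1) + f (x - axis s 1))"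

lemma linear_shift_op: "linear_op shift_op"
  by (simp add: linear_op_def shift_op_def sum.distrib sum_distrib_left algebra_simps fun_eq_iff)

locale periodic_set =
  fixes V :: "(real ^ 'd::finite) set"
  assumes translate: "x \<in> V \<Longrightarrow> m \<in> int_points \<Longrightarrow> x + m \<in> V"
begin

lemma translate_iff: "m \<in> int_points \<Longrightarrow> x + m \<in> V \<longleftrightarrow> x \<in> V"
  using translate[of x m] translate[of "x + m" "- m"] int_points_uminus[of m] by auto

lemma bij_translate:
  assumes "m \<in> int_points" shows "bij_betw (\<lambda>x. x + m) V V"
  by (rule bij_betwI[of _ _ _ "\<lambda>x. x - m"])
    (use assms translate translate[OF _ int_points_uminus[OF assms]] in auto)

lemma translate_ell2:
  assumes "m \<in> int_points" "f \<in> ell2 V" shows "(\<lambda>x. f (x + m)) \<in> ell2 V"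
  using assms summable_on_reindex_bij_betw[OF bij_translate[OF assms(1)], of "\<lambda>x. (cmod (f x))\<^sup>2"]
  by (auto simp: ell2_def translate_iff)

lemma translate_norm:
  assumes "m \<in> int_points" shows "ell2_norm V (\<lambda>x. f (x + m)) = ell2_norm V f"
  using infsum_reindex_bij_betw[OF bij_translate[OF assms], of "\<lambda>x. (cmod (f x))\<^sup>2"]
  by (simp add: ell2_norm_def)

lemma translate_inner:
  assumes "m \<in> int_points"
  shows "ell2_inner V (\<lambda>x. f (x + m)) g = ell2_inner V f (\<lambda>x. g (x - m))"
  using infsum_reindex_bij_betw[OF bij_translate[OF assms], of "\<lambda>x. f x * cnj (g (x - m))"]
  by (simp add: ell2_inner_def)

lemma ell2_inner_sum_left:
  "(\<And>i. i \<in> I \<Longrightarrow> f i \<in> ell2 V) \<Longrightarrow> g \<in> ell2 V \<Longrightarrow>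
    ell2_inner V (\<lambda>x. \<Sum>i\<in>I. f i x) g = (\<Sum>i\<in>I. ell2_inner V (f i) g)"
proof (induction I rule: infinite_finite_induct)
  case (insert i I)
  then show ?case
    using ell2_inner_lincomb_left[of "f i" V "\<lambda>x. \<Sum>i\<in>I. f i x" g 1 1] by (simp add: ell2_sum)
qed auto

lemma ell2_inner_sum_right:
  assumes "\<And>i. i \<in> I \<Longrightarrow> f i \<in> ell2 V" "g \<in> ell2 V"
  shows "ell2_inner V g (\<lambda>x. \<Sum>i\<in>I. f i x) = (\<Sum>i\<in>I. ell2_inner V g (f i))"
  using ell2_inner_sum_left[of I f g] assms by (subst (1 2) ell2_inner_commute) simp

sublocale shift: bounded_symmetric V shift_op "2 * real CARD('d)"
proof
  have minus: "(\<lambda>x. f (x - axis s 1)) = (\<lambda>x. f (x + - axis s 1))" for f :: "real ^ 'd \<Rightarrow> complex" and s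
    by simp
  have neg: "- axis s 1 \<in> int_points" for s :: 'd
    by (simp add: int_points_uminus)
  fix f :: "real ^ 'd \<Rightarrow> complex" assume f: "f \<in> ell2 V"
  have e1: "(\<lambda>x. f (x + axis s 1)) \<in> ell2 V" "(\<lambda>x. f (x - axis s 1)) \<in> ell2 V"
    if "f \<in> ell2 V" for s :: 'd and f
    using translate_ell2[OF _ that, of "axis s 1"] translate_ell2[OF neg that, of s] by simp_all
  show "shift_op f \<in> ell2 V"
    unfolding shift_op_def[abs_def] by (intro ell2_sum ell2_add e1 f)
  have "ell2_norm V (shift_op f) \<le> (\<Sum>s\<in>UNIV. ell2_norm V (\<lambda>x. f (x + axis s 1) + f (x - axis s 1)))"
    unfolding shift_op_def[abs_def] by (intro ell2_norm_sum ell2_add e1 f)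
  also have "\<dots> \<le> (\<Sum>s\<in>(UNIV :: 'd set). 2 * ell2_norm V f)"
  proof (rule sum_mono)
    fix s :: 'd
    show "ell2_norm V (\<lambda>x. f (x + axis s 1) + f (x - axis s 1)) \<le> 2 * ell2_norm V f"
      using ell2_norm_add[OF e1[OF f, of s]] translate_norm[of "axis s 1" f] translate_norm[OF neg, of f s]
      unfolding minus by simp
  qed
  finally show "ell2_norm V (shift_op f) \<le> 2 * real CARD('d) * ell2_norm V f"
    by simp
  fix g :: "real ^ 'd \<Rightarrow> complex" assume g: "g \<in> ell2 V"
  have "ell2_inner V (shift_op f) g
    = (\<Sum>s\<in>UNIV. ell2_inner V (\<lambda>x. f (x + axis s 1) + f (x - axis s 1)) g)"
    unfolding shift_op_def[abs_def] by (intro ell2_inner_sum_left ell2_add e1 f g)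
  also have "\<dots> = (\<Sum>s\<in>UNIV. ell2_inner V f (\<lambda>x. g (x + axis s 1) + g (x - axis s 1)))"
  proof (rule sum.cong[OF refl])
    fix s :: 'd
    show "ell2_inner V (\<lambda>x. f (x + axis s 1) + f (x - axis s 1)) g
      = ell2_inner V f (\<lambda>x. g (x + axis s 1) + g (x - axis s 1))"
      using ell2_inner_lincomb_left[OF e1[OF f, of s] g, of 1 1] ell2_inner_lincomb_right[OF e1[OF g, of s] f, of 1 1]
        translate_inner[of "axis s 1" f g] translate_inner[OF neg, of f s g]
      by simp
  qed
  also have "\<dots> = ell2_inner V f (shift_op g)"
    unfolding shift_op_def[abs_def] by (intro ell2_inner_sum_right[symmetric] ell2_add e1 f g)
  finally show "ell2_inner V (shift_op f) g = ell2_inner V f (shift_op g)" .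
qed (rule linear_shift_op)

end

section \<open>Fourier analysis of translation orbits\<close>

definition angle_measure :: "real measure" where
  "angle_measure = uniform_measure lborel {0..2 * pi}"

definition angles :: "('d::finite \<Rightarrow> real) measure" where
  "angles = PiM UNIV (\<lambda>_. angle_measure)"

definition symbol :: "('d::finite \<Rightarrow> real) \<Rightarrow> real" where
  "symbol \<theta> = (\<Sum>s\<in>UNIV. 2 * cos (\<theta> s))"

definition wave :: "real ^ 'd::finite \<Rightarrow> ('d \<Rightarrow> real) \<Rightarrow> complex" where
  "wave m \<theta> = (\<Prod>s\<in>UNIV. cis (m $ s * \<theta> s))"

interpretation angle: prob_space angle_measure
  unfolding angle_measure_def by (rule prob_space_uniform_measure) auto

interpretation angle_product: product_prob_space "\<lambda>_::'d::finite. angle_measure" UNIV ..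

interpretation angles: prob_space "angles :: ('d::finite \<Rightarrow> real) measure"
  unfolding angles_def by (rule prob_space_PiM) unfold_locales

lemma sets_angle [measurable_cong, simp]: "sets angle_measure = sets borel"
  by (simp add: angle_measure_def)

lemma space_angle [simp]: "space angle_measure = UNIV"
  by (simp add: angle_measure_def)

lemma measurable_angle_component [measurable]: "(\<lambda>\<theta>. \<theta> s) \<in> borel_measurable angles"
  using measurable_component_singleton[of s UNIV "\<lambda>_. angle_measure"]
  by (simp add: angles_def measurable_cong_sets[OF refl sets_angle])

lemma space_angles [simp]: "space angles = UNIV"
  by (simp add: angles_def space_PiM)

lemma measurable_symbol [measurable]: "symbol \<in> borel_measurable angles"
  unfolding symbol_def[abs_def] by measurable

lemma measurable_wave [measurable]: "wave m \<in> borel_measurable angles"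
  unfolding wave_def[abs_def] cis_conv_exp by measurable

lemma wave_add: "wave (m + n) \<theta> = wave m \<theta> * wave n \<theta>"
  by (simp add: wave_def distrib_right cis_mult[symmetric] prod.distrib)

lemma norm_wave [simp]: "cmod (wave m \<theta>) = 1"
  by (simp add: wave_def prod_norm[symmetric])

lemma wave_0 [simp]: "wave 0 \<theta> = 1"
  by (simp add: wave_def)

lemma cnj_wave: "cnj (wave m \<theta>) = wave (- m) \<theta>"
  by (simp add: wave_def cis_cnj)

lemma wave_axis: "wave (axis s 1) \<theta> = cis (\<theta> s)"
proof -
  have "wave (axis s 1) \<theta> = (\<Prod>r\<in>{s}. cis (axis s 1 $ r * \<theta> r))"
    unfolding wave_def by (rule prod.mono_neutral_right) (auto simp: axis_def)
  then show ?thesis by simp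
qed

lemma integral_angle_cis:
  assumes "k \<in> \<int>"
  shows "(\<integral>x. cis (k * x) \<partial>angle_measure) = (if k = 0 then 1 else 0)"
proof (cases "k = 0")
  case True
  then show ?thesis
    using angle.prob_space by simp
next
  case False
  have em: "emeasure lborel {0..2 * pi} = ennreal (2 * pi)"
    by simp
  have dens: "angle_measure = density lborel (\<lambda>x. ennreal (indicator {0..2 * pi} x / (2 * pi)))"
    unfolding angle_measure_def uniform_measure_def em
    by (intro density_cong) (auto simp: divide_ennreal[symmetric] ennreal_indicator indicator_def simp flip: ennreal_1)
  have "(\<integral>x. cis (k * x) \<partial>angle_measure) = (\<integral>x. (indicator {0..2 * pi} x / (2 * pi)) *\<^sub>R cis (k * x) \<partial>lborel)"
    unfolding dens cis_conv_exp by (rule integral_density) (auto simp: indicator_def)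
  also have "\<dots> = (1 / (2 * pi)) *\<^sub>R (\<integral>x. indicator {0..2 * pi} x *\<^sub>R cis (k * x) \<partial>lborel)"
    by (subst integral_scaleR_right[symmetric]) (simp add: mult.commute)
  also have "(\<integral>x. indicator {0..2 * pi} x *\<^sub>R cis (k * x) \<partial>lborel)
    = cis (k * (2 * pi)) / (\<i> * k) - cis (k * 0) / (\<i> * k)"
  proof (rule integral_FTC_Icc)
    show "((\<lambda>x. cis (k * x) / (\<i> * complex_of_real k)) has_vector_derivative cis (k * x)) (at x within {0..2 * pi})" for x
    proof -
      have "((\<lambda>z. exp (\<i> * of_real k * z) / (\<i> * of_real k)) has_field_derivative exp (\<i> * of_real k * of_real x)) (at (of_real x))"
        using False by (auto intro!: derivative_eq_intros)
      from has_vector_derivative_real_field[OF this] show ?thesis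
        by (simp add: cis_conv_exp mult.assoc)
    qed
    show "continuous_on {0..2 * pi} (\<lambda>x. cis (k * x))"
      unfolding cis_conv_exp by (intro continuous_intros)
  qed auto
  also have "cis (k * (2 * pi)) = 1"
    using assms by (metis Ints_cases cis_multiple_2pi mult.commute mult.left_commute Ints_of_int)
  finally show ?thesis
    using False by simp
qed

lemma integral_wave:
  assumes "m \<in> int_points"
  shows "(\<integral>\<theta>. wave m \<theta> \<partial>angles) = (if m = 0 then 1 else 0)"
proof -
  have "(\<integral>\<theta>. wave m \<theta> \<partial>angles) = (\<Prod>s\<in>UNIV. \<integral>x. cis (m $ s * x) \<partial>angle_measure)"
    unfolding wave_def angles_def
    by (rule angle_product.product_integral_prod)
      (auto intro!: angle.integrable_const_bound[of _ 1] borel_measurable_continuous_onI continuous_intros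
        simp: cis_conv_exp measurable_cong_sets[OF sets_angle refl])
  also have "\<dots> = (\<Prod>s\<in>UNIV. if m $ s = 0 then 1 else 0)"
    using assms by (intro prod.cong) (auto simp: integral_angle_cis int_points_def)
  also have "\<dots> = (if m = 0 then 1 else 0)"
    by (auto simp: vec_eq_iff prod_zero_iff)
  finally show ?thesis .
qed

text \<open>The Fourier transform along the translation orbit of the point \<open>v\<close> of the unit cell.\<close>
definition transform :: "(real ^ 'd::finite \<Rightarrow> complex) \<Rightarrow> real ^ 'd \<Rightarrow> ('d \<Rightarrow> real) \<Rightarrow> complex" where
  "transform f v \<theta> = (\<Sum>x | f x \<noteq> 0. if frac_part x = v then f x * wave (int_part x) \<theta> else 0)"

lemma transform_superset:
  "finite S \<Longrightarrow> {x. f x \<noteq> 0} \<subseteq> S \<Longrightarrow>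
    transform f v \<theta> = (\<Sum>x\<in>S. if frac_part x = v then f x * wave (int_part x) \<theta> else 0)"
  unfolding transform_def by (rule sum.mono_neutral_left) auto

lemma transform_sum:
  assumes "finite I" "\<And>i. i \<in> I \<Longrightarrow> finite {x. f i x \<noteq> 0}"
  shows "transform (\<lambda>x. \<Sum>i\<in>I. f i x) v \<theta> = (\<Sum>i\<in>I. transform (f i) v \<theta>)"
proof -
  define S where "S = (\<Union>i\<in>I. {x. f i x \<noteq> 0})"
  have S: "finite S" "\<And>i. i \<in> I \<Longrightarrow> {x. f i x \<noteq> 0} \<subseteq> S" "{x. (\<Sum>i\<in>I. f i x) \<noteq> 0} \<subseteq> S"
    using assms by (auto simp: S_def dest: sum.not_neutral_contains_not_neutral)
  have "transform (\<lambda>x. \<Sum>i\<in>I. f i x) v \<theta>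
    = (\<Sum>x\<in>S. \<Sum>i\<in>I. if frac_part x = v then f i x * wave (int_part x) \<theta> else 0)"
    unfolding transform_superset[OF S(1,3)] by (intro sum.cong) (auto simp: sum_distrib_right)
  also have "\<dots> = (\<Sum>i\<in>I. \<Sum>x\<in>S. if frac_part x = v then f i x * wave (int_part x) \<theta> else 0)"
    by (rule sum.swap)
  also have "\<dots> = (\<Sum>i\<in>I. transform (f i) v \<theta>)"
    using S by (intro sum.cong refl transform_superset[symmetric]) auto
  finally show ?thesis .
qed

lemma finite_support_translate:
  fixes f :: "'b::group_add \<Rightarrow> complex"
  assumes "finite {x. f x \<noteq> 0}" shows "finite {x. f (x + m) \<noteq> 0}"
proof -
  have "{x. f (x + m) \<noteq> 0} = (\<lambda>y. y - m) ` {x. f x \<noteq> 0}"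
    by (force simp: image_iff)
  then show ?thesis using assms by simp
qed

lemma finite_support_add:
  fixes f g :: "'b \<Rightarrow> complex"
  assumes "finite {x. f x \<noteq> 0}" "finite {x. g x \<noteq> 0}" shows "finite {x. f x + g x \<noteq> 0}"
  by (rule finite_subset[OF _ finite_UnI[OF assms]]) auto

lemma transform_add:
  assumes "finite {x. f x \<noteq> 0}" "finite {x. g x \<noteq> 0}"
  shows "transform (\<lambda>x. f x + g x) v \<theta> = transform f v \<theta> + transform g v \<theta>"
  using transform_sum[of "UNIV :: bool set" "\<lambda>b. if b then f else g" v \<theta>] assms
  by (simp add: UNIV_bool add.commute)

lemma transform_translate:
  assumes "m \<in> int_points"
  shows "transform (\<lambda>x. f (x + m)) v \<theta> = wave (- m) \<theta> * transform f v \<theta>"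
proof -
  have eq: "{x. f (x + m) \<noteq> 0} = (\<lambda>y. y - m) ` {x. f x \<noteq> 0}"
    by (force simp: image_iff)
  have ip: "int_part (y - m) = - m + int_part y" "frac_part (y - m) = frac_part y" for y
    using int_part_add[OF int_points_uminus[OF assms], of y] frac_part_add[OF int_points_uminus[OF assms], of y]
    by simp_all
  show ?thesis
    unfolding transform_def eq
    using wave_add[of "- m"]
    by (subst sum.reindex) (auto simp: inj_on_def ip sum_distrib_left intro!: sum.cong)
qed

lemma finite_support_shift_op:
  assumes "finite {x. f x \<noteq> 0}" shows "finite {x. shift_op f x \<noteq> 0}"
proof (rule finite_subset)
  show "{x. shift_op f x \<noteq> 0} \<subseteq> (\<Union>s\<in>UNIV. {x. f (x + axis s 1) + f (x - axis s 1) \<noteq> 0})"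
    by (auto simp: shift_op_def dest: sum.not_neutral_contains_not_neutral)
  show "finite (\<Union>s\<in>(UNIV :: 'a set). {x. f (x + axis s 1) + f (x - axis s 1) \<noteq> 0})"
    using finite_support_translate[OF assms, of "axis _ 1"] finite_support_translate[OF assms, of "- axis _ 1"]
    by (intro finite_UN_I finite_support_add) auto
qed

lemma transform_shift_op:
  assumes "finite {x. f x \<noteq> 0}"
  shows "transform (shift_op f) v \<theta> = of_real (symbol \<theta>) * transform f v \<theta>"
proof -
  have fin: "finite {x. f (x + axis s 1) \<noteq> 0}" "finite {x. f (x - axis s 1) \<noteq> 0}" for s
    using finite_support_translate[OF assms, of "axis s 1"] finite_support_translate[OF assms, of "- axis s 1"]
    by auto
  have "transform (\<lambda>x. f (x + axis s 1) + f (x - axis s 1)) v \<theta> = of_real (2 * cos (\<theta> s)) * transform f v \<theta>" for s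
  proof -
    have "transform (\<lambda>x. f (x + axis s 1) + f (x - axis s 1)) v \<theta>
      = (wave (- axis s 1) \<theta> + wave (axis s 1) \<theta>) * transform f v \<theta>"
      using transform_translate[of "axis s 1" f v \<theta>] transform_translate[of "- axis s 1" f v \<theta>]
      by (simp add: transform_add[OF fin] int_points_uminus distrib_right)
    also have "wave (- axis s 1) \<theta> + wave (axis s 1) \<theta> = of_real (2 * cos (\<theta> s))"
      by (simp flip: cnj_wave) (simp add: wave_axis complex_eq_iff)
    finally show ?thesis .
  qed
  then show ?thesis
    unfolding shift_op_def[abs_def] symbol_def
    by (subst transform_sum) (auto intro!: finite_support_add fin simp: sum_distrib_right)
qed

lemma measurable_transform [measurable]: "transform f v \<in> borel_measurable angles"
  unfolding transform_def[abs_def] by measurable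

lemma transform_bounded: "cmod (transform f v \<theta>) \<le> (\<Sum>x | f x \<noteq> 0. cmod (f x))"
  unfolding transform_def by (rule order_trans[OF norm_sum]) (auto intro!: sum_mono simp: norm_mult)

text \<open>Orthonormality of the characters pairs points with equal integral parts, the index v
  pairs equal fractional parts, and together these single out x = y. Only orbits met by g
  contribute, whence the condition on W.\<close>

lemma Parseval:
  assumes f: "finite {x. f x \<noteq> 0}" and g: "finite {x. g x \<noteq> 0}"
    and W: "finite W" "frac_part ` {x. g x \<noteq> 0} \<subseteq> W"
  shows "(\<integral>\<theta>. (\<Sum>v\<in>W. transform f v \<theta> * cnj (transform g v \<theta>)) \<partial>angles) = (\<Sum>x | g x \<noteq> 0. f x * cnj (g x))"
proof -
  let ?F = "{x. f x \<noteq> 0}" and ?G = "{x. g x \<noteq> 0}"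
  have "(\<Sum>v\<in>W. transform f v \<theta> * cnj (transform g v \<theta>))
      = (\<Sum>y\<in>?G. \<Sum>x\<in>?F. if frac_part x = frac_part y then f x * cnj (g y) * wave (int_part x - int_part y) \<theta> else 0)" for \<theta>
  proof -
    have "(\<Sum>v\<in>W. transform f v \<theta> * cnj (transform g v \<theta>)) 
      = (\<Sum>v\<in>W. \<Sum>y\<in>?G. if frac_part y = v then transform f v \<theta> * cnj (g y * wave (int_part y) \<theta>) else 0)"
      unfolding transform_def[of g] by (auto simp: sum_distrib_left cnj_sum intro!: sum.cong)
    also have "\<dots> = (\<Sum>y\<in>?G. \<Sum>v\<in>W. if frac_part y = v then transform f v \<theta> * cnj (g y * wave (int_part y) \<theta>) else 0)"
      by (rule sum.swap)
    also have "\<dots> = (\<Sum>y\<in>?G. transform f (frac_part y) \<theta> * cnj (g y * wave (int_part y) \<theta>))"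
      using W by (intro sum.cong) (auto simp: sum.delta')
    also have "\<dots> = (\<Sum>y\<in>?G. \<Sum>x\<in>?F. if frac_part x = frac_part y then f x * cnj (g y) * wave (int_part x - int_part y) \<theta> else 0)"
      unfolding transform_def[of f] diff_conv_add_uminus wave_add
      by (auto simp: sum_distrib_right sum_distrib_left cnj_wave mult_ac intro!: sum.cong)
    finally show ?thesis .
  qed
  then have "(\<integral>\<theta>. (\<Sum>v\<in>W. transform f v \<theta> * cnj (transform g v \<theta>)) \<partial>angles)
    = (\<integral>\<theta>. (\<Sum>y\<in>?G. \<Sum>x\<in>?F. (if frac_part x = frac_part y then f x * cnj (g y) else 0) * wave (int_part x - int_part y) \<theta>) \<partial>angles)"
    by (auto intro!: Bochner_Integration.integral_cong sum.cong)
  also have "\<dots> = (\<Sum>y\<in>?G. \<Sum>x\<in>?F. (if frac_part x = frac_part y then f x * cnj (g y) else 0) *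
      (\<integral>\<theta>. wave (int_part x - int_part y) \<theta> \<partial>angles))"
  proof -
    have i: "integrable angles (\<lambda>\<theta>. c * wave m \<theta>)" for c and m :: "real ^ 'a"
      by (intro integrable_mult_right angles.integrable_const_bound[of _ 1]) auto
    show ?thesis
      by (simp add: Bochner_Integration.integral_sum i)
  qed
  also have "\<dots> = (\<Sum>y\<in>?G. \<Sum>x\<in>?F. if x = y then f x * cnj (g y) else 0)"
  proof (intro sum.cong refl)
    fix x y :: "real ^ 'a"
    have "frac_part x = frac_part y \<and> int_part x = int_part y \<longleftrightarrow> x = y"
      using int_frac_part[of x] int_frac_part[of y] by metis
    then show "(if frac_part x = frac_part y then f x * cnj (g y) else 0) *
      (\<integral>\<theta>. wave (int_part x - int_part y) \<theta> \<partial>angles) = (if x = y then f x * cnj (g y) else 0)"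
      by (auto simp: integral_wave int_points_diff)
  qed
  also have "\<dots> = (\<Sum>y\<in>?G. f y * cnj (g y))"
    using f by (auto intro!: sum.cong simp: sum.delta)
  finally show ?thesis .
qed

section \<open>Distribution of the lattice symbol\<close>

lemma symbol_bounded: "\<bar>symbol (\<theta> :: 'd::finite \<Rightarrow> real)\<bar> \<le> 2 * real CARD('d)"
proof -
  have "\<bar>symbol \<theta>\<bar> \<le> (\<Sum>s\<in>(UNIV :: 'd set). 2)"
    unfolding symbol_def by (rule order_trans[OF sum_abs], rule sum_mono) (simp add: abs_mult)
  then show ?thesis by simp
qed

text \<open>Apart from 0, pi and 2 pi the interval splits into two branches on which cosine has the
  inverses arccos and 2 pi - arccos, and differentiable maps keep negligible sets negligible. The
  points -1 and 1, where arccos is not differentiable, are removed in N'.\<close>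

lemma negligible_cos_vimage:
  assumes N: "negligible N"
  shows "negligible {y \<in> {0..2 * pi}. 2 * cos y + r \<in> N}"
proof -
  define N' where "N' = (\<lambda>x. (x - r) / 2) ` N \<inter> {-1<..<1}"
  have "((\<lambda>x. (x - r) / 2) has_real_derivative 1 / 2) (at x within N)" for x
    by (rule derivative_eq_intros refl | simp)+
  then have "(\<lambda>x. (x - r) / 2) differentiable_on N"
    unfolding differentiable_on_def real_differentiable_def by blast
  then have "negligible ((\<lambda>x. (x - r) / 2) ` N)"
    by (rule negligible_differentiable_image_negligible[OF _ N, rotated]) simp
  then have N': "negligible N'"
    unfolding N'_def by (rule negligible_subset) auto
  have diff: "arccos differentiable_on N'"
    unfolding differentiable_on_def N'_def
  proof
    fix x :: real assume "x \<in> (\<lambda>x. (x - r) / 2) ` N \<inter> {-1<..<1}"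
    then have "(arccos has_real_derivative inverse (- sqrt (1 - x\<^sup>2))) (at x)"
      by (intro DERIV_arccos) auto
    then show "arccos differentiable at x within (\<lambda>x. (x - r) / 2) ` N \<inter> {-1<..<1}"
      unfolding real_differentiable_def using has_field_derivative_at_within by blast
  qed
  have 1: "negligible (arccos ` N')"
    by (rule negligible_differentiable_image_negligible[OF _ N' diff]) simp
  have 2: "negligible ((\<lambda>x. 2 * pi - arccos x) ` N')"
    by (rule negligible_differentiable_image_negligible[OF _ N']) (auto intro!: derivative_intros diff)
  have "{y \<in> {0..2 * pi}. 2 * cos y + r \<in> N} \<subseteq> arccos ` N' \<union> (\<lambda>x. 2 * pi - arccos x) ` N' \<union> {0, pi, 2 * pi}"
  proof
    fix y assume y: "y \<in> {y \<in> {0..2 * pi}. 2 * cos y + r \<in> N}"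
    show "y \<in> arccos ` N' \<union> (\<lambda>x. 2 * pi - arccos x) ` N' \<union> {0, pi, 2 * pi}"
    proof (cases "y \<in> {0, pi, 2 * pi}")
      case False
      have im: "cos y \<in> (\<lambda>x. (x - r) / 2) ` N"
        using y by (auto intro!: image_eqI[of _ _ "2 * cos y + r"])
      show ?thesis
      proof (cases "y \<le> pi")
        case True
        then have "0 < y" "y < pi" using y False by auto
        then have "cos y < cos 0" "cos pi < cos y"
          using cos_monotone_0_pi[of 0 y] cos_monotone_0_pi[of y pi] by simp_all
        then have "cos y \<in> N'" using im by (simp add: N'_def)
        moreover have "y = arccos (cos y)"
          using \<open>0 < y\<close> \<open>y < pi\<close> by (simp add: arccos_cos)
        ultimately show ?thesis by blast
      next
        case y2: False
        define z where "z = 2 * pi - y"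
        have z: "0 < z" "z < pi" "cos z = cos y"
          using y y2 False by (auto simp: z_def cos_diff)
        then have "cos z < cos 0" "cos pi < cos z"
          using cos_monotone_0_pi[of 0 z] cos_monotone_0_pi[of z pi] by simp_all
        then have "cos y \<in> N'" using im z by (simp add: N'_def)
        moreover have "y = 2 * pi - arccos (cos y)"
          using z arccos_cos[of z] by (simp add: z_def)
        ultimately show ?thesis by blast
      qed
    qed auto
  qed
  then show ?thesis
    by (rule negligible_subset[rotated]) (auto intro!: negligible_Un 1 2)
qed

lemma null_sets_lborel_negligible: "N \<in> null_sets lborel \<Longrightarrow> negligible (N :: real set)"
  by (auto simp: negligible_iff_null_sets intro: null_sets_completionI)

text \<open>By Fubini it is enough to vary one angle with the others fixed: the symbol is then 2 cos
  y + r, and \<open>negligible_cos_vimage\<close> applies to each fibre.\<close>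

lemma symbol_null:
  assumes N: "N \<in> null_sets lborel"
  shows "emeasure angles {\<theta> :: 'd::finite \<Rightarrow> real. symbol \<theta> \<in> N} = 0"
proof -
  obtain s :: 'd where True by blast
  have Nb [measurable]: "N \<in> sets borel" using N by auto
  define I where "I = UNIV - {s}"
  have I: "finite I" "s \<notin> I" "insert s I = UNIV" by (auto simp: I_def)
  have ms: "{\<theta> :: 'd \<Rightarrow> real. symbol \<theta> \<in> N} \<in> sets angles"
    using measurable_sets[OF measurable_symbol Nb] by (simp add: vimage_def)
  have "emeasure angles {\<theta> :: 'd \<Rightarrow> real. symbol \<theta> \<in> N} = (\<integral>\<^sup>+\<theta>. indicator {\<theta>. symbol \<theta> \<in> N} \<theta> \<partial>PiM (insert s I) (\<lambda>_. angle_measure))"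
    using ms by (simp add: I(3) angles_def)
  also have "\<dots> = (\<integral>\<^sup>+\<theta>. \<integral>\<^sup>+y. indicator {\<theta>. symbol \<theta> \<in> N} (\<theta>(s := y)) \<partial>angle_measure \<partial>PiM I (\<lambda>_. angle_measure))"
    by (rule angle_product.product_nn_integral_insert[OF I(1,2)])
      (use ms in \<open>simp add: I(3) angles_def\<close>)
  also have "\<dots> = (\<integral>\<^sup>+\<theta>. 0 \<partial>PiM I (\<lambda>_. angle_measure))"
  proof (rule nn_integral_cong)
    fix \<theta> :: "'d \<Rightarrow> real"
    define r where "r = (\<Sum>i\<in>I. 2 * cos (\<theta> i))"
    have sym: "symbol (\<theta>(s := y)) = 2 * cos y + r" for y
    proof -
      have "symbol (\<theta>(s := y)) = (\<Sum>i\<in>insert s I. 2 * cos ((\<theta>(s := y)) i))"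
        unfolding symbol_def I(3) ..
      also have "\<dots> = 2 * cos y + (\<Sum>i\<in>I. 2 * cos ((\<theta>(s := y)) i))"
        by (subst sum.insert[OF I(1,2)]) simp
      also have "(\<Sum>i\<in>I. 2 * cos ((\<theta>(s := y)) i)) = r"
        unfolding r_def using I by (intro sum.cong) auto
      finally show ?thesis .
    qed
    define Y where "Y = {y. 2 * cos y + r \<in> N}"
    have Y: "Y \<in> sets borel"
      unfolding Y_def by measurable
    have "negligible ({0..2 * pi} \<inter> Y)"
    proof -
      have "{0..2 * pi} \<inter> Y = {y \<in> {0..2 * pi}. 2 * cos y + r \<in> N}"
        unfolding Y_def by blast
      then show ?thesis
        using negligible_cos_vimage[OF null_sets_lborel_negligible[OF N], of r] by (simp only:)
    qed
    then have "emeasure lborel ({0..2 * pi} \<inter> Y) = 0"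
      using Y by (auto simp: negligible_iff_emeasure0 emeasure_completion)
    then have "emeasure angle_measure Y = 0"
      unfolding angle_measure_def using Y by (subst emeasure_uniform_measure) auto
    moreover have "(\<integral>\<^sup>+y. indicator {\<theta>. symbol \<theta> \<in> N} (\<theta>(s := y)) \<partial>angle_measure) = (\<integral>\<^sup>+y. indicator Y y \<partial>angle_measure)"
      by (auto intro!: nn_integral_cong simp: sym Y_def indicator_def)
    ultimately show "(\<integral>\<^sup>+y. indicator {\<theta>. symbol \<theta> \<in> N} (\<theta>(s := y)) \<partial>angle_measure) = 0"
      using Y by simp
  qed
  finally show ?thesis by simp
qed

lemma symbol_support:
  assumes c: "\<bar>c\<bar> \<le> 2 * real CARD('d::finite)" and e: "e > 0"
  shows "emeasure angles {\<theta> :: 'd \<Rightarrow> real. \<bar>symbol \<theta> - c\<bar> < e} > 0"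
proof -
  \<comment> \<open>If all angles equal y, the symbol is exactly c. A cube around this point has
    positive measure, and \<delta> is chosen so that the symbol stays within e of c on it, cosine
    being 1-Lipschitz.\<close>
  define y where "y = arccos (c / (2 * real CARD('d)))"
  have y: "0 \<le> y" "y \<le> pi" "2 * real CARD('d) * cos y = c"
    using c by (auto simp: y_def abs_le_iff divide_le_eq le_divide_eq intro!: arccos_lbound arccos_ubound)
  define \<delta> where "\<delta> = e / (2 * real CARD('d))"
  have \<delta>: "\<delta> > 0" using e by (simp add: \<delta>_def)
  define J where "J = {y - \<delta><..<y + \<delta>}"
  have "emeasure angle_measure J > 0"
  proof -
    define l where "l = max 0 (y - \<delta>)"
    define u where "u = min (2 * pi) (y + \<delta>)"
    have lu: "l < u" using y \<delta> pi_gt_zero by (auto simp: l_def u_def)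
    have "{l<..<u} \<subseteq> {0..2 * pi} \<inter> J" by (auto simp: l_def u_def J_def)
    then have "emeasure lborel {l<..<u} \<le> emeasure lborel ({0..2 * pi} \<inter> J)"
      by (intro emeasure_mono) (auto simp: J_def)
    moreover have "emeasure lborel {l<..<u} > 0" using lu by simp
    ultimately have "emeasure lborel ({0..2 * pi} \<inter> J) > 0" by simp
    then show ?thesis
      unfolding angle_measure_def by (subst emeasure_uniform_measure) (auto simp: J_def ennreal_zero_less_divide)
  qed
  then have "(\<Prod>s\<in>(UNIV :: 'd set). emeasure angle_measure J) > 0"
    by (simp add: zero_less_iff_neq_zero)
  also have "(\<Prod>s\<in>(UNIV :: 'd set). emeasure angle_measure J) = emeasure angles (PiE (UNIV :: 'd set) (\<lambda>_. J))"
    unfolding angles_def by (rule angle_product.emeasure_PiM[symmetric]) (auto simp: J_def)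
  also have "\<dots> \<le> emeasure angles {\<theta> :: 'd \<Rightarrow> real. \<bar>symbol \<theta> - c\<bar> < e}"
  proof (rule emeasure_mono)
    show "PiE (UNIV :: 'd set) (\<lambda>_. J) \<subseteq> {\<theta>. \<bar>symbol \<theta> - c\<bar> < e}"
    proof clarify
      fix \<theta> :: "'d \<Rightarrow> real" assume \<theta>: "\<theta> \<in> PiE UNIV (\<lambda>_. J)"
      have "\<bar>2 * cos (\<theta> s) - 2 * cos y\<bar> < 2 * \<delta>" for s
      proof -
        have "\<theta> s \<in> J" using \<theta> by auto
        then have "\<bar>\<theta> s - y\<bar> < \<delta>" by (auto simp: J_def abs_less_iff)
        moreover have "\<bar>cos (\<theta> s) - cos y\<bar> \<le> \<bar>\<theta> s - y\<bar>"
        proof -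
          have "cos (\<theta> s) - cos y = 2 * (sin ((\<theta> s + y) / 2) * sin ((y - \<theta> s) / 2))"
            by (simp add: cos_diff_cos)
          then have "\<bar>cos (\<theta> s) - cos y\<bar> = 2 * (\<bar>sin ((\<theta> s + y) / 2)\<bar> * \<bar>sin ((y - \<theta> s) / 2)\<bar>)"
            by (simp add: abs_mult)
          also have "\<dots> \<le> 2 * (1 * \<bar>(y - \<theta> s) / 2\<bar>)"
            by (intro mult_left_mono mult_mono abs_sin_x_le_abs_x abs_sin_le_one) auto
          finally show ?thesis by simp
        qed
        ultimately show ?thesis by (simp add: abs_if split: if_splits)
      qed
      then have "(\<Sum>s\<in>UNIV. \<bar>2 * cos (\<theta> s) - 2 * cos y\<bar>) < (\<Sum>s\<in>(UNIV :: 'd set). 2 * \<delta>)"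
        by (intro sum_strict_mono) auto
      moreover have "symbol \<theta> - c = (\<Sum>s\<in>UNIV. 2 * cos (\<theta> s) - 2 * cos y)"
        using y(3) by (simp add: symbol_def sum_subtractf mult_ac)
      ultimately show "\<bar>symbol \<theta> - c\<bar> < e"
        by (simp add: \<delta>_def le_less_trans[OF sum_abs])
    qed
    have "{\<theta> \<in> space angles. \<bar>symbol (\<theta> :: 'd \<Rightarrow> real) - c\<bar> < e} \<in> sets angles"
      by measurable
    then show "{\<theta> :: 'd \<Rightarrow> real. \<bar>symbol \<theta> - c\<bar> < e} \<in> sets angles"
      by simp
  qed
  finally show ?thesis .
qed

text \<open>The transform turns \<open>shift_op\<close> into multiplication by
  \<open>symbol\<close>, so the spectral measure of f is the law of the symbol under the density
  |transform f|^2, summed over the orbits that f meets.\<close>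

definition shift_spectral_measure :: "(real ^ 'd::finite \<Rightarrow> complex) \<Rightarrow> real measure" where
  "shift_spectral_measure f = distr (density angles
     (\<lambda>\<theta>. ennreal (\<Sum>v\<in>frac_part ` {x. f x \<noteq> 0}. (cmod (transform f v \<theta>))\<^sup>2))) borel symbol"

lemma shift_spectral_measure:
  assumes fin: "finite {x. f x \<noteq> 0}" and V: "{x. f x \<noteq> 0} \<subseteq> V"
  shows "is_spectral_measure V shift_op f (shift_spectral_measure f)"
    and "absolutely_continuous lborel (shift_spectral_measure f)"
    and "AE x in shift_spectral_measure (f :: real ^ 'd::finite \<Rightarrow> complex). \<bar>x\<bar> \<le> 2 * real CARD('d)"
proof -
  define k where "k \<theta> = (\<Sum>v\<in>frac_part ` {x. f x \<noteq> 0}. (cmod (transform f v \<theta>))\<^sup>2)" for \<theta>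
  have k0: "0 \<le> k \<theta>" for \<theta> by (simp add: k_def sum_nonneg)
  have [measurable]: "k \<in> borel_measurable angles"
    unfolding k_def[abs_def] by measurable
  define B where "B = (\<Sum>v\<in>frac_part ` {x. f x \<noteq> 0}. (\<Sum>x | f x \<noteq> 0. cmod (f x))\<^sup>2)"
  have kB: "k \<theta> \<le> B" for \<theta>
    unfolding k_def B_def by (intro sum_mono power_mono transform_bounded) auto
  have eq: "shift_spectral_measure f = distr (density angles k) borel symbol"
    by (simp add: shift_spectral_measure_def k_def[abs_def])
  have "emeasure (density angles k) (space (density angles k)) = (\<integral>\<^sup>+\<theta>. ennreal (k \<theta>) \<partial>angles)"
    by (subst emeasure_density) (auto simp del: space_angles cong: nn_integral_cong)
  also have "\<dots> \<le> (\<integral>\<^sup>+(\<theta> :: 'd \<Rightarrow> real). ennreal B \<partial>angles)"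
    by (intro nn_integral_mono ennreal_leI kB)
  also have "\<dots> < \<infinity>"
    using angles.emeasure_space_1[where 'd='d] by simp
  finally have "finite_measure (density angles k)"
    by (intro finite_measureI) auto
  then have finM: "finite_measure (shift_spectral_measure f)"
    unfolding eq by (rule finite_measure.finite_measure_distr) auto
  show bd: "AE x in shift_spectral_measure f. \<bar>x\<bar> \<le> 2 * real CARD('d)"
    unfolding eq by (subst AE_distr_iff) (auto intro!: AE_I2 symbol_bounded)
  show "absolutely_continuous lborel (shift_spectral_measure f)"
    unfolding absolutely_continuous_def
  proof
    fix N :: "real set" assume N: "N \<in> null_sets lborel"
    then have Nb: "N \<in> sets borel" by auto
    have "symbol -` N \<in> null_sets (angles :: ('d \<Rightarrow> real) measure)"
      using symbol_null[OF N, where 'd='d] measurable_sets[OF measurable_symbol Nb] by (auto simp: vimage_def null_sets_def)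
    moreover have "absolutely_continuous angles (density angles (\<lambda>\<theta>. ennreal (k \<theta>)))"
      by (rule absolutely_continuousI_density) auto
    ultimately have "symbol -` N \<in> null_sets (density angles k)"
      by (auto simp: absolutely_continuous_def)
    then show "N \<in> null_sets (shift_spectral_measure f)"
      using Nb unfolding eq by (auto simp: null_sets_def emeasure_distr)
  qed
  have "ell2_inner V ((shift_op ^^ n) f) f = complex_of_real (\<integral>x. x ^ n \<partial>shift_spectral_measure f)" for n
  proof -
    have fs: "finite {x. (shift_op ^^ n) f x \<noteq> 0}" for n
      by (induction n) (auto intro: fin finite_support_shift_op)
    have tr: "transform ((shift_op ^^ n) f) v \<theta> = of_real (symbol \<theta> ^ n) * transform f v \<theta>" for v n \<theta>
      by (induction n) (auto simp: transform_shift_op[OF fs])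
    have "ell2_inner V ((shift_op ^^ n) f) f = (\<Sum>\<^sub>\<infinity>x\<in>{x. f x \<noteq> 0}. (shift_op ^^ n) f x * cnj (f x))"
      unfolding ell2_inner_def using V by (intro infsum_cong_neutral) auto
    also have "\<dots> = (\<integral>\<theta>. (\<Sum>v\<in>frac_part ` {x. f x \<noteq> 0}. transform ((shift_op ^^ n) f) v \<theta> * cnj (transform f v \<theta>)) \<partial>angles)"
      using fin by (subst Parseval[OF fs fin]) auto
    also have "\<dots> = (\<integral>\<theta>. complex_of_real (k \<theta> * symbol \<theta> ^ n) \<partial>angles)"
      unfolding tr k_def
      by (intro Bochner_Integration.integral_cong refl)
        (simp add: sum_distrib_right sum_distrib_left complex_norm_square mult_ac del: of_real_power)
    also have "\<dots> = complex_of_real (\<integral>\<theta>. k \<theta> * symbol \<theta> ^ n \<partial>angles)"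
      by (rule integral_complex_of_real)
    also have "(\<integral>\<theta>. k \<theta> * symbol \<theta> ^ n \<partial>angles) = (\<integral>\<theta>. symbol \<theta> ^ n \<partial>density angles k)"
      by (subst integral_density) (auto simp: k0)
    also have "\<dots> = (\<integral>x. x ^ n \<partial>shift_spectral_measure f)"
      unfolding eq by (subst integral_distr) auto
    finally show ?thesis .
  qed
  moreover have "sets (shift_spectral_measure f) = sets borel"
    by (simp add: eq)
  ultimately show "is_spectral_measure V shift_op f (shift_spectral_measure f)"
    unfolding is_spectral_measure_def using finM bd by blast
qed

section \<open>Subdivided lattices\<close>

lemma infsum_diff:
  fixes f g :: "'a \<Rightarrow> complex"
  assumes "f summable_on X" "g summable_on X"
  shows "(\<Sum>\<^sub>\<infinity>x\<in>X. f x - g x) = infsum f X - infsum g X"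
  using infsum_add[OF assms(1) summable_on_uminus[THEN iffD2, OF assms(2)]] by (simp add: infsum_uminus)

section \<open>Laplacians of graphs of bounded degree\<close>

lemma linear_laplacian: "linear_op (laplacian E)"
  unfolding linear_op_def laplacian_def
  by (simp add: fun_eq_iff algebra_simps sum.distrib sum_distrib_left sum_subtractf)

text \<open>The degree part is bounded by k; so is the adjacency part, by Cauchy-Schwarz over the at
  most k neighbours and double counting of edges. Symmetry is the exchange of the two ends in an
  absolutely convergent sum over oriented edges.\<close>

lemma laplacian_bounded_symmetric:
  assumes fin: "\<And>v. finite {u. {v, u} \<in> E}" and card: "\<And>v. card {u. {v, u} \<in> E} \<le> k"
    and EV: "\<And>u v. {v, u} \<in> E \<Longrightarrow> v \<in> V"
  shows "bounded_symmetric V (laplacian E) (2 * real k)"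
proof
  define nb where "nb v = {u. {v, u} \<in> E}" for v
  have nb: "finite (nb v)" "card (nb v) \<le> k" "u \<in> nb v \<longleftrightarrow> v \<in> nb u" "u \<in> nb v \<Longrightarrow> u \<in> V" "v \<notin> V \<Longrightarrow> nb v = {}" for u v
  proof -
    show "finite (nb v)" "card (nb v) \<le> k" using fin card by (auto simp: nb_def)
    show "u \<in> nb v \<longleftrightarrow> v \<in> nb u" by (simp add: nb_def insert_commute)
    show "u \<in> nb v \<Longrightarrow> u \<in> V" using EV[of u v] by (simp add: nb_def insert_commute)
    show "v \<notin> V \<Longrightarrow> nb v = {}" using EV[of v] by (auto simp: nb_def)
  qed
  have nb_V: "v \<in> V" if "u \<in> nb v" for u v
    using nb(4)[of v u] nb(3)[of u v] that by simp
  have lap: "laplacian E f v = of_nat (card (nb v)) * f v - (\<Sum>u\<in>nb v. f u)" for f v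
    by (simp add: laplacian_def nb_def sum_subtractf)
  show "linear_op (laplacian E)" by (rule linear_laplacian)
  fix f :: "'a \<Rightarrow> complex" assume f: "f \<in> ell2 V"
  have off: "laplacian E f v = 0" if "v \<notin> V" for v
    using nb(5)[OF that] by (simp add: lap)
  have bd: "L2_set (\<lambda>x. cmod (laplacian E f x)) X \<le> 2 * real k * ell2_norm V f" if X: "finite X" "X \<subseteq> V" for X
  proof -
    define Y where "Y = (\<Union>v\<in>X. nb v)"
    have Y: "finite Y" "Y \<subseteq> V" using X nb by (auto simp: Y_def)
    have "L2_set (\<lambda>x. cmod (laplacian E f x)) X \<le> L2_set (\<lambda>v. real k * cmod (f v) + (\<Sum>u\<in>nb v. cmod (f u))) X"
    proof (rule L2_set_mono)
      fix v
      have "cmod (laplacian E f v) \<le> cmod (of_nat (card (nb v)) * f v) + cmod (\<Sum>u\<in>nb v. f u)"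
        unfolding lap by (rule norm_triangle_ineq4)
      also have "\<dots> \<le> real k * cmod (f v) + (\<Sum>u\<in>nb v. cmod (f u))"
        using nb(2)[of v] by (intro add_mono norm_sum) (auto simp: norm_mult intro: mult_right_mono)
      finally show "cmod (laplacian E f v) \<le> real k * cmod (f v) + (\<Sum>u\<in>nb v. cmod (f u))" .
    qed simp
    also have "\<dots> \<le> L2_set (\<lambda>v. real k * cmod (f v)) X + L2_set (\<lambda>v. \<Sum>u\<in>nb v. cmod (f u)) X"
      by (rule L2_set_triangle_ineq)
    also have "L2_set (\<lambda>v. real k * cmod (f v)) X = real k * L2_set (\<lambda>v. cmod (f v)) X"
      by (rule L2_set_right_distrib[symmetric]) simp
    also have "\<dots> \<le> real k * ell2_norm V f"
      by (intro mult_left_mono L2_set_le_ell2_norm f X) auto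
    also have "L2_set (\<lambda>v. \<Sum>u\<in>nb v. cmod (f u)) X \<le> real k * ell2_norm V f"
    proof -
      have "(\<Sum>v\<in>X. (\<Sum>u\<in>nb v. cmod (f u))\<^sup>2) \<le> (\<Sum>v\<in>X. real k * (\<Sum>u\<in>nb v. (cmod (f u))\<^sup>2))"
      proof (rule sum_mono)
        fix v
        have "(\<Sum>u\<in>nb v. cmod (f u))\<^sup>2 \<le> (\<Sum>u\<in>nb v. (cmod (f u))\<^sup>2) * card (nb v)"
          by (rule sum_squared_le_sum_of_squares) 
        also have "\<dots> \<le> (\<Sum>u\<in>nb v. (cmod (f u))\<^sup>2) * real k"
          using nb(2)[of v] by (intro mult_left_mono) (auto intro: sum_nonneg)
        finally show "(\<Sum>u\<in>nb v. cmod (f u))\<^sup>2 \<le> real k * (\<Sum>u\<in>nb v. (cmod (f u))\<^sup>2)"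
          by (simp add: mult.commute)
      qed
      also have "\<dots> = real k * (\<Sum>v\<in>X. \<Sum>u | u \<in> Y \<and> u \<in> nb v. (cmod (f u))\<^sup>2)"
      proof -
        have "{u. u \<in> Y \<and> u \<in> nb v} = nb v" if "v \<in> X" for v
          using that by (auto simp: Y_def)
        then show ?thesis by (simp add: sum_distrib_left)
      qed
      finally have "(\<Sum>v\<in>X. (\<Sum>u\<in>nb v. cmod (f u))\<^sup>2) \<le> real k * (\<Sum>v\<in>X. \<Sum>u | u \<in> Y \<and> u \<in> nb v. (cmod (f u))\<^sup>2)" .
      moreover have "(\<Sum>v\<in>X. \<Sum>u | u \<in> Y \<and> u \<in> nb v. (cmod (f u))\<^sup>2) = (\<Sum>u\<in>Y. \<Sum>v | v \<in> X \<and> u \<in> nb v. (cmod (f u))\<^sup>2)"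
        by (rule sum.swap_restrict[OF X(1) Y(1)])
      moreover have "\<dots> \<le> (\<Sum>u\<in>Y. real k * (cmod (f u))\<^sup>2)"
      proof (rule sum_mono)
        fix u
        have "card {v. v \<in> X \<and> u \<in> nb v} \<le> card (nb u)"
          by (rule card_mono) (use nb in auto)
        then have "real (card {v. v \<in> X \<and> u \<in> nb v}) \<le> real k"
          using nb(2)[of u] by simp
        then show "(\<Sum>v | v \<in> X \<and> u \<in> nb v. (cmod (f u))\<^sup>2) \<le> real k * (cmod (f u))\<^sup>2"
          by (simp add: mult_right_mono)
      qed
      ultimately have "(\<Sum>v\<in>X. (\<Sum>u\<in>nb v. cmod (f u))\<^sup>2) \<le> real k * (\<Sum>u\<in>Y. real k * (cmod (f u))\<^sup>2)"
        using mult_left_mono[of "\<Sum>v\<in>X. \<Sum>u | u \<in> Y \<and> u \<in> nb v. (cmod (f u))\<^sup>2"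
            "\<Sum>u\<in>Y. real k * (cmod (f u))\<^sup>2" "real k"] by simp
      also have "(\<Sum>u\<in>Y. real k * (cmod (f u))\<^sup>2) = real k * (L2_set (\<lambda>u. cmod (f u)) Y)\<^sup>2"
        by (simp add: L2_set_def sum_nonneg sum_distrib_left)
      also have "real k * (real k * (L2_set (\<lambda>u. cmod (f u)) Y)\<^sup>2) \<le> real k * (real k * (ell2_norm V f)\<^sup>2)"
        by (intro mult_left_mono power_mono L2_set_le_ell2_norm f Y) auto
      finally have "(\<Sum>v\<in>X. (\<Sum>u\<in>nb v. cmod (f u))\<^sup>2) \<le> (real k * ell2_norm V f)\<^sup>2"
        by (simp add: power_mult_distrib power2_eq_square[of "real k"] mult.assoc mult_left_mono)
      then show ?thesis
        unfolding L2_set_def by (intro real_le_lsqrt) (auto intro: sum_nonneg)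
    qed
    finally show ?thesis by simp
  qed
  show "laplacian E f \<in> ell2 V"
    by (rule ell2_boundI(1)[OF off bd])
  show "ell2_norm V (laplacian E f) \<le> 2 * real k * ell2_norm V f"
    by (rule ell2_boundI(2)[OF off bd])
  fix g :: "'a \<Rightarrow> complex" assume g: "g \<in> ell2 V"
  have sum1: "(\<lambda>(v, u). (cmod (g v))\<^sup>2) summable_on Sigma V nb" if g: "g \<in> ell2 V" for g
  proof (rule nonneg_bdd_above_summable_on)
    show "bdd_above (sum (\<lambda>(v, u). (cmod (g v))\<^sup>2) ` {F. F \<subseteq> Sigma V nb \<and> finite F})"
    proof (rule bdd_aboveI2)
      fix F assume "F \<in> {F. F \<subseteq> Sigma V nb \<and> finite F}"
      then have F: "F \<subseteq> Sigma V nb" "finite F" by auto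
      have "sum (\<lambda>(v, u). (cmod (g v))\<^sup>2) F \<le> sum (\<lambda>(v, u). (cmod (g v))\<^sup>2) (Sigma (fst ` F) nb)"
        using F nb(1) by (intro sum_mono2) (auto intro!: finite_SigmaI image_eqI)
      also have "\<dots> = (\<Sum>v\<in>fst ` F. \<Sum>u\<in>nb v. (cmod (g v))\<^sup>2)"
        using F nb(1) by (intro sum.Sigma[symmetric]) auto
      also have "\<dots> \<le> (\<Sum>v\<in>fst ` F. real k * (cmod (g v))\<^sup>2)"
        using nb(2) by (intro sum_mono) (auto intro!: mult_right_mono)
      also have "\<dots> = real k * (\<Sum>v\<in>fst ` F. (cmod (g v))\<^sup>2)"
        by (simp add: sum_distrib_left)
      also have "\<dots> \<le> real k * (\<Sum>\<^sub>\<infinity>v\<in>V. (cmod (g v))\<^sup>2)"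
        using F by (intro mult_left_mono finite_sum_le_infsum ell2_summable g) auto
      finally show "sum (\<lambda>(v, u). (cmod (g v))\<^sup>2) F \<le> real k * (\<Sum>\<^sub>\<infinity>v\<in>V. (cmod (g v))\<^sup>2)" .
    qed
  qed auto
  have swap: "bij_betw prod.swap (Sigma V nb) (Sigma V nb)"
    by (rule bij_betwI[of _ _ _ prod.swap]) (auto intro: nb(4) nb_V simp: nb(3))
  have sum2: "(\<lambda>(v, u). (cmod (g u))\<^sup>2) summable_on Sigma V nb" if g: "g \<in> ell2 V" for g
    using sum1[OF g] summable_on_reindex_bij_betw[OF swap, of "\<lambda>(v, u). (cmod (g v))\<^sup>2"]
    by (simp add: case_prod_unfold)
  have abs: "(\<lambda>(v, u). f u * cnj (g v)) summable_on Sigma V nb" if f: "f \<in> ell2 V" and g: "g \<in> ell2 V" for f g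
  proof (rule abs_summable_summable, rule Infinite_Sum.abs_summable_on_comparison_test')
    show "(\<lambda>p. (case p of (v, u) \<Rightarrow> (cmod (f u))\<^sup>2) + (case p of (v, u) \<Rightarrow> (cmod (g v))\<^sup>2)) summable_on Sigma V nb"
      by (rule summable_on_add[OF sum2[OF f] sum1[OF g]])
    fix p :: "'a \<times> 'a"
    obtain v u where p: "p = (v, u)" by force
    have "0 \<le> cmod (f u) * cmod (g v)" by simp
    then show "norm (case p of (v, u) \<Rightarrow> f u * cnj (g v)) \<le> (case p of (v, u) \<Rightarrow> (cmod (f u))\<^sup>2) + (case p of (v, u) \<Rightarrow> (cmod (g v))\<^sup>2)"
      using sum_squares_bound[of "cmod (f u)" "cmod (g v)"] unfolding p prod.case norm_mult complex_mod_cnj by linarith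
  qed
  have A: "(\<Sum>\<^sub>\<infinity>v\<in>V. (\<Sum>u\<in>nb v. f u) * cnj (g v)) = (\<Sum>\<^sub>\<infinity>(v, u)\<in>Sigma V nb. f u * cnj (g v))"
    "(\<lambda>v. (\<Sum>u\<in>nb v. f u) * cnj (g v)) summable_on V"
    if fg: "f \<in> ell2 V" "g \<in> ell2 V" for f g
  proof -
    have eq: "(\<Sum>\<^sub>\<infinity>u\<in>nb v. f u * cnj (g v)) = (\<Sum>u\<in>nb v. f u) * cnj (g v)" for v
      using nb(1) by (simp add: sum_distrib_right)
    show "(\<Sum>\<^sub>\<infinity>v\<in>V. (\<Sum>u\<in>nb v. f u) * cnj (g v)) = (\<Sum>\<^sub>\<infinity>(v, u)\<in>Sigma V nb. f u * cnj (g v))"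
      using infsum_Sigma'_banach[OF abs[OF fg]] unfolding eq by simp
    show "(\<lambda>v. (\<Sum>u\<in>nb v. f u) * cnj (g v)) summable_on V"
      using summable_on_Sigma_banach[OF abs[OF fg]] unfolding eq by simp
  qed
  have D: "(\<lambda>v. of_nat (card (nb v)) * f v * cnj (g v)) summable_on V"
  proof (rule abs_summable_summable, rule Infinite_Sum.abs_summable_on_comparison_test')
    show "(\<lambda>v. real k * norm (f v * cnj (g v))) summable_on V"
      by (intro summable_on_cmult_right ell2_inner_abs_summable f g)
    show "norm (of_nat (card (nb v)) * f v * cnj (g v)) \<le> real k * norm (f v * cnj (g v))" for v
      using nb(2)[of v] by (auto simp: norm_mult mult.assoc intro!: mult_right_mono)
  qed
  have "ell2_inner V (laplacian E f) g
    = (\<Sum>\<^sub>\<infinity>v\<in>V. of_nat (card (nb v)) * f v * cnj (g v) - (\<Sum>u\<in>nb v. f u) * cnj (g v))"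
    by (simp add: ell2_inner_def lap left_diff_distrib)
  also have "\<dots> = (\<Sum>\<^sub>\<infinity>v\<in>V. of_nat (card (nb v)) * f v * cnj (g v)) - (\<Sum>\<^sub>\<infinity>(v, u)\<in>Sigma V nb. f u * cnj (g v))"
    using infsum_diff[OF D A(2)[OF f g]] A(1)[OF f g] by simp
  also have "(\<Sum>\<^sub>\<infinity>(v, u)\<in>Sigma V nb. f u * cnj (g v)) = (\<Sum>\<^sub>\<infinity>(v, u)\<in>Sigma V nb. f v * cnj (g u))"
    using infsum_reindex_bij_betw[OF swap, of "\<lambda>(v, u). f u * cnj (g v)"] by (simp add: case_prod_unfold)
  also have "\<dots> = cnj (\<Sum>\<^sub>\<infinity>(v, u)\<in>Sigma V nb. g u * cnj (f v))"
    by (simp add: infsum_cnj[symmetric] case_prod_unfold mult.commute)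
  also have "\<dots> = cnj (\<Sum>\<^sub>\<infinity>v\<in>V. (\<Sum>u\<in>nb v. g u) * cnj (f v))"
    using A(1)[OF g f] by simp
  also have "(\<Sum>\<^sub>\<infinity>v\<in>V. of_nat (card (nb v)) * f v * cnj (g v)) - \<dots>
    = cnj ((\<Sum>\<^sub>\<infinity>v\<in>V. of_nat (card (nb v)) * g v * cnj (f v)) - (\<Sum>\<^sub>\<infinity>v\<in>V. (\<Sum>u\<in>nb v. g u) * cnj (f v)))"
    by (simp add: infsum_cnj[symmetric] mult_ac)
  also have "(\<Sum>\<^sub>\<infinity>v\<in>V. of_nat (card (nb v)) * g v * cnj (f v)) - (\<Sum>\<^sub>\<infinity>v\<in>V. (\<Sum>u\<in>nb v. g u) * cnj (f v))
    = ell2_inner V (laplacian E g) f"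
  proof -
    have "(\<lambda>v. cnj (of_nat (card (nb v)) * f v * cnj (g v))) summable_on V"
      using D by (rule summable_on_cnj_iff[THEN iffD2])
    then have "(\<lambda>v. of_nat (card (nb v)) * g v * cnj (f v)) summable_on V"
      by (simp add: mult_ac)
    from infsum_diff[OF this A(2)[OF g f]] show ?thesis
      by (simp add: ell2_inner_def lap left_diff_distrib)
  qed
  finally show "ell2_inner V (laplacian E f) g = ell2_inner V f (laplacian E g)"
    by (simp flip: ell2_inner_commute)
qed

section \<open>Coordinates and neighbours in the subdivided lattice\<close>

lemma int_part_axis_scale:
  assumes "0 \<le> c" "c < 1" shows "int_part (c *\<^sub>R axis s 1) = (0 :: real ^ 'd)"
  using assms by (auto simp: int_part_def vec_eq_iff axis_def floor_eq_iff)

lemma axis_scale_eq_iff: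
  fixes a b :: real
  assumes "a \<noteq> 0" shows "a *\<^sub>R axis s 1 = b *\<^sub>R (axis r 1 :: real ^ 'd::finite) \<longleftrightarrow> s = r \<and> a = b"
proof
  assume eq: "a *\<^sub>R axis s 1 = b *\<^sub>R (axis r 1 :: real ^ 'd)"
  have "(a *\<^sub>R axis s 1 :: real ^ 'd) $ s = (b *\<^sub>R axis r 1 :: real ^ 'd) $ s"
    by (simp add: eq)
  with assms show "s = r \<and> a = b"
    by (auto simp: axis_def split: if_splits)
qed auto

locale subdivided_lattice =
  fixes N :: nat and t :: "'d::finite \<Rightarrow> nat \<Rightarrow> real"
  assumes N: "N \<ge> 1" and t: "edge_parameters N t"
begin

abbreviation "pt \<equiv> edge_point t"
abbreviation "V \<equiv> subdiv_verts N t"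
abbreviation "E \<equiv> subdiv_edges N t"
abbreviation "lap \<equiv> laplacian E"
abbreviation "e s \<equiv> (axis s 1 :: real ^ 'd)"

lemma t_0 [simp]: "t s 0 = 0" and t_last: "t s (Suc N) = 1"
  and t_less: "i < j \<Longrightarrow> j \<le> Suc N \<Longrightarrow> t s i < t s j"
  using t by (auto simp: edge_parameters_def strict_mono_on_def)

lemma t_inner: "1 \<le> j \<Longrightarrow> j \<le> N \<Longrightarrow> 0 < t s j \<and> t s j < 1"
  using t_less[of 0 j s] t_less[of j "Suc N" s] t_last[of s] by simp

lemma t_range: "j \<le> N \<Longrightarrow> 0 \<le> t s j \<and> t s j < 1"
  using t_inner[of j s] by (cases "j = 0") auto

lemma pt_0 [simp]: "pt m s 0 = m"
  by (simp add: edge_point_def)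

lemma pt_last [simp]: "pt m s (Suc N) = m + e s"
  by (simp add: edge_point_def t_last)

lemma pt_add: "pt (m + n) s j = pt m s j + n"
  by (simp add: edge_point_def algebra_simps)

lemma int_part_pt: "m \<in> int_points \<Longrightarrow> j \<le> N \<Longrightarrow> int_part (pt m s j) = m"
  using int_part_add[of m "t s j *\<^sub>R e s"] int_part_axis_scale[of "t s j" s] t_range[of j s]
  by (simp add: edge_point_def add.commute)

lemma frac_part_pt: "m \<in> int_points \<Longrightarrow> j \<le> N \<Longrightarrow> frac_part (pt m s j) = pt 0 s j"
  by (simp add: frac_part_def int_part_pt) (simp add: edge_point_def)

lemma frac_part_int [simp]: "m \<in> int_points \<Longrightarrow> frac_part m = 0"
  by (simp add: frac_part_def int_part_eq_self)

lemma pt_0_inj: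
  assumes "1 \<le> j" "j \<le> N" "i \<le> N" "pt 0 s j = pt 0 r i"
  shows "s = r \<and> j = i"
proof -
  have "s = r \<and> t s j = t r i"
    using assms t_inner[of j s] axis_scale_eq_iff[of "t s j" s "t r i" r] by (simp add: edge_point_def)
  moreover have "j = i" if "t s j = t s i"
    using that t_less[of j i s] t_less[of i j s] assms by (cases j i rule: linorder_cases) auto
  ultimately show ?thesis by auto
qed

text \<open>A lattice point is \<open>pt m s 0\<close> for every s and also the far end of other
  edges, so the left-hand vertex is required to be an added one; comparing integral and fractional
  parts then recovers all three coordinates.\<close>

lemma pt_inj:
  assumes "m \<in> int_points" "n \<in> int_points" "1 \<le> j" "j \<le> N" "i \<le> Suc N" "pt m s j = pt n r i"
  shows "m = n" "s = r" "j = i"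
proof -
  have "m = n \<and> s = r \<and> j = i"
  proof (cases "i = Suc N")
    case True
    then have "frac_part (pt m s j) = 0"
      unfolding assms(6) using assms by (simp add: int_points_add)
    then have "pt 0 s j = pt 0 s 0"
      using frac_part_pt[OF assms(1,4), of s] by simp
    then show ?thesis
      using pt_0_inj[of j 0 s s] assms by simp
  next
    case False
    then have "i \<le> N" using assms by simp
    then have "m = n" "pt 0 s j = pt 0 r i"
      using assms int_part_pt[of m j s] int_part_pt[of n i r] frac_part_pt[of m j s] frac_part_pt[of n i r] by auto
    then show ?thesis
      using pt_0_inj[of j i s r] assms \<open>i \<le> N\<close> by simp
  qed
  then show "m = n" "s = r" "j = i" by auto
qed

lemma pt_not_int: "1 \<le> j \<Longrightarrow> j \<le> N \<Longrightarrow> m \<in> int_points \<Longrightarrow> pt m s j \<notin> int_points"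
  using pt_inj(3)[of m "pt m s j" j 0 s s] by auto

lemma edge_iff: "{v, u} \<in> E \<longleftrightarrow> (\<exists>m s j. m \<in> int_points \<and> j \<le> N \<and>
    (v = pt m s j \<and> u = pt m s (Suc j) \<or> u = pt m s j \<and> v = pt m s (Suc j)))"
  unfolding subdiv_edges_def by (auto simp: doubleton_eq_iff)

lemma vert_cases:
  assumes "v \<in> V"
  obtains "v \<in> int_points" | m s j where "m \<in> int_points" "1 \<le> j" "j \<le> N" "v = pt m s j"
proof -
  obtain m s j where m: "m \<in> int_points" "j \<le> N + 1" "v = pt m s j"
    using assms by (auto simp: subdiv_verts_def)
  consider "j = 0" | "j = Suc N" | "1 \<le> j" "j \<le> N" using m(2) by linarith
  then show ?thesis
  proof cases
    case 2
    then show ?thesis using that(1) m by (simp add: int_points_add)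
  qed (use that m in auto)
qed

lemma pt_vert: "m \<in> int_points \<Longrightarrow> j \<le> Suc N \<Longrightarrow> pt m s j \<in> V"
  by (auto simp: subdiv_verts_def)

lemma int_vert: "m \<in> int_points \<Longrightarrow> m \<in> V"
  using pt_vert[of m 0] by simp

sublocale periodic_set V
proof
  fix x m assume "x \<in> V" "m \<in> (int_points :: (real ^ 'd) set)"
  then show "x + m \<in> V"
    by (cases rule: vert_cases) (auto intro: int_vert int_points_add pt_vert simp flip: pt_add)
qed

lemma nb_inner:
  assumes "m \<in> int_points" "1 \<le> j" "j \<le> N"
  shows "{u. {pt m s j, u} \<in> E} = {pt m s (j - 1), pt m s (Suc j)}"
proof
  show "{u. {pt m s j, u} \<in> E} \<subseteq> {pt m s (j - 1), pt m s (Suc j)}"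
  proof
    fix u assume "u \<in> {u. {pt m s j, u} \<in> E}"
    then obtain n r i where n: "n \<in> int_points" "i \<le> N" and
      c: "pt m s j = pt n r i \<and> u = pt n r (Suc i) \<or> u = pt n r i \<and> pt m s j = pt n r (Suc i)"
      by (auto simp: edge_iff)
    from c show "u \<in> {pt m s (j - 1), pt m s (Suc j)}"
    proof
      assume a: "pt m s j = pt n r i \<and> u = pt n r (Suc i)"
      then have "m = n" "s = r" "j = i" using pt_inj[OF assms(1) n(1) assms(2,3), of i s r] n(2) by auto
      then show ?thesis using a by simp
    next
      assume a: "u = pt n r i \<and> pt m s j = pt n r (Suc i)"
      then have "m = n" "s = r" "j = Suc i" using pt_inj[OF assms(1) n(1) assms(2,3), of "Suc i" s r] n(2) by auto
      then show ?thesis using a by simp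
    qed
  qed
  have "{pt m s j, pt m s (Suc j)} \<in> E"
    unfolding edge_iff using assms by blast
  moreover have "{pt m s j, pt m s (j - 1)} \<in> E"
    unfolding edge_iff using assms by (intro exI[of _ m] exI[of _ s] exI[of _ "j - 1"]) auto
  ultimately show "{pt m s (j - 1), pt m s (Suc j)} \<subseteq> {u. {pt m s j, u} \<in> E}"
    by auto
qed

lemma pt_pred_neq: "m \<in> int_points \<Longrightarrow> 1 \<le> j \<Longrightarrow> j \<le> N \<Longrightarrow> pt m s (j - 1) \<noteq> pt m s (Suc j)"
proof -
  assume "1 \<le> j" "j \<le> N"
  then have "t s (j - 1) < t s (Suc j)" by (intro t_less) auto
  then show ?thesis
    by (auto simp: edge_point_def dest!: arg_cong[of _ _ "\<lambda>x. x $ s"])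
qed

lemma nb_int:
  assumes "m \<in> int_points"
  shows "{u. {m, u} \<in> E} = (\<Union>s\<in>UNIV. {pt m s 1, pt (m - e s) s N})"
proof
  show "{u. {m, u} \<in> E} \<subseteq> (\<Union>s\<in>UNIV. {pt m s 1, pt (m - e s) s N})"
  proof clarify
    fix u assume "{m, u} \<in> E"
    then obtain n r i where n: "n \<in> int_points" "i \<le> N" and
      c: "m = pt n r i \<and> u = pt n r (Suc i) \<or> u = pt n r i \<and> m = pt n r (Suc i)"
      by (auto simp: edge_iff)
    from c show "u \<in> (\<Union>s\<in>UNIV. {pt m s 1, pt (m - e s) s N})"
    proof
      assume a: "m = pt n r i \<and> u = pt n r (Suc i)"
      then have "i = 0" using pt_not_int[of i n r] n assms by (cases "i = 0") auto
      then show ?thesis using a by auto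
    next
      assume a: "u = pt n r i \<and> m = pt n r (Suc i)"
      then have "i = N" using pt_not_int[of "Suc i" n r] n assms by (cases "i = N") auto
      then have "u = pt (m - e r) r N" using a by simp
      then show ?thesis by blast
    qed
  qed
  have "{m, pt m s 1} \<in> E" for s
    unfolding edge_iff using assms by (intro exI[of _ m] exI[of _ s] exI[of _ 0]) auto
  moreover have "{m, pt (m - e s) s N} \<in> E" for s
    unfolding edge_iff using assms by (intro exI[of _ "m - e s"] exI[of _ s] exI[of _ N]) (auto simp: int_points_diff)
  ultimately show "(\<Union>s\<in>UNIV. {pt m s 1, pt (m - e s) s N}) \<subseteq> {u. {m, u} \<in> E}"
    by auto
qed

lemma edge_vert: "{v, u} \<in> E \<Longrightarrow> v \<in> V"
  unfolding edge_iff by (auto intro!: pt_vert)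

lemma nb_off: "v \<notin> V \<Longrightarrow> {u. {v, u} \<in> E} = {}"
  using edge_vert by blast

text \<open>As N \<ge> 1, each of the 2d lattice edges at m has an added vertex of its own next to
  m. Hence these neighbours are distinct and the sum in the Laplacian can be split by
  direction.\<close>

lemma nb_neq:
  assumes "m \<in> int_points"
  shows "pt m s 1 \<noteq> pt (m - e r) r N"
    and "s \<noteq> r \<Longrightarrow> {pt m s 1, pt (m - e s) s N} \<inter> {pt m r 1, pt (m - e r) r N} = {}"
proof -
  have me: "m - e s \<in> int_points" "m \<noteq> m - e s" for s
    using assms by (auto simp: int_points_diff)
  show 1: "pt m s 1 \<noteq> pt (m - e r) r N" for s r
    using pt_inj(1)[OF assms me(1), of 1 N s r r] N me(2)[of r] by auto
  show "s \<noteq> r \<Longrightarrow> {pt m s 1, pt (m - e s) s N} \<inter> {pt m r 1, pt (m - e r) r N} = {}"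
    using 1[of s r] 1[of r s] pt_inj(2)[OF assms assms, of 1 1 s r] pt_inj(2)[OF me(1) me(1), of N N s s r r] N
    by auto
qed

lemma lap_inner:
  assumes "m \<in> int_points" "1 \<le> j" "j \<le> N"
  shows "lap f (pt m s j) = 2 * f (pt m s j) - f (pt m s (j - 1)) - f (pt m s (Suc j))"
  unfolding laplacian_def nb_inner[OF assms] using pt_pred_neq[OF assms] by simp

lemma lap_int:
  assumes "m \<in> int_points"
  shows "lap f m = (\<Sum>s\<in>UNIV. 2 * f m - f (pt m s 1) - f (pt (m - e s) s N))"
proof -
  have "lap f m = (\<Sum>s\<in>UNIV. \<Sum>u\<in>{pt m s 1, pt (m - e s) s N}. f m - f u)"
    unfolding laplacian_def nb_int[OF assms] using nb_neq(2)[OF assms]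
    by (intro sum.UNION_disjoint) auto
  also have "\<dots> = (\<Sum>s\<in>UNIV. 2 * f m - f (pt m s 1) - f (pt (m - e s) s N))"
    using nb_neq(1)[OF assms] by (intro sum.cong refl) simp
  finally show ?thesis .
qed

lemma lap_off: "v \<notin> V \<Longrightarrow> lap f v = 0"
  by (simp add: laplacian_def nb_off)

lemma nb_bounds: "finite {u. {v, u} \<in> E}" "card {u. {v, u} \<in> E} \<le> 2 * CARD('d)"
proof -
  have "finite {u. {v, u} \<in> E} \<and> card {u. {v, u} \<in> E} \<le> 2 * CARD('d)"
  proof (cases "v \<in> V")
    case True
    then show ?thesis
    proof (cases rule: vert_cases)
      case 1
      have "card (\<Union>s\<in>(UNIV :: 'd set). {pt v s 1, pt (v - e s) s N}) \<le> (\<Sum>s\<in>(UNIV :: 'd set). card {pt v s 1, pt (v - e s) s N})"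
        by (rule card_UN_le) simp
      also have "\<dots> \<le> (\<Sum>s\<in>(UNIV :: 'd set). 2)"
        by (intro sum_mono) (auto simp: card_insert_if)
      finally show ?thesis
        by (simp add: nb_int[OF 1] mult.commute)
    next
      case (2 m s j)
      have "CARD('d) > 0" by simp
      then have "2 \<le> 2 * CARD('d)" by linarith
      moreover have "card {pt m s (j - 1), pt m s (Suc j)} \<le> 2"
        by (auto simp: card_insert_if)
      ultimately have "card {pt m s (j - 1), pt m s (Suc j)} \<le> 2 * CARD('d)"
        by linarith
      then show ?thesis
        unfolding 2(4) nb_inner[OF 2(1-3)] by simp
    qed
  qed (simp add: nb_off)
  then show "finite {u. {v, u} \<in> E}" "card {u. {v, u} \<in> E} \<le> 2 * CARD('d)" by auto
qed

sublocale lap: bounded_symmetric V lap "2 * real (2 * CARD('d))"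
  by (rule laplacian_bounded_symmetric[OF nb_bounds edge_vert])

end

section \<open>Elimination of the added vertices\<close>

text \<open>Up to the sign of the variable these are the Chebyshev polynomials of the second kind, in the
  variable \<open>1 - x / 2\<close>.\<close>
fun cheb :: "nat \<Rightarrow> real poly" where
  "cheb 0 = 0"
| "cheb (Suc 0) = 1"
| "cheb (Suc (Suc k)) = [:2, -1:] * cheb (Suc k) - cheb k"

text \<open>What the equation at a lattice point leaves as the factor of the value there, once the
  values at the neighbours, multiplied by U, have been expressed by lattice values.\<close>

definition discriminant :: "nat \<Rightarrow> nat \<Rightarrow> real poly" where
  "discriminant d N = [:2 * real d, -1:] * cheb (Suc N) - Polynomial.smult (2 * real d) (cheb N)"

text \<open>Along a path 2 - A is the sum of the two neighbours, which is the recursion of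
  \<open>cheb\<close> with the operator in place of the variable. The path is abstract so that an
  edge can be run through in both directions. Both inductions vary g, because the step applies the
  hypothesis to (2 - A) g.\<close>

lemma path_recursion:
  fixes A :: "('a \<Rightarrow> complex) \<Rightarrow> 'a \<Rightarrow> complex" and q :: "nat \<Rightarrow> 'a"
  assumes lin: "linear_op A"
    and path: "\<And>g j. 1 \<le> j \<Longrightarrow> j \<le> N \<Longrightarrow> op_poly A [:2, -1:] g (q j) = g (q (j - 1)) + g (q (Suc j))"
  shows "j \<le> N \<Longrightarrow> g (q (Suc j)) = op_poly A (cheb (Suc j)) g (q 1) - op_poly A (cheb j) g (q 0)"
    and "j \<le> Suc N \<Longrightarrow> op_poly A (cheb (Suc N)) g (q j)
      = op_poly A (cheb (Suc N - j)) g (q 0) + op_poly A (cheb j) g (q (Suc N))"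
proof -
  have step: "op_poly A (cheb (Suc (Suc k))) g = (\<lambda>x. op_poly A (cheb (Suc k)) (op_poly A [:2, -1:] g) x - op_poly A (cheb k) g x)" for k g
    unfolding cheb.simps op_poly_diff[OF lin] mult.commute[of "[:2, -1:]"] op_poly_mult[OF lin] ..
  show fwd: "g (q (Suc j)) = op_poly A (cheb (Suc j)) g (q 1) - op_poly A (cheb j) g (q 0)" if "j \<le> N" for j g
    using that
  proof (induction j arbitrary: g rule: induct_nat_012)
    case 0
    show ?case by (simp add: lin)
  next
    case 1
    then show ?case
      using path[of 1 g] unfolding step by (simp add: lin algebra_simps)
  next
    case (ge2 j)
    have "g (q (Suc (Suc (Suc j)))) = op_poly A [:2, -1:] g (q (Suc (Suc j))) - g (q (Suc j))"
      using path[of "Suc (Suc j)" g] ge2(3) by simp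
    also have "\<dots> = op_poly A (cheb (Suc (Suc j))) (op_poly A [:2, -1:] g) (q 1) - op_poly A (cheb (Suc j)) (op_poly A [:2, -1:] g) (q 0)
        - (op_poly A (cheb (Suc j)) g (q 1) - op_poly A (cheb j) g (q 0))"
      using ge2(1)[of g] ge2(2)[of "op_poly A [:2, -1:] g"] ge2(3) by simp
    also have "\<dots> = op_poly A (cheb (Suc (Suc (Suc j)))) g (q 1) - op_poly A (cheb (Suc (Suc j))) g (q 0)"
      using fun_cong[OF step[of "Suc j" g], of "q 1"] fun_cong[OF step[of j g], of "q 0"] by simp
    finally show ?case .
  qed
  show "op_poly A (cheb (Suc N)) g (q j)
      = op_poly A (cheb (Suc N - j)) g (q 0) + op_poly A (cheb j) g (q (Suc N))" if "j \<le> Suc N" for j g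
    using that
  proof (induction j arbitrary: g rule: induct_nat_012)
    case 0
    show ?case by simp
  next
    case 1
    show ?case
      using fwd[of N g] by (simp add: lin)
  next
    case (ge2 j)
    obtain k where k: "N = Suc (j + k)"
      using ge2(3) by (metis Suc_le_D Suc_le_mono add_Suc le_iff_add)
    let ?L = "op_poly A [:2, -1:]" and ?U = "op_poly A (cheb (Suc N))"
    have "?L (?U g) = ?U (?L g)"
      by (rule op_poly_commute[OF lin op_poly_linear[OF lin]]) (rule op_poly_commute[OF lin lin, symmetric], simp)
    then have "?U g (q (Suc (Suc j))) = ?U (?L g) (q (Suc j)) - ?U g (q j)"
      using path[of "Suc j" "?U g"] ge2(3) by simp
    also have "\<dots> = (op_poly A (cheb (Suc k)) (?L g) (q 0) - op_poly A (cheb (Suc (Suc k))) g (q 0))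
        + (op_poly A (cheb (Suc j)) (?L g) (q (Suc N)) - op_poly A (cheb j) g (q (Suc N)))"
      using ge2(1)[of g] ge2(2)[of "?L g"] ge2(3) k by simp
    also have "\<dots> = op_poly A (cheb k) g (q 0) + op_poly A (cheb (Suc (Suc j))) g (q (Suc N))"
      using fun_cong[OF step[of k g], of "q 0"] fun_cong[OF step[of j g], of "q (Suc N)"] by simp
    finally show ?case
      using k by simp
  qed
qed

section \<open>Operator identities that replace the elimination\<close>

locale subdivided_lattice_disc = subdivided_lattice N t
  for N :: nat and t :: "'d::finite \<Rightarrow> nat \<Rightarrow> real" +
  fixes D :: "real poly"
  assumes D_def: "D = discriminant CARD('d) N"
begin

abbreviation "P \<equiv> op_poly lap"
abbreviation "U \<equiv> cheb (Suc N)"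

lemmas ll = linear_laplacian[of E]

lemma P_comm: "P p (P q g) = P q (P p g)"
  by (metis op_poly_mult[OF ll] mult.commute)

lemma P_off: "(\<And>x. x \<notin> V \<Longrightarrow> g x = 0) \<Longrightarrow> x \<notin> V \<Longrightarrow> P p g x = 0"
  by (induction p) (simp_all add: op_poly_pCons[OF ll] lap_off)

lemma P_2_minus: "P [:a, -1:] g = (\<lambda>x. of_real a * g x - lap g x)"
  by (simp add: op_poly_pCons[OF ll] linear_op_zero[OF ll] linear_op_scale[OF ll, of "-1", simplified])

lemma path_fwd: "m \<in> int_points \<Longrightarrow> 1 \<le> j \<Longrightarrow> j \<le> N \<Longrightarrow>
    P [:2, -1:] g (pt m s j) = g (pt m s (j - 1)) + g (pt m s (Suc j))"
  by (simp add: P_2_minus lap_inner)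

lemma path_bwd:
  assumes "m \<in> int_points" "1 \<le> j" "j \<le> N"
  shows "P [:2, -1:] g (pt m s (Suc N - j)) = g (pt m s (Suc N - (j - 1))) + g (pt m s (Suc N - Suc j))"
proof -
  have "Suc N - (j - 1) = Suc (Suc N - j)" "Suc N - Suc j = (Suc N - j) - 1"
    using assms by auto
  then show ?thesis
    using path_fwd[OF assms(1), of "Suc N - j" g s] assms by (simp add: add.commute)
qed

lemma U_first: "m \<in> int_points \<Longrightarrow> P U g (pt m s 1) = g (m + e s) + P (cheb N) g m"
  using path_recursion(1)[where q = "pt m s" and j = N and N = N and g = g, OF ll path_fwd] by simp

lemma U_last: "m \<in> int_points \<Longrightarrow> P U g (pt m s N) = g m + P (cheb N) g (m + e s)"
  using path_recursion(1)[where q = "\<lambda>j. pt m s (Suc N - j)" and j = N and N = N and g = g, OF ll path_bwd]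
  by simp

lemma U_inner: "m \<in> int_points \<Longrightarrow> j \<le> Suc N \<Longrightarrow>
    P U g (pt m s j) = P (cheb (Suc N - j)) g m + P (cheb j) g (m + e s)"
  using path_recursion(2)[where q = "pt m s" and j = j and N = N and g = g, OF ll path_fwd] by simp

text \<open>Applying 2d - \<Delta> to U(\<Delta>) g at m sums U(\<Delta>) g over the neighbours of
  m; by \<open>U_first\<close> and \<open>U_last\<close> each gives the value of g at the far end of
  its edge plus \<open>P (cheb N) g m\<close>. The second term of the discriminant cancels the
  latter.\<close>

lemma D_int:
  assumes m: "m \<in> int_points" shows "P D g m = shift_op g m"
proof -
  have m': "m - e s \<in> int_points" for s using m by (simp add: int_points_diff)
  have "P ([:2 * real CARD('d), -1:] * U) g m = of_real (2 * real CARD('d)) * P U g m - lap (P U g) m"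
    unfolding op_poly_mult[OF ll] P_2_minus ..
  also have "\<dots> = (\<Sum>s\<in>UNIV. P U g (pt m s 1) + P U g (pt (m - e s) s N))"
    unfolding lap_int[OF m] by (simp add: sum_subtractf sum.distrib)
  also have "\<dots> = (\<Sum>s\<in>UNIV. g (m + e s) + g (m - e s)) + of_real (2 * real CARD('d)) * P (cheb N) g m"
    unfolding U_first[OF m] U_last[OF m'] by (simp add: sum.distrib)
  finally show ?thesis
    by (simp add: D_def discriminant_def op_poly_diff[OF ll] op_poly_smult[OF ll] shift_op_def)
qed

lemma lap_translate:
  assumes n: "n \<in> int_points" shows "lap (\<lambda>x. g (x + n)) v = lap g (v + n)"
proof (cases "v \<in> V")
  case True
  then show ?thesis
  proof (cases rule: vert_cases)
    case 1
    have "pt (v + n - e s) s N = pt (v - e s) s N + n" for s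
      by (simp add: edge_point_def algebra_simps)
    then show ?thesis
      using n by (simp add: lap_int[OF 1] lap_int[OF int_points_add[OF 1 n]] pt_add)
  next
    case (2 m s j)
    then show ?thesis
      using lap_inner[OF int_points_add[OF 2(1) n] 2(2,3), of g s] lap_inner[OF 2(1-3), of "\<lambda>x. g (x + n)" s]
      by (simp add: pt_add)
  qed
qed (simp add: lap_off translate_iff[OF n])

lemma shift_lap: "shift_op (lap g) = lap (shift_op g)"
proof
  fix v
  have "lap (shift_op g) v = (\<Sum>s\<in>UNIV. lap (\<lambda>x. g (x + e s)) v + lap (\<lambda>x. g (x + - e s)) v)"
    using linear_op_sum[OF ll, of "\<lambda>s x. g (x + e s) + g (x + - e s)" UNIV] linear_op_add[OF ll]
    by (simp add: shift_op_def[abs_def])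
  also have "\<dots> = shift_op (lap g) v"
    by (simp only: lap_translate[OF axis_int_points] lap_translate[OF int_points_uminus[OF axis_int_points]])
      (simp add: shift_op_def)
  finally show "shift_op (lap g) v = lap (shift_op g) v" ..
qed

lemma shift_P: "shift_op (P p g) = P p (shift_op g)"
  by (rule op_poly_commute[OF ll linear_shift_op shift_lap])

lemma shift_off: "(\<And>x. x \<notin> V \<Longrightarrow> g x = 0) \<Longrightarrow> x \<notin> V \<Longrightarrow> shift_op g x = 0"
  using translate_iff[of "- e s" x for s] translate_iff[of "e s" x for s]
  by (simp add: shift_op_def int_points_uminus)

text \<open>On the range of \<open>U(\<Delta>)\<close>, which is orthogonal to all flat bands, \<open>D(\<Delta>)\<close> is the adjacency operator
  of the lattice.\<close>
lemma D_U:
  assumes g: "\<And>x. x \<notin> V \<Longrightarrow> g x = 0"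
  shows "P D (P U g) = shift_op (P U g)"
proof
  fix x
  show "P D (P U g) x = shift_op (P U g) x"
  proof (cases "x \<in> V")
    case True
    then show ?thesis
    proof (cases rule: vert_cases)
      case 1
      then show ?thesis by (rule D_int)
    next
      case (2 m s j)
      have m: "m + e s \<in> int_points" using 2 by (simp add: int_points_add)
      have "P D (P U g) x = P U (P D g) (pt m s j)"
        unfolding 2(4) by (subst P_comm) (rule refl)
      \<comment> \<open>At an added vertex U(\<Delta>) is an expression in lattice values, and at
        lattice points D(\<Delta>) is already known to be the adjacency operator; both commute with
        polynomials of \<Delta>.\<close>
      also have "\<dots> = P D (P (cheb (Suc N - j)) g) m + P D (P (cheb j) g) (m + e s)"
        using U_inner[OF 2(1), of j "P D g" s] 2(3) P_comm[of _ D g] by simp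
      also have "\<dots> = P (cheb (Suc N - j)) (shift_op g) m + P (cheb j) (shift_op g) (m + e s)"
        unfolding D_int[OF 2(1)] D_int[OF m] shift_P ..
      also have "\<dots> = P U (shift_op g) (pt m s j)"
        using U_inner[OF 2(1), of j "shift_op g" s] 2(3) by simp
      also have "\<dots> = shift_op (P U g) x"
        unfolding 2(4) shift_P ..
      finally show ?thesis .
    qed
  next
    case False
    then show ?thesis
      using P_off[OF P_off[OF g]] shift_off[OF P_off[OF g]] by simp
  qed
qed

lemma finite_support_lap:
  assumes "finite {x. f x \<noteq> 0}" shows "finite {x. lap f x \<noteq> 0}"
proof (rule finite_subset)
  show "finite ({x. f x \<noteq> 0} \<union> (\<Union>u\<in>{x. f x \<noteq> 0}. {v. {u, v} \<in> E}))"
    using assms nb_bounds(1) by auto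
  show "{x. lap f x \<noteq> 0} \<subseteq> {x. f x \<noteq> 0} \<union> (\<Union>u\<in>{x. f x \<noteq> 0}. {v. {u, v} \<in> E})"
  proof (intro subsetI, rule ccontr)
    fix x assume x: "x \<in> {x. lap f x \<noteq> 0}" "x \<notin> {x. f x \<noteq> 0} \<union> (\<Union>u\<in>{x. f x \<noteq> 0}. {v. {u, v} \<in> E})"
    then have "f x = 0" "\<And>u. {x, u} \<in> E \<Longrightarrow> f u = 0"
      by (auto simp: insert_commute)
    then have "lap f x = 0"
      by (simp add: laplacian_def)
    with x show False by simp
  qed
qed

lemma finite_support_P:
  assumes "finite {x. f x \<noteq> 0}" shows "finite {x. P p f x \<noteq> 0}"
proof (induction p)
  case (pCons a p)
  have "finite {x. of_real a * f x \<noteq> 0}"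
    by (rule finite_subset[OF _ assms]) auto
  with pCons show ?case
    unfolding op_poly_pCons[OF ll] by (intro finite_support_add finite_support_lap)
qed simp

text \<open>For h = U(\<Delta>) f the image under D of the spectral measure M of h has the moments
  of the adjacency operator at h, so it is the absolutely continuous measure found by Fourier
  transform. As D is differentiable, it maps a null set Z to a null set, and M(Z) is at most the
  mass that the image measure gives to D(Z).\<close>

lemma ac_range_U:
  assumes fin: "finite {x. f x \<noteq> 0}" and V: "{x. f x \<noteq> 0} \<subseteq> V"
  shows "P U f \<in> ac_subspace V lap"
proof -
  define h where "h = P U f"
  have off: "f x = 0" if "x \<notin> V" for x using that V by auto
  have fh: "finite {x. h x \<noteq> 0}" "{x. h x \<noteq> 0} \<subseteq> V"
    using finite_support_P[OF fin] P_off[of f, OF off] by (auto simp: h_def)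
  have h: "h \<in> ell2 V" by (rule ell2_finite_support[OF fh])
  obtain M where M: "is_spectral_measure V lap h M"
    using lap.exists_spectral_measure[OF h] by blast
  obtain C where C: "AE x in M. \<bar>x\<bar> \<le> C" and fin: "finite_measure M" and sets: "sets M = sets borel"
    using M by (auto simp: is_spectral_measure_def)
  interpret finite_measure M by fact
  have sp: "space M = UNIV" using sets_eq_imp_space_eq[OF sets] by simp
  let ?\<nu> = "shift_spectral_measure h"
  note \<nu> = shift_spectral_measure[OF fh]
  have cont: "continuous_on X (poly D)" for X
    by (intro continuous_at_imp_continuous_on) auto
  have meas: "poly D \<in> borel_measurable M"
    unfolding measurable_cong_sets[OF sets refl] by (intro borel_measurable_continuous_onI cont)
  have "bounded (poly D ` {-C..C})"
    by (intro compact_imp_bounded compact_continuous_image cont compact_Icc)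
  then obtain B where B: "\<And>x. x \<in> {-C..C} \<Longrightarrow> norm (poly D x) \<le> B"
    unfolding bounded_iff by blast
  have Dn: "P (D ^ n) h = (shift_op ^^ n) h" for n
  proof (induction n)
    case (Suc n)
    have "P (D ^ Suc n) h = P D ((shift_op ^^ n) h)"
      by (simp add: op_poly_mult[OF ll] Suc)
    also have "\<dots> = (shift_op ^^ n) (P D h)"
      by (induction n) (simp_all flip: shift_P)
    also have "P D h = shift_op h"
      unfolding h_def by (rule D_U[OF off])
    finally show ?case
      by (metis funpow_Suc_right o_apply)
  qed (simp add: ll)
  have eq: "distr M borel (poly D) = ?\<nu>"
  proof (rule finite_moments_unique[where C = "max B (2 * real CARD('d))"])
    show "finite_measure (distr M borel (poly D))"
      by (rule finite_measure_distr[OF meas])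
    show "AE x in distr M borel (poly D). \<bar>x\<bar> \<le> max B (2 * real CARD('d))"
    proof (subst AE_distr_iff[OF meas])
      show "AE x in M. \<bar>poly D x\<bar> \<le> max B (2 * real CARD('d))"
      proof (rule eventually_mono[OF C])
        show "\<bar>x\<bar> \<le> C \<Longrightarrow> \<bar>poly D x\<bar> \<le> max B (2 * real CARD('d))" for x
          using B[of x] by (simp add: abs_le_iff) linarith
      qed
    qed auto
    show "AE x in ?\<nu>. \<bar>x\<bar> \<le> max B (2 * real CARD('d))"
      by (rule eventually_mono[OF \<nu>(3)]) auto
    show "finite_measure ?\<nu>" "sets ?\<nu> = sets borel"
      using \<nu>(1) by (auto simp: is_spectral_measure_def)
    fix n
    have "complex_of_real (\<integral>x. poly (D ^ n) x \<partial>M) = ell2_inner V (P (D ^ n) h) h"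
      by (rule lap.spectral_integral[OF h M, symmetric])
    also have "\<dots> = of_real (\<integral>x. x ^ n \<partial>?\<nu>)"
      unfolding Dn using \<nu>(1) by (simp add: is_spectral_measure_def)
    finally have "(\<integral>x. poly (D ^ n) x \<partial>M) = (\<integral>x. x ^ n \<partial>?\<nu>)"
      unfolding of_real_eq_iff .
    then show "(\<integral>x. x ^ n \<partial>distr M borel (poly D)) = (\<integral>x. x ^ n \<partial>?\<nu>)"
      by (subst integral_distr[OF meas]) (auto simp: poly_power[abs_def])
  qed simp
  have "absolutely_continuous lborel M"
    unfolding absolutely_continuous_def
  proof
    fix Z :: "real set" assume Z: "Z \<in> null_sets lborel"
    have "poly D differentiable_on Z"
      by (intro differentiable_at_imp_differentiable_on) (auto simp: real_differentiable_def intro: poly_DERIV)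
    then have "negligible (poly D ` Z)"
      by (rule negligible_differentiable_image_negligible[rotated 2]) (use null_sets_lborel_negligible[OF Z] in auto)
    \<comment> \<open>A Borel null superset is taken, since D(Z) itself is only known to be
      negligible.\<close>
    then obtain W where W: "W \<in> null_sets lborel" "poly D ` Z \<subseteq> W"
      by (auto simp: negligible_iff_null_sets null_sets_completion_iff2)
    have "Z \<subseteq> poly D -` W" using W(2) by auto
    moreover have "poly D -` W \<in> sets M"
      using measurable_sets[OF meas, of W] W(1) by (auto simp: sp)
    ultimately have "emeasure M Z \<le> emeasure M (poly D -` W)"
      by (intro emeasure_mono)
    also have "\<dots> = emeasure (distr M borel (poly D)) W"
      using W(1) by (subst emeasure_distr[OF meas]) (auto simp: sp)
    also have "\<dots> = 0"
      using \<nu>(2) W(1) unfolding eq absolutely_continuous_def by auto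
    finally show "Z \<in> null_sets M"
      using Z sets by (auto simp: null_sets_def)
  qed
  then show ?thesis
    using h M by (auto simp: ac_subspace_def h_def)
qed

text \<open>A non-real eigenvalue is excluded by symmetry. For real x, U(\<Delta>) \<delta> is
  absolutely continuous for the point mass \<delta> at v, hence orthogonal to f; moving U(\<Delta>)
  to f shows that U(x) times the conjugate of f(v) is 0.\<close>

lemma eigenvector_zero:
  assumes f: "f \<in> ell2 V" "lap f = (\<lambda>x. z * f x)" and z: "z \<notin> complex_of_real ` {x. poly U x = 0}"
  shows "f = (\<lambda>x. 0)"
proof (cases "Im z = 0")
  case False
  have "\<bar>Im z\<bar> * ell2_norm V f \<le> 0"
    using lap.nonreal_bounded_below[OF f(1), of z] f(2) by simp
  then have "ell2_norm V f = 0"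
    using False ell2_norm_nonneg[of V f] by (simp add: mult_le_0_iff)
  then show ?thesis by (rule ell2_norm_eq_0[OF f(1)])
next
  case True
  define x where "x = Re z"
  have zx: "z = of_real x" using True by (simp add: x_def complex_eq_iff)
  have Ux: "poly U x \<noteq> 0" using z by (auto simp: zx)
  show ?thesis
  proof
    fix v
    show "f v = 0"
    proof (cases "v \<in> V")
      case vV: True
      define \<delta> where "\<delta> w = (if w = v then 1 else 0 :: complex)" for w
      have \<delta>: "finite {w. \<delta> w \<noteq> 0}" "{w. \<delta> w \<noteq> 0} \<subseteq> V"
        using vV by (auto simp: \<delta>_def)
      have \<delta>2: "\<delta> \<in> ell2 V" by (rule ell2_finite_support[OF \<delta>])
      have "0 = ell2_inner V (P U \<delta>) f"
        using lap.inner_eigenvector_zero[OF ac_range_U[OF \<delta>] f(1), of x] f(2) by (simp add: zx)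
      also have "\<dots> = ell2_inner V \<delta> (P U f)"
        by (rule lap.op_poly_sym[OF \<delta>2 f(1)])
      also have "P U f = (\<lambda>w. of_real (poly U x) * f w)"
        by (rule op_poly_eigenvector[OF ll]) (simp add: f(2) zx)
      also have "ell2_inner V \<delta> \<dots> = (\<Sum>\<^sub>\<infinity>w\<in>{v}. \<delta> w * cnj (of_real (poly U x) * f w))"
        unfolding ell2_inner_def using vV by (intro infsum_cong_neutral) (auto simp: \<delta>_def)
      also have "\<dots> = of_real (poly U x) * cnj (f v)"
        by (simp add: \<delta>_def)
      finally show ?thesis using Ux by simp
    qed (rule ell2D[OF f(1)])
  qed
qed

lemma poly_quotient:
  fixes p :: "real poly"
  obtains R where "p = [:poly p x:] + [:- x, 1:] * R"
proof -
  have "[:- x, 1:] dvd p - [:poly p x:]"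
    by (rule poly_eq_0_iff_dvd[THEN iffD1]) simp
  then obtain R where "p - [:poly p x:] = [:- x, 1:] * R" by (rule dvdE)
  then show ?thesis
    by (intro that[of R]) (metis add.commute diff_eq_eq)
qed

text \<open>U(\<Delta>) - U(x) has \<Delta> - x as a factor. Where U(x) is not 0, lower bounds for
  \<Delta> - x may therefore be proved or refuted on the range of U(\<Delta>).\<close>

lemma U_approx:
  assumes "f \<in> ell2 V"
  obtains C where "C \<ge> 0" "\<And>f. f \<in> ell2 V \<Longrightarrow>
    \<bar>poly U x\<bar> * ell2_norm V f \<le> ell2_norm V (P U f) + C * ell2_norm V (\<lambda>v. lap f v - of_real x * f v)"
proof -
  obtain S where S: "U = [:poly U x:] + [:- x, 1:] * S" by (rule poly_quotient)
  obtain C where C: "C \<ge> 0" "\<And>f. f \<in> ell2 V \<Longrightarrow> ell2_norm V (P S f) \<le> C * ell2_norm V f"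
    using lap.op_poly_bounded[of S] by auto
  show ?thesis
  proof (rule that[OF C(1)])
    fix f :: "real ^ 'd \<Rightarrow> complex" assume f: "f \<in> ell2 V"
    let ?w = "\<lambda>v. lap f v - of_real x * f v"
    have w: "?w \<in> ell2 V" by (rule lap.shift_ell2[OF f])
    have "P U f = (\<lambda>v. of_real (poly U x) * f v + P S ?w v)"
      by (subst S, subst mult.commute)
        (simp add: op_poly_add[OF ll] op_poly_const[OF ll] op_poly_mult[OF ll] op_poly_X_minus[OF ll] del: mult_pCons_left mult_pCons_right)
    then have "(\<lambda>v. of_real (poly U x) * f v) = (\<lambda>v. P U f v - P S ?w v)"
      by (simp add: fun_eq_iff)
    then have "\<bar>poly U x\<bar> * ell2_norm V f = ell2_norm V (\<lambda>v. P U f v - P S ?w v)"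
      using ell2_norm_scale[of V "of_real (poly U x)" f] by simp
    also have "\<dots> \<le> ell2_norm V (P U f) + ell2_norm V (P S ?w)"
      by (intro ell2_norm_diff lap.op_poly_ell2 f w)
    also have "\<dots> \<le> ell2_norm V (P U f) + C * ell2_norm V ?w"
      using C(2)[OF w] by simp
    finally show "\<bar>poly U x\<bar> * ell2_norm V f \<le> ell2_norm V (P U f) + C * ell2_norm V ?w" .
  qed
qed

text \<open>On the range of U(\<Delta>), D(\<Delta>) is the adjacency operator, of norm at most 2d,
  so D(x) - D(\<Delta>) is bounded below there by b = |D(x)| - 2d. It has \<Delta> - x as a factor,
  and \<open>U_approx\<close> transfers the bound to all vectors.\<close>

lemma lap_bounded_below:
  assumes x: "\<bar>poly D x\<bar> > 2 * real CARD('d)" and U: "poly U x \<noteq> 0"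
  shows "\<exists>c>0. \<forall>f\<in>ell2 V. c * ell2_norm V f \<le> ell2_norm V (\<lambda>v. lap f v - of_real x * f v)"
proof -
  obtain R where R: "D = [:poly D x:] + [:- x, 1:] * R" by (rule poly_quotient)
  obtain C1 where C1: "C1 \<ge> 0" "\<And>f. f \<in> ell2 V \<Longrightarrow> ell2_norm V (P (R * U) f) \<le> C1 * ell2_norm V f"
    using lap.op_poly_bounded[of "R * U"] by auto
  obtain C2 where C2: "C2 \<ge> 0" "\<And>f. f \<in> ell2 V \<Longrightarrow>
    \<bar>poly U x\<bar> * ell2_norm V f \<le> ell2_norm V (P U f) + C2 * ell2_norm V (\<lambda>v. lap f v - of_real x * f v)"
    using U_approx[of "\<lambda>x. 0" x] by auto
  define b where "b = \<bar>poly D x\<bar> - 2 * real CARD('d)"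
  have b: "b > 0" using x by (simp add: b_def)
  define K where "K = C1 / b + C2 + 1"
  have K: "K > 0" using C1 C2 b by (auto simp: K_def intro!: add_nonneg_pos add_nonneg_nonneg)
  have "\<bar>poly U x\<bar> / K * ell2_norm V f \<le> ell2_norm V (\<lambda>v. lap f v - of_real x * f v)" if f: "f \<in> ell2 V" for f
  proof -
    let ?w = "\<lambda>v. lap f v - of_real x * f v"
    have w: "?w \<in> ell2 V" by (rule lap.shift_ell2[OF f])
    have u: "P U f \<in> ell2 V" by (rule lap.op_poly_ell2[OF f])
    have "shift_op (P U f) = P ([:poly D x:] + [:- x, 1:] * R) (P U f)"
      using D_U[of f] ell2D[OF f] R by simp
    also have "\<dots> = (\<lambda>v. of_real (poly D x) * P U f v + P ([:- x, 1:] * R) (P U f) v)"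
      unfolding op_poly_add[OF ll] op_poly_const[OF ll] ..
    also have "P ([:- x, 1:] * R) (P U f) = P (R * U) ?w"
      unfolding op_poly_mult[OF ll, symmetric] op_poly_X_minus[OF ll, symmetric] by (simp only: mult_ac)
    finally have "P (R * U) ?w = (\<lambda>v. shift_op (P U f) v - of_real (poly D x) * P U f v)"
      by (simp add: fun_eq_iff)
    then have "C1 * ell2_norm V ?w \<ge> ell2_norm V (\<lambda>v. of_real (poly D x) * P U f v - shift_op (P U f) v)"
      using C1(2)[OF w] ell2_norm_minus[of V "shift_op (P U f)" "\<lambda>v. of_real (poly D x) * P U f v"] by simp
    moreover have "ell2_norm V (\<lambda>v. of_real (poly D x) * P U f v) - ell2_norm V (shift_op (P U f))
      \<le> ell2_norm V (\<lambda>v. of_real (poly D x) * P U f v - shift_op (P U f) v)"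
      by (intro ell2_norm_diff_ge ell2_scale u shift.maps)
    moreover have "ell2_norm V (\<lambda>v. of_real (poly D x) * P U f v) = \<bar>poly D x\<bar> * ell2_norm V (P U f)"
      by (simp add: ell2_norm_scale)
    ultimately have "b * ell2_norm V (P U f) \<le> C1 * ell2_norm V ?w"
      using shift.bounded[OF u] by (simp add: b_def left_diff_distrib)
    then have "ell2_norm V (P U f) \<le> C1 / b * ell2_norm V ?w"
      using b by (simp add: field_simps)
    then have "\<bar>poly U x\<bar> * ell2_norm V f \<le> K * ell2_norm V ?w"
      using C2(2)[OF f] ell2_norm_nonneg[of V ?w] unfolding K_def distrib_right by linarith
    then show ?thesis
      using K by (simp add: field_simps)
  qed
  then show ?thesis
    using U K by (intro exI[of _ "\<bar>poly U x\<bar> / K"]) auto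
qed

end

section \<open>The discriminant\<close>

text \<open>Numbered increasingly, so that the k-th value becomes the upper end of the k-th band;
  the numbering by 2 + 2 cos(pi n / (N + 1)) is the reverse one, n = N + 1 - k.\<close>

definition flat_value :: "nat \<Rightarrow> nat \<Rightarrow> real" where
  "flat_value N k = 2 - 2 * cos (pi * real k / real (Suc N))"

text \<open>The substitution x = 2 - 2 cos \<phi> turns \<open>cheb k\<close> into sin(k \<phi>) /
  sin \<phi>; it is kept multiplied out to avoid the zeros of the sine.\<close>

lemma sin_cheb: "sin \<phi> * poly (cheb k) (2 - 2 * cos \<phi>) = sin (real k * \<phi>)"
proof (induction k rule: induct_nat_012)
  case (ge2 k)
  have "sin (real (Suc (Suc k)) * \<phi>) + sin (real k * \<phi>) = 2 * cos \<phi> * sin (real (Suc k) * \<phi>)"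
    using sin_add[of "real (Suc k) * \<phi>" \<phi>] sin_diff[of "real (Suc k) * \<phi>" \<phi>]
    by (simp add: algebra_simps)
  then show ?case
    using ge2 by (simp add: algebra_simps)
qed simp_all

lemma cheb_at_0: "poly (cheb k) 0 = real k"
  by (induction k rule: induct_nat_012) auto

lemma degree_cheb: "degree (cheb (Suc k)) = k \<and> coeff (cheb (Suc k)) k = (-1) ^ k"
proof (induction k rule: induct_nat_012)
  case 1
  show ?case by (simp add: numeral_poly[symmetric])
next
  case (ge2 k)
  have d: "degree ([:2, -1:] * cheb (Suc (Suc k))) = Suc (Suc k)"
    using ge2 by (subst degree_mult_eq) auto
  have "degree (cheb (Suc (Suc (Suc k)))) = Suc (Suc k)"
    unfolding cheb.simps(3)[of "Suc k"] using d ge2 by (subst diff_conv_add_uminus, subst degree_add_eq_left) auto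
  moreover have "coeff (cheb (Suc (Suc (Suc k)))) (Suc (Suc k)) = (-1) ^ Suc (Suc k)"
    unfolding cheb.simps(3)[of "Suc k"] using ge2 by (simp add: coeff_pCons coeff_eq_0 del: cheb.simps)
  ultimately show ?case by simp
qed auto

lemma poly_eq_prod_roots:
  fixes p :: "'a::field poly"
  assumes S: "finite S" "card S = degree p" and roots: "\<And>x. x \<in> S \<Longrightarrow> poly p x = 0" and p: "p \<noteq> 0"
  shows "p = Polynomial.smult (lead_coeff p) (\<Prod>x\<in>S. [:- x, 1:])"
proof -
  have "(\<Prod>x\<in>S. [:- x, 1:]) dvd p"
    using S(1) roots
  proof (induction S rule: finite_induct)
    case (insert y S)
    then obtain q where q: "p = (\<Prod>x\<in>S. [:- x, 1:]) * q"
      by (auto elim: dvdE)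
    have "poly (\<Prod>x\<in>S. [:- x, 1:]) y \<noteq> 0"
      using insert(1,2) by (auto simp: poly_prod)
    then have "poly q y = 0"
      using insert(4)[of y] by (simp add: q)
    then show ?case
      using insert(1,2) by (simp add: q poly_eq_0_iff_dvd mult_dvd_mono mult.commute del: mult_pCons_left mult_pCons_right)
  qed simp
  then obtain q where q: "p = (\<Prod>x\<in>S. [:- x, 1:]) * q" by (rule dvdE)
  have m1: "lead_coeff (\<Prod>x\<in>S. [:- x, 1:] :: 'a poly) = 1"
    unfolding lead_coeff_prod by simp
  have m2: "degree (\<Prod>x\<in>S. [:- x, 1:] :: 'a poly) = card S"
    by (subst degree_prod_eq_sum_degree) auto
  have "q \<noteq> 0" "(\<Prod>x\<in>S. [:- x, 1:] :: 'a poly) \<noteq> 0"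
    using p q by auto
  then have "degree p = card S + degree q"
    using m2 q by (simp add: degree_mult_eq)
  then have "degree q = 0" using S(2) by simp
  then obtain a where a: "q = [:a:]" by (rule degree_eq_zeroE)
  have lc: "lead_coeff p = a"
    unfolding q lead_coeff_mult m1 by (simp add: a)
  have "p = Polynomial.smult a (\<Prod>x\<in>S. [:- x, 1:])"
    using q a by simp
  then show ?thesis
    unfolding lc .
qed

lemma flat_value_less: "j < k \<Longrightarrow> k \<le> Suc N \<Longrightarrow> flat_value N j < flat_value N k"
  unfolding flat_value_def
  by (simp, rule cos_monotone_0_pi) (auto simp: divide_simps)

lemma flat_value_0 [simp]: "flat_value N 0 = 0"
  by (simp add: flat_value_def)

lemma flat_value_less_4: "k \<le> N \<Longrightarrow> flat_value N k < 4"
  using flat_value_less[of k "Suc N" N] by (simp add: flat_value_def)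

lemma flat_value_nonneg: "0 \<le> flat_value N k"
  by (simp add: flat_value_def)

lemma sin_flat_angle: "1 \<le> k \<Longrightarrow> k \<le> N \<Longrightarrow> sin (pi * real k / real (Suc N)) > 0"
  by (rule sin_gt_zero) (auto simp: divide_simps)

lemma cheb_flat_value:
  assumes "1 \<le> k" "k \<le> N" shows "poly (cheb (Suc N)) (flat_value N k) = 0"
proof -
  have "sin (pi * real k / real (Suc N)) * poly (cheb (Suc N)) (flat_value N k) = sin (real k * pi)"
    using sin_cheb[of "pi * real k / real (Suc N)" "Suc N"] by (simp add: flat_value_def mult.commute del: of_nat_Suc)
  then show ?thesis
    using sin_flat_angle[OF assms] by simp
qed

lemma inj_flat_value: "inj_on (flat_value N) {1..N}"
  by (rule strict_mono_on_imp_inj_on) (auto simp: strict_mono_on_def intro: flat_value_less)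

lemma inj_complex_flat_value: "inj_on (\<lambda>n. complex_of_real (flat_value N n)) {1..N}"
  by (rule inj_onI) (rule inj_onD[OF inj_flat_value], simp_all only: of_real_eq_iff)

lemma cheb_eq_prod: "cheb (Suc N) = Polynomial.smult ((-1) ^ N) (\<Prod>k\<in>{1..N}. [:- flat_value N k, 1:])"
proof -
  have nz: "cheb (Suc N) \<noteq> 0"
    using degree_cheb[of N] by auto
  have "cheb (Suc N) = Polynomial.smult (lead_coeff (cheb (Suc N))) (\<Prod>x\<in>flat_value N ` {1..N}. [:- x, 1:])"
    using cheb_flat_value[of _ N] degree_cheb[of N]
    by (intro poly_eq_prod_roots nz) (auto simp: card_image[OF inj_flat_value] simp del: One_nat_def)
  then show ?thesis
    using degree_cheb[of N] by (simp add: prod.reindex[OF inj_flat_value] del: One_nat_def)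
qed

lemma cheb_root_iff: "poly (cheb (Suc N)) x = 0 \<longleftrightarrow> x \<in> flat_value N ` {1..N}"
  unfolding cheb_eq_prod by (auto simp: poly_prod)

lemma degree_discriminant:
  "degree (discriminant d N) = Suc N" "lead_coeff (discriminant d N) = (-1) ^ Suc N"
proof -
  have d: "degree ([:2 * real d, -1:] * cheb (Suc N)) = Suc N"
    using degree_cheb[of N] by (subst degree_mult_eq) auto
  have "degree (cheb N) < Suc N"
    using degree_cheb[of "N - 1"] by (cases N) auto
  then have d2: "degree (Polynomial.smult (2 * real d) (cheb N)) < Suc N"
    using degree_smult_le[of "2 * real d" "cheb N"] by linarith
  show dd: "degree (discriminant d N) = Suc N"
    unfolding discriminant_def using d d2 by (subst diff_conv_add_uminus, subst degree_add_eq_left) auto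
  have "coeff (discriminant d N) (Suc N) = (-1) ^ Suc N"
    using degree_cheb[of N] coeff_eq_0[OF d2] by (simp add: discriminant_def coeff_pCons coeff_eq_0)
  then show "lead_coeff (discriminant d N) = (-1) ^ Suc N"
    by (simp add: dd)
qed

text \<open>At a root of U the term in sin((N + 1) \<phi>) vanishes, so this form yields the value
  of the discriminant there and, after differentiation, its slope.\<close>

lemma sin_discriminant:
  "sin \<phi> * poly (discriminant d N) (2 - 2 * cos \<phi>)
    = (2 * real d - 2) * (1 - cos \<phi>) * sin (real (Suc N) * \<phi>) + 2 * real d * sin \<phi> * cos (real (Suc N) * \<phi>)"
proof -
  have A: "sin (real N * \<phi>) = sin (real (Suc N) * \<phi>) * cos \<phi> - cos (real (Suc N) * \<phi>) * sin \<phi>"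
    using sin_diff[of "real (Suc N) * \<phi>" \<phi>] by (simp add: algebra_simps)
  have B: "sin \<phi> * poly (discriminant d N) (2 - 2 * cos \<phi>)
    = (2 * real d - (2 - 2 * cos \<phi>)) * (sin \<phi> * poly (cheb (Suc N)) (2 - 2 * cos \<phi>))
      - 2 * real d * (sin \<phi> * poly (cheb N) (2 - 2 * cos \<phi>))"
    by (simp add: discriminant_def algebra_simps)
  show ?thesis
    unfolding B sin_cheb A by (simp add: algebra_simps)
qed

lemma flat_trig: "sin (real (Suc N) * (pi * real k / real (Suc N))) = 0"
  "cos (real (Suc N) * (pi * real k / real (Suc N))) = (-1) ^ k"
proof -
  have eq: "real (Suc N) * (pi * real k / real (Suc N)) = real k * pi"
    by (simp add: mult.commute)
  show "sin (real (Suc N) * (pi * real k / real (Suc N))) = 0"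
    "cos (real (Suc N) * (pi * real k / real (Suc N))) = (-1) ^ k"
    unfolding eq by simp_all
qed

lemma discriminant_flat_value:
  assumes "k \<le> N" shows "poly (discriminant d N) (flat_value N k) = 2 * real d * (-1) ^ k"
proof (cases "k = 0")
  case True
  then show ?thesis
    using cheb_at_0 by (simp add: discriminant_def algebra_simps del: cheb.simps)
next
  case False
  let ?\<phi> = "pi * real k / real (Suc N)"
  have "sin ?\<phi> * poly (discriminant d N) (flat_value N k) = sin ?\<phi> * (2 * real d * (-1) ^ k)"
    using sin_discriminant[of ?\<phi> d N] unfolding flat_trig by (simp add: flat_value_def mult.assoc)
  then show ?thesis
    using sin_flat_angle[of k N] False assms by simp
qed

text \<open>The gap above a flat band: it opens because \<open>d \<ge> 2\<close>.\<close>
lemma discriminant_deriv_flat_value: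
  assumes d: "d \<ge> 2" and k: "1 \<le> k" "k \<le> N"
  shows "(-1) ^ k * poly (pderiv (discriminant d N)) (flat_value N k) > 0"
proof -
  let ?\<phi> = "pi * real k / real (Suc N)" and ?p = "discriminant d N"
  define n where "n = real (Suc N)"
  have n: "n > 0" by (simp add: n_def)
  have "((\<lambda>\<phi>. sin \<phi> * poly ?p (2 - 2 * cos \<phi>)) has_real_derivative
      cos ?\<phi> * poly ?p (2 - 2 * cos ?\<phi>) + sin ?\<phi> * (poly (pderiv ?p) (2 - 2 * cos ?\<phi>) * (2 * sin ?\<phi>))) (at ?\<phi>)"
    by (auto intro!: derivative_eq_intros DERIV_chain2[OF poly_DERIV])
  moreover have "((\<lambda>\<phi>. (2 * real d - 2) * (1 - cos \<phi>) * sin (n * \<phi>) + 2 * real d * sin \<phi> * cos (n * \<phi>)) has_real_derivative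
      (2 * real d - 2) * (1 - cos ?\<phi>) * (n * cos (n * ?\<phi>)) + (2 * real d - 2) * sin ?\<phi> * sin (n * ?\<phi>)
      + 2 * real d * cos ?\<phi> * cos (n * ?\<phi>) - 2 * real d * sin ?\<phi> * (n * sin (n * ?\<phi>))) (at ?\<phi>)"
    by (auto intro!: derivative_eq_intros simp: algebra_simps)
  ultimately have "cos ?\<phi> * poly ?p (2 - 2 * cos ?\<phi>) + sin ?\<phi> * (poly (pderiv ?p) (2 - 2 * cos ?\<phi>) * (2 * sin ?\<phi>))
     = (2 * real d - 2) * (1 - cos ?\<phi>) * (n * cos (n * ?\<phi>)) + (2 * real d - 2) * sin ?\<phi> * sin (n * ?\<phi>)
      + 2 * real d * cos ?\<phi> * cos (n * ?\<phi>) - 2 * real d * sin ?\<phi> * (n * sin (n * ?\<phi>))"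
    unfolding sin_discriminant n_def by (rule DERIV_unique)
  \<comment> \<open>The terms with sin(n \<phi>) are 0, and cos \<phi> times the value of the
    discriminant cancels against 2d cos \<phi> cos(n \<phi>). What is left on the right has the sign
    of (-1)^k because d > 1.\<close>
  then have "sin ?\<phi> * (poly (pderiv ?p) (flat_value N k) * (2 * sin ?\<phi>)) = (2 * real d - 2) * (1 - cos ?\<phi>) * (n * (-1) ^ k)"
    using discriminant_flat_value[OF k(2), of d] unfolding n_def flat_trig by (simp add: flat_value_def)
  then have "(-1) ^ k * (sin ?\<phi> * (poly (pderiv ?p) (flat_value N k) * (2 * sin ?\<phi>)))
      = (-1) ^ k * ((2 * real d - 2) * (1 - cos ?\<phi>) * (n * (-1) ^ k))" by simp
  then have "2 * (sin ?\<phi>)\<^sup>2 * ((-1) ^ k * poly (pderiv ?p) (flat_value N k))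
      = ((-1) ^ k * (-1) ^ k) * ((2 * real d - 2) * (1 - cos ?\<phi>) * n)"
    by (simp only: power2_eq_square mult_ac)
  also have "(-1) ^ k * (-1) ^ k = (1 :: real)"
    by (simp flip: power_mult_distrib)
  also have "1 * ((2 * real d - 2) * (1 - cos ?\<phi>) * n) > 0"
  proof -
    have "flat_value N k > 0"
      using flat_value_less[of 0 k N] k by simp
    then have "1 - cos ?\<phi> > 0" by (simp add: flat_value_def)
    then show ?thesis using d n by (intro mult_pos_pos) auto
  qed
  finally show ?thesis
    by (simp add: zero_less_mult_iff)
qed

text \<open>Windows end at consecutive roots of U; the last one has no root of U above it and is
  closed off at 4d, twice the largest degree, which bounds the norm of the Laplacian.\<close>

definition band_top :: "nat \<Rightarrow> nat \<Rightarrow> nat \<Rightarrow> real" where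
  "band_top d N k = (if k < N then flat_value N (Suc k) else 4 * real d)"

text \<open>Windows in which one root of D = c each will be found. They are half open, so that a
  root of U is counted in the window below it; the lowest one also contains 0.\<close>

definition band_range :: "nat \<Rightarrow> nat \<Rightarrow> nat \<Rightarrow> real set" where
  "band_range d N k = (if k = 0 then {0..band_top d N 0} else {flat_value N k<..band_top d N k})"

text \<open>With the alternating sign removed, the recursion at 4d has the coefficient 4d - 2 \<ge>
  2, under which increments of at least 1 persist. These increments give the sign and size of the
  discriminant at the right end of the last window.\<close>

lemma cheb_alternating:
  assumes "d \<ge> 1"
  defines "a \<equiv> \<lambda>k. (-1) ^ k * poly (cheb (Suc k)) (4 * real d)"
  shows "a (Suc k) \<ge> a k + 1 \<and> a k \<ge> 1"
proof (induction k)
  case 0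
  show ?case using assms(1) by (simp add: a_def)
next
  case (Suc k)
  have "a (Suc (Suc k)) = (4 * real d - 2) * a (Suc k) - a k"
    by (simp add: a_def algebra_simps)
  moreover have "2 * a (Suc k) \<le> (4 * real d - 2) * a (Suc k)"
    using Suc assms(1) by (intro mult_right_mono) auto
  ultimately show ?case using Suc by linarith
qed

lemma discriminant_top:
  assumes d: "d \<ge> 1" and N: "N \<ge> 1"
  shows "(-1) ^ N * poly (discriminant d N) (4 * real d) \<le> - 2 * real d"
proof -
  obtain n where n: "N = Suc n" using N by (cases N) auto
  have "(-1) ^ N * poly (discriminant d N) (4 * real d)
    = - 2 * real d * ((-1) ^ N * poly (cheb (Suc N)) (4 * real d) - (-1) ^ n * poly (cheb (Suc n)) (4 * real d))"
    unfolding discriminant_def n by (simp add: algebra_simps del: cheb.simps)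
  also have "\<dots> \<le> - 2 * real d * 1"
    using cheb_alternating[OF d, of n] unfolding n by (intro mult_left_mono_neg) auto
  finally show ?thesis by simp
qed

definition band_set :: "nat \<Rightarrow> nat \<Rightarrow> real set" where
  "band_set d N = {x. \<bar>poly (discriminant d N) x\<bar> \<le> 2 * real d}"

section \<open>One root of D = c in each window\<close>

locale discriminant_roots =
  fixes d N :: nat
  assumes d: "d \<ge> 2" and N: "N \<ge> 1"
begin

abbreviation "D \<equiv> discriminant d N"
abbreviation "J \<equiv> band_range d N"

lemma flat_less_top: "k \<le> N \<Longrightarrow> flat_value N k < band_top d N k"
  using flat_value_less[of k "Suc k" N] flat_value_less_4[of k N] d by (auto simp: band_top_def)

lemma discriminant_band_top: "k \<le> N \<Longrightarrow> (-1) ^ k * poly D (band_top d N k) \<le> - 2 * real d"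
  using discriminant_top[of d N] d N discriminant_flat_value[of "Suc k" N d]
  by (auto simp: band_top_def simp flip: power_mult_distrib)

text \<open>Up to the sign (-1)^k, D is 2d at the left end of the window and at most -2d at the
  right end. For k \<ge> 1 the left end is excluded, and the positive slope there supplies a point
  inside where the signed value exceeds 2d, so the intermediate value theorem reaches the extreme
  values of c as well.\<close>

lemma root_exists:
  assumes c: "\<bar>c\<bar> \<le> 2 * real d" and k: "k \<le> N"
  shows "\<exists>x\<in>J k. poly D x = c"
proof -
  define F where "F x = (-1) ^ k * poly D x" for x
  have F: "isCont F x" for x unfolding F_def by (intro continuous_intros)
  have sq: "(-1) ^ k * ((-1) ^ k * y) = y" for y :: real
    by (simp add: mult.assoc[symmetric] flip: power_mult_distrib)
  have eq: "poly D x = c" if "F x = (-1) ^ k * c" for x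
    using that sq[of "poly D x"] sq[of c] by (simp add: F_def)
  have ab: "\<bar>(-1) ^ k * c\<bar> \<le> 2 * real d" using c by (simp add: abs_mult)
  have top: "F (band_top d N k) \<le> (-1) ^ k * c"
    using discriminant_band_top[OF k] ab by (simp add: F_def abs_le_iff)
  have bot: "F (flat_value N k) = 2 * real d"
    using sq[of "2 * real d"] by (simp add: F_def discriminant_flat_value[OF k] mult_ac)
  show ?thesis
  proof (cases "k = 0")
    case True
    have "\<exists>x\<ge>flat_value N k. x \<le> band_top d N k \<and> F x = (-1) ^ k * c"
      using top bot ab flat_less_top[OF k] F by (intro IVT2) auto
    then obtain x where x: "flat_value N k \<le> x" "x \<le> band_top d N k" "F x = (-1) ^ k * c" by blast
    then have "x \<in> J k" using True by (simp add: band_range_def)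
    with eq[OF x(3)] show ?thesis by blast
  next
    case False
    have "(F has_real_derivative (-1) ^ k * poly (pderiv D) (flat_value N k)) (at (flat_value N k))"
      unfolding F_def by (auto intro!: derivative_eq_intros poly_DERIV)
    then obtain \<delta> where \<delta>: "\<delta> > 0" "\<And>h. 0 < h \<Longrightarrow> h < \<delta> \<Longrightarrow> F (flat_value N k) < F (flat_value N k + h)"
      using DERIV_pos_inc_right[OF _ discriminant_deriv_flat_value[of d k N]] d k False by force
    define h where "h = min \<delta> (band_top d N k - flat_value N k) / 2"
    have h: "0 < h" "h < \<delta>" "flat_value N k + h < band_top d N k"
      using \<delta>(1) flat_less_top[OF k] by (auto simp: h_def min_def field_simps)
    have "\<exists>x\<ge>flat_value N k + h. x \<le> band_top d N k \<and> F x = (-1) ^ k * c"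
      using top bot ab \<delta>(2)[OF h(1,2)] h F by (intro IVT2) auto
    then obtain x where x: "flat_value N k + h \<le> x" "x \<le> band_top d N k" "F x = (-1) ^ k * c" by blast
    then have "x \<in> J k" using False h(1) by (simp add: band_range_def)
    with eq[OF x(3)] show ?thesis by blast
  qed
qed

definition band_root :: "nat \<Rightarrow> real \<Rightarrow> real" where
  "band_root k c = (SOME x. x \<in> J k \<and> poly D x = c)"

lemma band_root: "\<bar>c\<bar> \<le> 2 * real d \<Longrightarrow> k \<le> N \<Longrightarrow> band_root k c \<in> J k \<and> poly D (band_root k c) = c"
  unfolding band_root_def by (rule someI_ex) (use root_exists[of c k] in blast)

lemma band_range_less:
  assumes "j < k" "k \<le> N" "x \<in> J j" "y \<in> J k" shows "x < y"
proof -
  have "x \<le> flat_value N (Suc j)"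
    using assms by (auto simp: band_range_def band_top_def split: if_splits)
  also have "\<dots> \<le> flat_value N k"
    using flat_value_less[of "Suc j" k N] assms by (cases "Suc j = k") auto
  also have "\<dots> < y" using assms by (auto simp: band_range_def)
  finally show ?thesis .
qed

lemma root_less: "\<bar>c\<bar> \<le> 2 * real d \<Longrightarrow> j < k \<Longrightarrow> k \<le> N \<Longrightarrow> band_root j c < band_root k c"
  using band_range_less[of j k] band_root[of c j] band_root[of c k] by auto

lemma inj_root: "\<bar>c\<bar> \<le> 2 * real d \<Longrightarrow> inj_on (\<lambda>k. band_root k c) {..N}"
  by (rule strict_mono_on_imp_inj_on) (auto simp: strict_mono_on_def intro: root_less)

text \<open>D - c has degree N + 1 and a root in each of N + 1 disjoint windows; these are therefore
  all its roots, and simple.\<close>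

lemma discriminant_minus_eq_prod:
  assumes c: "\<bar>c\<bar> \<le> 2 * real d"
  shows "D - [:c:] = Polynomial.smult ((-1) ^ Suc N) (\<Prod>k\<le>N. [:- band_root k c, 1:])"
proof -
  have deg: "degree (D - [:c:]) = Suc N"
    using degree_discriminant(1)[of d N] by (subst diff_conv_add_uminus, subst degree_add_eq_left) auto
  have lc: "lead_coeff (D - [:c:]) = (-1) ^ Suc N"
    using degree_discriminant[of d N] by (simp add: deg coeff_pCons)
  have "D - [:c:] = Polynomial.smult (lead_coeff (D - [:c:])) (\<Prod>x\<in>(\<lambda>k. band_root k c) ` {..N}. [:- x, 1:])"
  proof (rule poly_eq_prod_roots)
    show "D - [:c:] \<noteq> 0" using deg by auto
  qed (use band_root[OF c] in \<open>auto simp: card_image[OF inj_root[OF c]] deg\<close>)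
  then show ?thesis
    unfolding lc by (simp add: prod.reindex[OF inj_root[OF c]])
qed

lemma root_unique:
  assumes "\<bar>poly D x\<bar> \<le> 2 * real d"
  obtains k where "k \<le> N" "x = band_root k (poly D x)"
proof -
  have "poly (D - [:poly D x:]) x = 0" by simp
  then have "(\<Prod>k\<le>N. x - band_root k (poly D x)) = 0"
    unfolding discriminant_minus_eq_prod[OF assms] by (simp add: poly_prod)
  then show ?thesis using that by auto
qed

lemma root_eqI:
  assumes "\<bar>poly D x\<bar> \<le> 2 * real d" "x \<in> J k" "k \<le> N" shows "x = band_root k (poly D x)"
proof -
  obtain j where j: "j \<le> N" "x = band_root j (poly D x)"
    using root_unique[OF assms(1)] by blast
  then have "x \<in> J j" using band_root[OF assms(1), of j] by simp
  then have "j = k"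
    using band_range_less[of j k x x] band_range_less[of k j x x] assms j by (cases j k rule: linorder_cases) auto
  then show ?thesis using j by simp
qed

lemma band_range_convex: "x \<in> J k \<Longrightarrow> y \<in> J k \<Longrightarrow> x \<le> z \<Longrightarrow> z \<le> y \<Longrightarrow> z \<in> J k"
  by (auto simp: band_range_def split: if_splits)

lemma poly_IVT_between:
  assumes "a \<le> b" "min (poly D a) (poly D b) \<le> c" "c \<le> max (poly D a) (poly D b)"
  shows "\<exists>x. a \<le> x \<and> x \<le> b \<and> poly D x = c"
proof (cases "poly D a \<le> poly D b")
  case True
  then show ?thesis using assms IVT[of "poly D" a c b] by (auto simp: min_def max_def)
next
  case False
  then show ?thesis using assms IVT2[of "poly D" b c a] by (auto simp: min_def max_def)
qed

text \<open>The argument goes through D rather than its inverse branch: D is continuous and takes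
  each value in [-2d, 2d] only once in the window, so between the roots for -2d and 2d it stays
  within these bounds and attains all of them. For k < N the next root of U lies in the window and
  has |D| = 2d, which makes it the upper end.\<close>

lemma band_interval:
  assumes k: "k \<le> N"
  shows "\<exists>a b. a < b \<and> (\<lambda>c. band_root k c) ` {- 2 * real d..2 * real d} = {a..b} \<and> (k < N \<longrightarrow> b = flat_value N (Suc k))"
proof -
  define e where "e = 2 * real d"
  have e: "e > 0" using d by (simp add: e_def)
  define p where "p = band_root k (- e)"
  define q where "q = band_root k e"
  have p: "p \<in> J k" "poly D p = - e" and q: "q \<in> J k" "poly D q = e"
    using band_root[of "- e" k] band_root[of e k] k e by (auto simp: p_def q_def e_def)
  have pq: "p \<noteq> q" using p q e by auto
  define a where "a = min p q"
  define b where "b = max p q"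
  have ab: "a < b" "a \<in> J k" "b \<in> J k" using pq p q by (auto simp: a_def b_def min_def max_def)
  have uniq: "x = y" if "x \<in> J k" "y \<in> J k" "poly D x = poly D y" "\<bar>poly D x\<bar> \<le> e" for x y
    using root_eqI[OF _ that(1) k] root_eqI[OF _ that(2) k] that by (simp add: e_def)
  have Dab: "min (poly D a) (poly D b) = - e" "max (poly D a) (poly D b) = e"
    using p q e by (auto simp: a_def b_def min_def max_def)
  have inside: "\<bar>poly D x\<bar> \<le> e" if x: "a \<le> x" "x \<le> b" for x
  proof (rule ccontr)
    assume "\<not> \<bar>poly D x\<bar> \<le> e"
    then consider "poly D x > e" | "poly D x < - e" by linarith
    then show False
    proof cases
      case 1
      \<comment> \<open>A value above e at x would force the value e again between x and p; by
        uniqueness that point is q, which lies on the other side of x.\<close>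
      have "\<exists>y. min x p \<le> y \<and> y \<le> max x p \<and> poly D y = e"
        using 1 p e by (intro poly_IVT_between) (auto simp: min_def max_def)
      then obtain y where y: "min x p \<le> y" "y \<le> max x p" "poly D y = e" by blast
      then have "y \<in> J k" using band_range_convex[OF ab(2,3), of y] x by (auto simp: a_def b_def)
      then have "y = q" using uniq[of y q] y q e by simp
      then show False using y x 1 q by (auto simp: a_def b_def min_def max_def split: if_splits)
    next
      case 2
      have "\<exists>y. min x q \<le> y \<and> y \<le> max x q \<and> poly D y = - e"
        using 2 q e by (intro poly_IVT_between) (auto simp: min_def max_def)
      then obtain y where y: "min x q \<le> y" "y \<le> max x q" "poly D y = - e" by blast
      then have "y \<in> J k" using band_range_convex[OF ab(2,3), of y] x by (auto simp: a_def b_def)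
      then have "y = p" using uniq[of y p] y p e by simp
      then show False using y x 2 p by (auto simp: a_def b_def min_def max_def split: if_splits)
    qed
  qed
  have im: "(\<lambda>c. band_root k c) ` {- e..e} = {a..b}"
  proof (intro equalityI subsetI)
    fix x assume x: "x \<in> {a..b}"
    then have "x \<in> J k" using band_range_convex[OF ab(2,3), of x] by auto
    then have "x = band_root k (poly D x)" using inside[of x] x k by (intro root_eqI) (auto simp: e_def)
    moreover have "poly D x \<in> {- e..e}" using inside[of x] x by (auto simp: abs_le_iff)
    ultimately show "x \<in> (\<lambda>c. band_root k c) ` {- e..e}" by blast
  next
    fix x assume "x \<in> (\<lambda>c. band_root k c) ` {- e..e}"
    then obtain c where c: "x = band_root k c" "- e \<le> c" "c \<le> e" by auto
    then have x: "x \<in> J k" "poly D x = c" using band_root[of c k] k by (auto simp: e_def)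
    obtain y where y: "a \<le> y" "y \<le> b" "poly D y = c"
      using poly_IVT_between[of a b c] ab Dab c by auto
    then have "y \<in> J k" using band_range_convex[OF ab(2,3), of y] by auto
    then have "x = y" using uniq[of x y] x y c by auto
    then show "x \<in> {a..b}" using y by auto
  qed
  moreover have "b = flat_value N (Suc k)" if "k < N"
  proof -
    let ?f = "flat_value N (Suc k)"
    have f: "?f \<in> J k"
      using that flat_value_less[of k "Suc k" N] flat_value_nonneg[of N "Suc k"] by (auto simp: band_range_def band_top_def)
    have Df: "\<bar>poly D ?f\<bar> \<le> e"
      using discriminant_flat_value[of "Suc k" N d] that by (simp add: e_def abs_mult)
    then have "?f = band_root k (poly D ?f)" using that by (intro root_eqI f) (auto simp: e_def)
    then have "?f \<in> {a..b}" unfolding im[symmetric] using Df by (auto simp: abs_le_iff)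
    moreover have "b \<le> ?f"
      using ab(3) that by (auto simp: band_range_def band_top_def split: if_splits)
    ultimately show ?thesis by simp
  qed
  ultimately show ?thesis
    using ab(1) by (intro exI[of _ a] exI[of _ b]) (auto simp: e_def)
qed

lemma bands_eq: "(\<Union>k\<le>N. (\<lambda>c. band_root k c) ` {- 2 * real d..2 * real d}) = {x. \<bar>poly D x\<bar> \<le> 2 * real d}"
proof (intro equalityI subsetI)
  fix x assume "x \<in> {x. \<bar>poly D x\<bar> \<le> 2 * real d}"
  then have x: "\<bar>poly D x\<bar> \<le> 2 * real d" by simp
  then obtain k where "k \<le> N" "x = band_root k (poly D x)" by (rule root_unique)
  moreover have "poly D x \<in> {- 2 * real d..2 * real d}" using x by (auto simp: abs_le_iff)
  ultimately show "x \<in> (\<Union>k\<le>N. (\<lambda>c. band_root k c) ` {- 2 * real d..2 * real d})" by blast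
qed (use band_root in \<open>auto simp: abs_le_iff\<close>)

end

section \<open>The spectrum\<close>

interpretation fun_module: Modules.module "\<lambda>(c :: complex) (f :: 'a \<Rightarrow> complex) x. c * f x"
  by standard (auto simp: fun_eq_iff algebra_simps)

lemma sum_fun_apply: "(\<Sum>i\<in>I. f i) x = (\<Sum>i\<in>I. f i x)" for f :: "'i \<Rightarrow> 'a \<Rightarrow> complex"
  by (induction I rule: infinite_finite_induct) auto

text \<open>Evaluating a linear relation at \<open>p k\<close> leaves only the coefficient of
  \<open>f k\<close>.\<close>

lemma independent_if_separated:
  fixes f :: "nat \<Rightarrow> 'a \<Rightarrow> complex" and p :: "nat \<Rightarrow> 'a"
  assumes "\<And>j k. f j (p k) = 0 \<longleftrightarrow> j \<noteq> k"
  shows "inj f" and "\<not> module.dependent (\<lambda>c f x. c * f x) (range f)"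
proof -
  show "inj f"
    using assms by (metis injI)
  show "\<not> module.dependent (\<lambda>c f x. c * f x) (range f)"
  proof
    assume "module.dependent (\<lambda>c f x. c * f x) (range f)"
    then obtain t u v where t: "finite t" "t \<subseteq> range f" "(\<Sum>v\<in>t. (\<lambda>x. u v * v x)) = 0" "v \<in> t" "u v \<noteq> 0"
      unfolding fun_module.dependent_explicit by blast
    obtain k where k: "v = f k" using t by auto
    have "0 = (\<Sum>v\<in>t. (\<lambda>x. u v * v x)) (p k)"
      using t(3) by simp
    also have "\<dots> = (\<Sum>w\<in>t. u w * w (p k))"
      by (simp add: sum_fun_apply)
    also have "\<dots> = (\<Sum>w\<in>{v}. u w * w (p k))"
    proof (rule sum.mono_neutral_right[OF t(1)])
      show "\<forall>w\<in>t - {v}. u w * w (p k) = 0"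
      proof
        fix w assume w: "w \<in> t - {v}"
        then obtain j where "w = f j" using t(2) by auto
        moreover have "j \<noteq> k" using w k calculation by auto
        ultimately show "u w * w (p k) = 0" using assms[of j k] by simp
      qed
    qed (use t in auto)
    finally show False
      using t(5) assms[of k k] by (simp add: k)
  qed
qed

locale subdivided_lattice_ge2 = subdivided_lattice_disc N t D
  for N :: nat and t :: "'d::finite \<Rightarrow> nat \<Rightarrow> real" and D +
  assumes card_ge2: "CARD('d) \<ge> 2"
begin

sublocale roots: discriminant_roots "CARD('d)" N
  by unfold_locales (rule card_ge2, rule N)

lemma cheb_rec: "poly (cheb (Suc (Suc k))) x = (2 - x) * poly (cheb (Suc k)) x - poly (cheb k) x"
  by (simp add: algebra_simps)

text \<open>The extension of a function \<open>g\<close> on the lattice that satisfies \<open>\<Delta> f = x f\<close> at all added vertices,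
  multiplied by \<open>U(x)\<close>.\<close>
definition extension :: "real \<Rightarrow> (real ^ 'd \<Rightarrow> complex) \<Rightarrow> real ^ 'd \<Rightarrow> complex" where
  "extension x g v = of_real (poly U x) * g v + (\<Sum>s\<in>UNIV. \<Sum>j\<in>{1..N}.
     of_real (poly (cheb (Suc N - j)) x) * g (v - pt 0 s j) + of_real (poly (cheb j) x) * g (v - pt 0 s j + e s))"

text \<open>Decides which summand of \<open>extension\<close> survives at a given vertex, g being 0
  off the lattice.\<close>

lemma pt_diff_int:
  assumes "m \<in> int_points" "1 \<le> i" "i \<le> N" "j \<le> N"
  shows "pt m s j - pt 0 r i \<in> int_points \<longleftrightarrow> s = r \<and> j = i"
proof
  assume "pt m s j - pt 0 r i \<in> int_points"
  moreover define n where "n = pt m s j - pt 0 r i"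
  ultimately have n: "n \<in> int_points" "pt n r i = pt m s j"
    using pt_add[of 0 n r i] by auto
  then show "s = r \<and> j = i"
    using pt_inj(2,3)[OF n(1) assms(1-3), of j r s] assms(4) by simp
next
  assume "s = r \<and> j = i"
  then show "pt m s j - pt 0 r i \<in> int_points"
    using pt_add[of 0 m s j] assms by simp
qed

lemma extension_pt:
  assumes g': "\<forall>v. v \<notin> int_points \<longrightarrow> g v = 0" and m: "m \<in> int_points" and j: "j \<le> Suc N"
  shows "extension x g (pt m s j) = of_real (poly (cheb (Suc N - j)) x) * g m + of_real (poly (cheb j) x) * g (m + e s)"
proof -
  note g = g'[rule_format]
  have g2: "g (v + e r) = 0" if "v \<notin> int_points" for v r
    using that int_points_diff[of "v + e r" "e r"] by (intro g) auto
  have int: "extension x g n = of_real (poly U x) * g n" if n: "n \<in> int_points" for n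
  proof -
    have "n - pt 0 r i \<notin> int_points" if "1 \<le> i" "i \<le> N" for r i
      using pt_diff_int[OF n that, of 0 r r] that by simp
    then show ?thesis
      unfolding extension_def by (simp add: g g2 del: cheb.simps)
  qed
  consider "j = 0" | "j = Suc N" | "1 \<le> j" "j \<le> N" using j by linarith
  then show ?thesis
  proof cases
    case 1
    then show ?thesis using int[OF m] by (simp del: cheb.simps(2,3))
  next
    case 2
    then show ?thesis using int[OF int_points_add[OF m axis_int_points]] by (simp del: cheb.simps(2,3))
  next
    case 3
    have "extension x g (pt m s j) = (\<Sum>r\<in>UNIV. \<Sum>i\<in>{1..N}.
       of_real (poly (cheb (Suc N - i)) x) * g (pt m s j - pt 0 r i) + of_real (poly (cheb i) x) * g (pt m s j - pt 0 r i + e r))"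
      using g[OF pt_not_int[OF 3 m]] by (simp add: extension_def)
    also have "\<dots> = (\<Sum>r\<in>UNIV. \<Sum>i\<in>{1..N}. if i = j then (if r = s then
       of_real (poly (cheb (Suc N - j)) x) * g m + of_real (poly (cheb j) x) * g (m + e s) else 0) else 0)"
    proof (intro sum.cong refl)
      fix r i assume i: "i \<in> {1..N}"
      show "of_real (poly (cheb (Suc N - i)) x) * g (pt m s j - pt 0 r i) + of_real (poly (cheb i) x) * g (pt m s j - pt 0 r i + e r)
        = (if i = j then (if r = s then of_real (poly (cheb (Suc N - j)) x) * g m + of_real (poly (cheb j) x) * g (m + e s) else 0) else 0)"
      proof (cases "r = s \<and> i = j")
        case True
        then show ?thesis using pt_add[of 0 m s j] by simp
      next
        case False
        then have "pt m s j - pt 0 r i \<notin> int_points"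
          using pt_diff_int[OF m, of i j s r] i 3 by auto
        then show ?thesis using False g g2 by auto
      qed
    qed
    also have "\<dots> = of_real (poly (cheb (Suc N - j)) x) * g m + of_real (poly (cheb j) x) * g (m + e s)"
      using 3 by (simp add: sum.delta)
    finally show ?thesis .
  qed
qed

lemma extension_off: "\<forall>v. v \<notin> int_points \<longrightarrow> g v = 0 \<Longrightarrow> v \<notin> V \<Longrightarrow> extension x g v = 0"
proof -
  assume g': "\<forall>v. v \<notin> int_points \<longrightarrow> g v = 0" and v: "v \<notin> V"
  note g = g'[rule_format]
  have n: "v - pt 0 s j \<notin> int_points" if "j \<in> {1..N}" for s j
  proof
    assume "v - pt 0 s j \<in> int_points"
    then have "pt 0 s j + (v - pt 0 s j) \<in> V"
      using that by (intro translate pt_vert) auto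
    with v show False by simp
  qed
  have "v - pt 0 s j + e s \<notin> int_points" if "j \<in> {1..N}" for s j
    using n[OF that, of s] int_points_diff[of "v - pt 0 s j + e s" "e s"] by auto
  moreover have "v \<notin> int_points" using v int_vert by blast
  ultimately show ?thesis
    using n by (simp add: extension_def g)
qed

text \<open>At added vertices the three-term recursion of \<open>cheb\<close> makes both sides 0; at
  a lattice point the equation leaves the discriminant and the adjacency operator. It serves twice:
  with finitely supported g for test vectors, with plane waves for the Floquet matrix.\<close>

lemma lap_extension:
  assumes g': "\<forall>v. v \<notin> int_points \<longrightarrow> g v = 0"
  shows "lap (extension x g) v - of_real x * extension x g v = of_real (poly D x) * g v - shift_op g v"
proof (cases "v \<in> V")
  case True
  note g = g'[rule_format]
  note ext = extension_pt[OF g']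
  from True show ?thesis
  proof (cases rule: vert_cases)
    case 1
    have m: "v - e s \<in> int_points" for s using 1 by (simp add: int_points_diff)
    have c1: "cheb 1 = 1" by simp
    have "lap (extension x g) v = (\<Sum>s\<in>UNIV. 2 * (of_real (poly U x) * g v)
        - (of_real (poly (cheb N) x) * g v + g (v + e s)) - (g (v - e s) + of_real (poly (cheb N) x) * g v))"
      using ext[OF 1, of 0 x] ext[OF 1, of 1 x] ext[OF m, of N x] N
      unfolding lap_int[OF 1] by (simp del: cheb.simps(3))
    also have "\<dots> = 2 * of_real (real CARD('d)) * (of_real (poly U x) * g v) - 2 * of_real (real CARD('d)) * (of_real (poly (cheb N) x) * g v) - shift_op g v"
      by (simp add: shift_op_def sum.distrib sum_subtractf algebra_simps del: cheb.simps(3))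
    finally show ?thesis
      using ext[OF 1, of 0 x] by (simp add: D_def discriminant_def algebra_simps del: cheb.simps(3))
  next
    case (2 m s j)
    have v: "v \<notin> int_points" using pt_not_int[OF 2(2,3,1)] 2(4) by simp
    then have "v + e r \<notin> int_points" "v - e r \<notin> int_points" for r
      using int_points_diff[of "v + e r" "e r"] int_points_add[of "v - e r" "e r"] by auto
    then have rhs: "of_real (poly D x) * g v - shift_op g v = 0"
      using v by (simp add: g shift_op_def)
    obtain i where i: "j = Suc i" using 2(2) by (cases j) auto
    obtain k where k: "N = i + Suc k" using 2(3) i by (metis add_Suc_shift le_Suc_ex)
    have "lap (extension x g) v - of_real x * extension x g v = (2 - of_real x) * extension x g (pt m s j)
      - extension x g (pt m s (j - 1)) - extension x g (pt m s (Suc j))"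
      unfolding 2(4) lap_inner[OF 2(1-3)] by (simp add: algebra_simps)
    also have "\<dots> = (2 - of_real x) * (of_real (poly (cheb (Suc k)) x) * g m + of_real (poly (cheb (Suc i)) x) * g (m + e s))
      - (of_real (poly (cheb (Suc (Suc k))) x) * g m + of_real (poly (cheb i) x) * g (m + e s))
      - (of_real (poly (cheb k) x) * g m + of_real (poly (cheb (Suc (Suc i))) x) * g (m + e s))"
      using ext[OF 2(1), of j x s] ext[OF 2(1), of "j - 1" x s] ext[OF 2(1), of "Suc j" x s] 2(3) i k
      by (simp del: cheb.simps)
    also have "\<dots> = 0"
      unfolding cheb_rec by (simp add: algebra_simps del: cheb.simps)
    finally show ?thesis unfolding rhs .
  qed
next
  case False
  note g = g'[rule_format]
  have "v \<notin> int_points" using False int_vert by blast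
  then have "g v = 0" "\<And>r. g (v + e r) = 0" "\<And>r. g (v - e r) = 0"
    using int_points_diff[of "v + e r" "e r" for r] int_points_add[of "v - e r" "e r" for r] by (auto intro!: g)
  then show ?thesis
    using False extension_off[OF g', of v x] by (simp add: lap_off shift_op_def)
qed

lemma finite_support_extension:
  assumes "finite {v. g v \<noteq> 0}" shows "finite {v. extension x g v \<noteq> 0}"
proof (rule finite_subset)
  let ?F = "{v. g v \<noteq> 0} \<union> (\<Union>s\<in>UNIV. \<Union>j\<in>{1..N}. {v. g (v - pt 0 s j) \<noteq> 0} \<union> {v. g (v - pt 0 s j + e s) \<noteq> 0})"
  have "finite {v. g (v - a) \<noteq> 0}" "finite {v. g (v - a + b) \<noteq> 0}" for a b
    using finite_support_translate[OF assms, of "- a"] finite_support_translate[OF assms, of "b - a"]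
    by (simp_all add: algebra_simps)
  then show "finite ?F"
    using assms by auto
  show "{v. extension x g v \<noteq> 0} \<subseteq> ?F"
  proof (intro subsetI, rule ccontr)
    fix v assume v: "v \<in> {v. extension x g v \<noteq> 0}" "v \<notin> ?F"
    then have "g v = 0" "\<And>s j. j \<in> {1..N} \<Longrightarrow> g (v - pt 0 s j) = 0" "\<And>s j. j \<in> {1..N} \<Longrightarrow> g (v - pt 0 s j + e s) = 0"
      by auto
    then have "extension x g v = 0"
      by (simp add: extension_def)
    with v show False by simp
  qed
qed

text \<open>If \<open>\<Delta> - x\<close> were bounded below on the absolutely continuous subspace, then \<open>A - D(x)\<close>, for the
  adjacency operator \<open>A\<close> of the lattice, would be bounded below on the vectors \<open>p(A) \<delta>\<^sub>0\<close>; but \<open>D(x)\<close>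
  is in the support of the spectral measure of \<open>\<delta>\<^sub>0\<close>.\<close>
lemma not_bounded_below:
  assumes x: "\<bar>poly D x\<bar> \<le> 2 * real CARD('d)" and U: "poly U x \<noteq> 0"
    and C: "\<And>f. f \<in> ac_subspace V lap \<Longrightarrow> ell2_norm V f \<le> C * ell2_norm V (\<lambda>v. lap f v - of_real x * f v)"
  shows False
proof -
  define C' where "C' = \<bar>C\<bar>"
  have C': "C' \<ge> 0" "\<And>f. f \<in> ac_subspace V lap \<Longrightarrow> ell2_norm V f \<le> C' * ell2_norm V (\<lambda>v. lap f v - of_real x * f v)"
  proof -
    fix f assume "f \<in> ac_subspace V lap"
    then have "ell2_norm V f \<le> C * ell2_norm V (\<lambda>v. lap f v - of_real x * f v)" by (rule C)
    also have "\<dots> \<le> C' * ell2_norm V (\<lambda>v. lap f v - of_real x * f v)"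
      by (intro mult_right_mono) (auto simp: C'_def)
    finally show "ell2_norm V f \<le> C' * ell2_norm V (\<lambda>v. lap f v - of_real x * f v)" .
  qed (simp add: C'_def)
  obtain C1 where C1: "C1 \<ge> 0" "\<And>f. f \<in> ell2 V \<Longrightarrow> ell2_norm V (P U f) \<le> C1 * ell2_norm V f"
    using lap.op_poly_bounded[of U] by auto
  obtain C2 where C2: "C2 \<ge> 0" "\<And>f. f \<in> ell2 V \<Longrightarrow>
    \<bar>poly U x\<bar> * ell2_norm V f \<le> ell2_norm V (P U f) + C2 * ell2_norm V (\<lambda>v. lap f v - of_real x * f v)"
    using U_approx[of "\<lambda>x. 0" x] by auto
  \<comment> \<open>C' and C1 come from testing the assumed bound on U(\<Delta>) f, C2 from passing
    back from U(\<Delta>) f to f; the 1 keeps K positive.\<close>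
  define K where "K = C' * C1 + C2 + 1"
  have K: "K > 0" using C' C1 C2 by (auto simp: K_def intro!: add_nonneg_pos add_nonneg_nonneg)
  \<comment> \<open>One factor |U(x)| comes from \<open>U_approx\<close>, the other from the values
    U(x) g of the extension at lattice points.\<close>
  define c where "c = (poly U x)\<^sup>2 / K"
  have c: "c > 0" using U K by (simp add: c_def)
  have main: "c * ell2_norm V g \<le> ell2_norm V (\<lambda>v. shift_op g v - of_real (poly D x) * g v)"
    if fin: "finite {v. g v \<noteq> 0}" and g: "\<forall>v. v \<notin> int_points \<longrightarrow> g v = 0" for g
  proof -
    define f where "f = extension x g"
    have f: "finite {v. f v \<noteq> 0}" "{v. f v \<noteq> 0} \<subseteq> V"
      using finite_support_extension[OF fin, of x] extension_off[OF g, of _ x] by (auto simp: f_def)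
    have f2: "f \<in> ell2 V" by (rule ell2_finite_support[OF f])
    have g2: "g \<in> ell2 V"
      using fin g int_vert by (intro ell2_finite_support) auto
    let ?w = "\<lambda>v. lap f v - of_real x * f v"
    have w2: "?w \<in> ell2 V" by (rule lap.shift_ell2[OF f2])
    have w: "ell2_norm V ?w = ell2_norm V (\<lambda>v. shift_op g v - of_real (poly D x) * g v)"
      unfolding f_def lap_extension[OF g] by (rule ell2_norm_minus)
    have "(\<lambda>v. lap (P U f) v - of_real x * P U f v) = P U ?w"
      unfolding op_poly_X_minus[OF ll, symmetric] by (rule P_comm)
    then have "ell2_norm V (P U f) \<le> C' * ell2_norm V (P U ?w)"
      using C'(2)[OF ac_range_U[OF f]] by simp
    also have "\<dots> \<le> C' * (C1 * ell2_norm V ?w)"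
      using C1(2)[OF w2] C'(1) by (intro mult_left_mono)
    finally have "\<bar>poly U x\<bar> * ell2_norm V f \<le> C' * (C1 * ell2_norm V ?w) + C2 * ell2_norm V ?w"
      using C2(2)[OF f2] by linarith
    also have "\<dots> \<le> K * ell2_norm V ?w"
      by (simp add: K_def algebra_simps)
    finally have 1: "\<bar>poly U x\<bar> * ell2_norm V f \<le> K * ell2_norm V ?w" .
    have "\<bar>poly U x\<bar> * ell2_norm V g = ell2_norm V (\<lambda>v. of_real (poly U x) * g v)"
      by (simp add: ell2_norm_scale)
    also have "\<dots> \<le> ell2_norm V f"
    proof (intro ell2_norm_mono ell2_scale g2 f2)
      fix v
      show "cmod (of_real (poly U x) * g v) \<le> cmod (f v)"
      proof (cases "v \<in> int_points")
        case True
        then show ?thesis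
          using extension_pt[OF g, of v 0 x] by (simp add: f_def del: cheb.simps(2,3))
      qed (simp add: g)
    qed
    finally have "\<bar>poly U x\<bar> * (\<bar>poly U x\<bar> * ell2_norm V g) \<le> \<bar>poly U x\<bar> * ell2_norm V f"
      by (intro mult_left_mono) auto
    with 1 have "(poly U x)\<^sup>2 * ell2_norm V g \<le> K * ell2_norm V ?w"
      by (simp add: power2_eq_square abs_mult_self_eq mult.assoc[symmetric])
    then show ?thesis
      using K by (simp add: c_def w field_simps)
  qed
  define \<delta> :: "real ^ 'd \<Rightarrow> complex" where "\<delta> v = (if v = 0 then 1 else 0)" for v
  have supp: "{v. \<delta> v \<noteq> 0} = {0}" by (auto simp: \<delta>_def)
  have \<delta>: "finite {v. \<delta> v \<noteq> 0}" "{v. \<delta> v \<noteq> 0} \<subseteq> V"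
    unfolding supp using int_vert[of 0] by auto
  have \<delta>2: "\<delta> \<in> ell2 V" by (rule ell2_finite_support[OF \<delta>])
  note \<nu> = shift_spectral_measure[OF \<delta>]
  have pA: "finite {v. op_poly shift_op p \<delta> v \<noteq> 0} \<and> (\<forall>v. v \<notin> int_points \<longrightarrow> op_poly shift_op p \<delta> v = 0)" for p
  proof (induction p)
    case (pCons a p)
    have "finite {v. of_real a * \<delta> v \<noteq> 0}"
      by (rule finite_subset[OF _ \<delta>(1)]) auto
    moreover have "shift_op (op_poly shift_op p \<delta>) v = 0" if "v \<notin> int_points" for v
    proof -
      have "v + e r \<notin> int_points" "v - e r \<notin> int_points" for r
        using that int_points_diff[of "v + e r" "e r"] int_points_add[of "v - e r" "e r"] by auto
      then show ?thesis
        using pCons by (simp add: shift_op_def[of "op_poly shift_op p \<delta>"])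
    qed
    moreover have "\<delta> v = 0" if "v \<notin> int_points" for v using that by (auto simp: \<delta>_def)
    ultimately show ?case
      unfolding op_poly_pCons[OF linear_shift_op] using pCons finite_support_shift_op[of "op_poly shift_op p \<delta>"]
      by (auto intro!: finite_support_add)
  qed simp
  define r where "r = c / 2"
  have r: "0 < r" "r\<^sup>2 < c\<^sup>2 / 2" using c by (auto simp: r_def power_divide)
  have "AE y in shift_spectral_measure \<delta>. c\<^sup>2 / 2 \<le> poly (dist_poly (of_real (poly D x))) y"
    using \<delta>2 \<nu>(1) c by (rule shift.spectral_measure_away) (use pA in \<open>auto intro!: main\<close>)
  then have "AE y in shift_spectral_measure \<delta>. \<not> \<bar>y - poly D x\<bar> < r"
  proof eventually_elim
    case (elim y)
    have "poly (dist_poly (of_real (poly D x))) y = \<bar>y - poly D x\<bar>\<^sup>2"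
      unfolding poly_dist_poly of_real_diff[symmetric] norm_of_real ..
    then show ?case
      using elim r(2) power_strict_mono[of "\<bar>y - poly D x\<bar>" r 2] by force
  qed
  moreover have "shift_spectral_measure \<delta> = distr (angles :: ('d \<Rightarrow> real) measure) borel symbol"
  proof -
    \<comment> \<open>The point mass has a constant transform, so its spectral measure is the plain
      distribution of the symbol, whose support contains D(x).\<close>
    have "transform \<delta> 0 \<theta> = 1" for \<theta>
      unfolding transform_def supp by (simp add: \<delta>_def int_part_eq_self)
    then show ?thesis
      unfolding shift_spectral_measure_def supp by (simp add: density_1)
  qed
  ultimately have "AE y in distr (angles :: ('d \<Rightarrow> real) measure) borel symbol. \<not> \<bar>y - poly D x\<bar> < r"
    by (simp only:)
  then have "AE \<theta> in (angles :: ('d \<Rightarrow> real) measure). \<not> \<bar>symbol \<theta> - poly D x\<bar> < r"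
  proof (subst (asm) AE_distr_iff)
    show "{y \<in> space borel. \<not> \<bar>y - poly D x\<bar> < r} \<in> sets borel" by measurable
  qed (rule measurable_symbol)
  moreover have "{\<theta> \<in> space angles. \<bar>symbol \<theta> - poly D x\<bar> < r} \<in> sets (angles :: ('d \<Rightarrow> real) measure)"
    by measurable
  ultimately have "emeasure (angles :: ('d \<Rightarrow> real) measure) {\<theta>. \<bar>symbol \<theta> - poly D x\<bar> < r} = 0"
    using AE_iff_measurable[of "{\<theta>. \<bar>symbol \<theta> - poly D x\<bar> < r}" "angles :: ('d \<Rightarrow> real) measure" "\<lambda>\<theta>. \<not> \<bar>symbol \<theta> - poly D x\<bar> < r"]
    by simp
  with symbol_support[OF x r(1)] show False by simp
qed

lemma in_bands: "x \<in> band_set CARD('d) N \<longleftrightarrow> \<bar>poly D x\<bar> \<le> 2 * real CARD('d)"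
  by (simp add: band_set_def D_def)

lemma flat_subset_bands: "flat_value N ` {1..N} \<subseteq> band_set CARD('d) N"
  using discriminant_flat_value[of _ N "CARD('d)"] by (auto simp: band_set_def abs_mult)

text \<open>Bands are nondegenerate intervals and U has finitely many roots, so even a flat value,
  to which \<open>not_bounded_below\<close> does not apply, is a limit of other band points.\<close>

lemma nonflat_near:
  assumes x: "x \<in> band_set CARD('d) N" and \<epsilon>: "\<epsilon> > 0"
  obtains y where "y \<in> band_set CARD('d) N" "\<bar>y - x\<bar> < \<epsilon>" "poly U y \<noteq> 0"
proof -
  obtain k where k: "k \<le> N" "x \<in> (\<lambda>c. roots.band_root k c) ` {- 2 * real CARD('d)..2 * real CARD('d)}"
    using x roots.bands_eq unfolding band_set_def by blast
  obtain a b where ab: "a < b" "(\<lambda>c. roots.band_root k c) ` {- 2 * real CARD('d)..2 * real CARD('d)} = {a..b}"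
    using roots.band_interval[OF k(1)] by blast
  have sub: "{a..b} \<subseteq> band_set CARD('d) N"
    using roots.bands_eq ab(2) k(1) unfolding band_set_def by blast
  define l where "l = max a (x - \<epsilon> / 2)"
  define u where "u = min b (x + \<epsilon> / 2)"
  have lu: "l < u" using k(2) ab \<epsilon> by (auto simp: l_def u_def)
  have "finite {y. poly U y = 0}"
    using degree_cheb[of N] by (intro poly_roots_finite) auto
  then have "infinite ({l<..<u} - {y. poly U y = 0})"
    using lu by (intro Diff_infinite_finite) auto
  then obtain y where y: "y \<in> {l<..<u}" "poly U y \<noteq> 0"
    using infinite_imp_nonempty by blast
  then have "y \<in> {a..b}" "\<bar>y - x\<bar> < \<epsilon>"
    using \<epsilon> by (auto simp: l_def u_def)
  then show ?thesis using that[of y] y(2) sub by blast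
qed

text \<open>A lower bound at x would persist, with twice the constant, at all points closer than
  1/(2K), among them a band point that is not a root of U. The set S covers both spectra at once,
  since the contradiction arises on absolutely continuous vectors.\<close>

lemma bands_subset_spectrum:
  assumes x: "x \<in> band_set CARD('d) N" and S: "ac_subspace V lap \<subseteq> S" "S \<subseteq> ell2 V"
  shows "of_real x \<in> spectrum_on V S lap"
proof (rule ccontr)
  assume "of_real x \<notin> spectrum_on V S lap"
  then obtain C where C: "\<And>f. f \<in> S \<Longrightarrow> ell2_norm V f \<le> C * ell2_norm V (\<lambda>v. lap f v - of_real x * f v)"
    by (auto simp: spectrum_on_def)
  define K where "K = \<bar>C\<bar> + 1"
  have K: "K > 0" by (simp add: K_def)
  obtain y where y: "y \<in> band_set CARD('d) N" "\<bar>y - x\<bar> < 1 / (2 * K)" "poly U y \<noteq> 0"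
    using nonflat_near[OF x, of "1 / (2 * K)"] K by auto
  have "ell2_norm V f \<le> (2 * K) * ell2_norm V (\<lambda>v. lap f v - of_real y * f v)" if f: "f \<in> ac_subspace V lap" for f
  proof -
    have f2: "f \<in> ell2 V" using f by (auto simp: ac_subspace_def)
    let ?n = "\<lambda>x. ell2_norm V (\<lambda>v. lap f v - of_real x * f v)"
    have eq: "(\<lambda>v. lap f v - of_real x * f v) = (\<lambda>v. (lap f v - of_real y * f v) + of_real (y - x) * f v)"
      by (simp add: fun_eq_iff algebra_simps)
    have "?n x \<le> ?n y + \<bar>y - x\<bar> * ell2_norm V f"
      unfolding eq using ell2_norm_add[OF lap.shift_ell2[OF f2, of "of_real y"] ell2_scale[OF f2, of "of_real (y - x)"]]
      by (simp add: ell2_norm_scale del: of_real_diff)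
    also have "\<dots> \<le> ?n y + 1 / (2 * K) * ell2_norm V f"
      using y(2) by (intro add_mono mult_right_mono) auto
    finally have "?n x \<le> ?n y + 1 / (2 * K) * ell2_norm V f" .
    moreover have "ell2_norm V f \<le> K * ?n x"
    proof -
      have "ell2_norm V f \<le> C * ?n x" using C f S(1) by blast
      also have "\<dots> \<le> K * ?n x" by (intro mult_right_mono) (auto simp: K_def)
      finally show ?thesis .
    qed
    ultimately have "ell2_norm V f \<le> K * (?n y + 1 / (2 * K) * ell2_norm V f)"
      using K by (meson less_imp_le mult_left_mono order_trans)
    then show ?thesis
      using K by (simp add: field_simps)
  qed
  with not_bounded_below[OF _ y(3)] y(1) show False unfolding in_bands by blast
qed

lemma not_bands_resolvent:
  assumes "z \<notin> of_real ` (band_set CARD('d) N)"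
  shows "z \<notin> op_spectrum V lap" "z \<notin> ac_spectrum V lap"
proof -
  have "\<exists>c>0. \<forall>f\<in>ell2 V. c * ell2_norm V f \<le> ell2_norm V (\<lambda>v. lap f v - z * f v)"
  proof (cases "Im z = 0")
    case False
    then show ?thesis
      using lap.nonreal_bounded_below by (intro exI[of _ "\<bar>Im z\<bar>"]) auto
  next
    case True
    then have z: "z = of_real (Re z)" by (simp add: complex_eq_iff)
    with assms have "Re z \<notin> band_set CARD('d) N" by (metis image_eqI)
    moreover have "poly U (Re z) \<noteq> 0"
      using calculation flat_subset_bands unfolding cheb_root_iff by blast
    ultimately show ?thesis
      using lap_bounded_below[of "Re z"] z by (simp add: in_bands)
  qed
  then show "z \<notin> op_spectrum V lap" "z \<notin> ac_spectrum V lap"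
    using lap.resolvent_set[of _ z] by blast+
qed

theorem op_spectrum_eq: "op_spectrum V lap = of_real ` (band_set CARD('d) N)"
  using not_bands_resolvent(1) bands_subset_spectrum[of _ "ell2 V"]
  by (auto simp: op_spectrum_def ac_subspace_def)

theorem ac_spectrum_eq: "ac_spectrum V lap = of_real ` (band_set CARD('d) N)"
  using not_bands_resolvent(2) bands_subset_spectrum[of _ "ac_subspace V lap"]
  by (auto simp: ac_spectrum_def ac_subspace_def)

end

section \<open>Flat bands\<close>

context subdivided_lattice_ge2
begin

section \<open>Compactly supported eigenfunctions for a root of U\<close>

context
  fixes n :: nat
  assumes n: "1 \<le> n" "n \<le> N"
begin

text \<open>Dirichlet eigenfunction of a subdivided edge for the n-th root of U: it vanishes at both
  ends j = 0 and j = N + 1.\<close>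

definition mode :: "nat \<Rightarrow> complex" where
  "mode j = of_real (sin (real j * (pi * real n / real (Suc N))))"

lemma mode_0 [simp]: "mode 0 = 0"
  by (simp add: mode_def)

lemma mode_rec: "mode (Suc (Suc j)) = (2 - of_real (flat_value N n)) * mode (Suc j) - mode j"
proof -
  define \<phi> where "\<phi> = pi * real n / real (Suc N)"
  have "sin (real (Suc (Suc j)) * \<phi>) + sin (real j * \<phi>) = 2 * cos \<phi> * sin (real (Suc j) * \<phi>)"
    using sin_add[of "real (Suc j) * \<phi>" \<phi>] sin_diff[of "real (Suc j) * \<phi>" \<phi>]
    by (simp add: algebra_simps)
  then have "sin (real (Suc (Suc j)) * \<phi>) = (2 - flat_value N n) * sin (real (Suc j) * \<phi>) - sin (real j * \<phi>)"
    by (simp add: flat_value_def \<phi>_def del: of_nat_Suc)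
  then have "complex_of_real (sin (real (Suc (Suc j)) * \<phi>))
      = of_real ((2 - flat_value N n) * sin (real (Suc j) * \<phi>) - sin (real j * \<phi>))"
    by (simp only:)
  then show ?thesis
    unfolding mode_def \<phi>_def[symmetric] by (simp del: of_nat_Suc)
qed

lemma mode_last [simp]: "mode (Suc N) = 0"
  using flat_trig(1)[of N n] by (simp add: mode_def del: of_nat_Suc)

text \<open>Under reflection of the edge the mode is symmetric or antisymmetric according to the
  parity of n. This sign dictates the coefficients of \<open>square_mode\<close>.\<close>

lemma mode_N: "mode N = - ((-1) ^ n) * mode (Suc 0)"
proof -
  define \<phi> where "\<phi> = pi * real n / real (Suc N)"
  have "real N * \<phi> = real (Suc N) * \<phi> - \<phi>" by (simp add: algebra_simps)
  then have "sin (real N * \<phi>) = - ((-1) ^ n) * sin \<phi>"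
    using flat_trig[of N n] unfolding \<phi>_def[symmetric] by (simp add: sin_diff del: of_nat_Suc)
  then show ?thesis
    by (simp add: mode_def \<phi>_def)
qed

lemma mode_1: "mode (Suc 0) \<noteq> 0"
  using sin_flat_angle[OF n] by (simp add: mode_def)

definition edge_mode :: "'d \<Rightarrow> real ^ 'd \<Rightarrow> complex" where
  "edge_mode s v = (\<Sum>j\<in>{1..N}. if v = pt 0 s j then mode j else 0)"

lemma edge_mode_pt:
  assumes "m \<in> int_points" "j \<le> Suc N"
  shows "edge_mode s (pt m r j) = (if m = 0 \<and> r = s then mode j else 0)"
proof (cases "1 \<le> j \<and> j \<le> N")
  case True
  have "pt m r j = pt 0 s i \<longleftrightarrow> m = 0 \<and> r = s \<and> i = j" if "i \<in> {1..N}" for i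
    using pt_inj[OF assms(1) int_points_0, of j i r s] True that by auto
  then have "edge_mode s (pt m r j) = (\<Sum>i\<in>{1..N}. if i = j then (if m = 0 \<and> r = s then mode j else 0) else 0)"
    unfolding edge_mode_def by (intro sum.cong) auto
  then show ?thesis using True by simp
next
  case False
  then have j: "j = 0 \<or> j = Suc N" using assms by linarith
  then have "pt m r j \<in> int_points" using assms by (auto simp: int_points_add)
  then have "pt m r j \<noteq> pt 0 s i" if "i \<in> {1..N}" for i
    using pt_not_int[of i 0 s] that by auto
  then have "edge_mode s (pt m r j) = 0" by (simp add: edge_mode_def)
  then show ?thesis using j by auto
qed

lemma edge_mode_off: "v \<notin> V \<Longrightarrow> edge_mode s v = 0"
  using pt_vert[of 0 _ s] unfolding edge_mode_def by (intro sum.neutral) auto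

lemma edge_mode_int: "m \<in> int_points \<Longrightarrow> edge_mode s m = 0"
  using edge_mode_pt[of m 0 s s] by simp

abbreviation "delta w v \<equiv> (if v = w then 1 else 0 :: complex)"

text \<open>A single edge mode solves the equation except at the two ends of its edge, where the
  value of the mode next to the end is left over; these defects have to cancel around a closed
  path.\<close>

lemma lap_edge_mode:
  "lap (edge_mode s) v = of_real (flat_value N n) * edge_mode s v - mode (Suc 0) * (delta 0 v - (-1) ^ n * delta (e s) v)"
proof (cases "v \<in> V")
  case True
  then show ?thesis
  proof (cases rule: vert_cases)
    case 1
    have m: "v - e r \<in> int_points" for r using 1 by (simp add: int_points_diff)
    have "lap (edge_mode s) v = (\<Sum>r\<in>UNIV. - (if v = 0 \<and> r = s then mode (Suc 0) else 0) - (if v - e r = 0 \<and> r = s then mode N else 0))"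
      unfolding lap_int[OF 1] using edge_mode_pt[OF 1, of "Suc 0"] edge_mode_pt[OF m, of N] edge_mode_int[OF 1] N by simp
    also have "\<dots> = (\<Sum>r\<in>UNIV. if r = s then - (mode (Suc 0) * delta 0 v) - mode N * delta (e s) v else 0)"
      by (intro sum.cong) auto
    also have "\<dots> = - (mode (Suc 0) * delta 0 v) - mode N * delta (e s) v"
      by simp
    finally show ?thesis
      unfolding mode_N edge_mode_int[OF 1] by (simp add: algebra_simps)
  next
    case (2 m r j)
    have "v \<notin> int_points" using pt_not_int[OF 2(2,3,1)] unfolding 2(4) .
    then have v: "v \<noteq> 0" "v \<noteq> e s" by auto
    obtain i where i: "j = Suc i" using 2(2) by (cases j) auto
    show ?thesis
      using v edge_mode_pt[OF 2(1), of j s r] edge_mode_pt[OF 2(1), of i s r] edge_mode_pt[OF 2(1), of "Suc j" s r] 2(3) mode_rec[of i]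
      unfolding 2(4) lap_inner[OF 2(1-3)] by (auto simp: i algebra_simps)
  qed
next
  case False
  then have "v \<noteq> 0" "v \<noteq> e s" using int_vert axis_int_points by auto
  then show ?thesis using False by (simp add: lap_off edge_mode_off)
qed

text \<open>An eigenfunction on the boundary of a unit square, vanishing at the corners.\<close>
definition square_mode :: "'d \<Rightarrow> 'd \<Rightarrow> real ^ 'd \<Rightarrow> complex" where
  "square_mode s r v = (edge_mode s v - (-1) ^ n * edge_mode s (v + - e r)) - (edge_mode r v - (-1) ^ n * edge_mode r (v + - e s))"

text \<open>Each corner of the square is an end of two of its edges, and with the chosen signs the
  two defects at every corner are opposite.\<close>

lemma lap_square_mode: "lap (square_mode s r) v = of_real (flat_value N n) * square_mode s r v"
proof -
  have ne: "- e i \<in> int_points" for i by (simp add: int_points_uminus)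
  have "lap (square_mode s r) v = (lap (edge_mode s) v - (-1) ^ n * lap (edge_mode s) (v + - e r)) - (lap (edge_mode r) v - (-1) ^ n * lap (edge_mode r) (v + - e s))"
    unfolding square_mode_def[abs_def] linear_op_diff[OF ll] linear_op_scale[OF ll] lap_translate[OF ne] ..
  moreover have "(v + - e r = 0) = (v = e r)" "(v + - e s = 0) = (v = e s)"
    "(v + - e r = e s) = (v = e s + e r)" "(v + - e s = e r) = (v = e s + e r)"
    by (auto simp: algebra_simps)
  moreover have "(-1) ^ n * ((-1) ^ n * c) = c" for c :: complex
    by (simp add: mult.assoc[symmetric] flip: power_mult_distrib)
  ultimately show ?thesis
    unfolding lap_edge_mode by (simp add: square_mode_def algebra_simps)
qed

lemma finite_support_edge_mode: "finite {v. edge_mode s v \<noteq> 0}"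
proof (rule finite_subset)
  show "{v. edge_mode s v \<noteq> 0} \<subseteq> pt 0 s ` {1..N}"
  proof
    fix v assume "v \<in> {v. edge_mode s v \<noteq> 0}"
    then have "(\<Sum>j\<in>{1..N}. if v = pt 0 s j then mode j else 0) \<noteq> 0"
      by (simp add: edge_mode_def)
    then obtain j where "j \<in> {1..N}" "v = pt 0 s j"
      by (rule sum.not_neutral_contains_not_neutral) (metis (full_types))
    then show "v \<in> pt 0 s ` {1..N}" by blast
  qed
qed simp

lemma square_mode_ell2: "square_mode s r \<in> ell2 V"
proof -
  have a: "edge_mode s \<in> ell2 V" for s
    using finite_support_edge_mode edge_mode_off by (intro ell2_finite_support) auto
  then show ?thesis
    unfolding square_mode_def[abs_def] by (intro ell2_diff ell2_scale translate_ell2 int_points_uminus axis_int_points)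
qed

lemma flat_value_flat_band: "of_real (flat_value N n) \<in> flat_bands V lap"
proof -
  obtain s r :: 'd where sr: "s \<noteq> r"
  proof (rule ccontr)
    assume "\<not> thesis"
    then have "(UNIV :: 'd set) = {undefined}" using that by blast
    then have "CARD('d) = card {undefined :: 'd}" by (rule arg_cong)
    with card_ge2 show False by simp
  qed
  define f where "f k v = square_mode s r (v + - (real k *\<^sub>R e s))" for k :: nat and v
  have k: "real k *\<^sub>R e s \<in> int_points" for k
    by (simp add: int_points_def axis_def)
  have k': "- (real k *\<^sub>R e s) \<in> int_points" for k
    by (rule int_points_uminus[OF k])
  \<comment> \<open>Neighbouring translates along s share an edge in direction r, but their edges in
    direction s all differ; the test point is the first added vertex on such an edge.\<close>
  define p where "p k = pt (real k *\<^sub>R e s) s (Suc 0)" for k :: nat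
  have fp: "f j (p i) = (if i = j then mode (Suc 0) else 0)" for i j
  proof -
    have d: "real i *\<^sub>R e s + - (real j *\<^sub>R e s) \<in> int_points"
      by (intro int_points_add k k')
    have d2: "real i *\<^sub>R e s + - (real j *\<^sub>R e s) + - e q \<in> int_points" for q
      by (intro int_points_add d int_points_uminus axis_int_points)
    have eq: "real i *\<^sub>R e s + - (real j *\<^sub>R e s) = 0 \<longleftrightarrow> i = j"
      by (auto simp: vec_eq_iff axis_def)
    have neq: "real i *\<^sub>R e s + - (real j *\<^sub>R e s) + - e r \<noteq> 0"
    proof
      assume "real i *\<^sub>R e s + - (real j *\<^sub>R e s) + - e r = 0"
      then have "(real i *\<^sub>R e s + - (real j *\<^sub>R e s) + - e r) $ r = (0 :: real ^ 'd) $ r" by simp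
      then show False using sr by (simp add: axis_def)
    qed
    show ?thesis
      unfolding f_def p_def square_mode_def pt_add[symmetric]
      using edge_mode_pt[OF d, of "Suc 0"] edge_mode_pt[OF d2, of "Suc 0"] N sr eq neq by simp
  qed
  have f0: "f j (p i) = 0 \<longleftrightarrow> j \<noteq> i" for i j
    using fp mode_1 by auto
  have "range f \<subseteq> eigenspace V lap (of_real (flat_value N n))"
  proof clarify
    fix k
    have "f k \<in> ell2 V"
      unfolding f_def[abs_def] by (intro translate_ell2 square_mode_ell2 k')
    moreover have "lap (f k) = (\<lambda>v. of_real (flat_value N n) * f k v)"
      unfolding f_def[abs_def] by (rule ext) (simp only: lap_translate[OF k'] lap_square_mode)
    ultimately show "f k \<in> eigenspace V lap (of_real (flat_value N n))"
      by (simp add: eigenspace_def)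
  qed
  moreover have "infinite (range f)"
    using independent_if_separated(1)[of f p, OF f0] by (simp add: finite_image_iff)
  ultimately show ?thesis
    unfolding flat_bands_def using independent_if_separated(2)[of f p, OF f0] by blast
qed

end

theorem flat_bands_eq: "flat_bands V lap = complex_of_real ` flat_value N ` {1..N}"
proof (intro equalityI subsetI)
  fix z assume "z \<in> flat_bands V lap"
  then obtain B where B: "B \<subseteq> eigenspace V lap z" "infinite B"
    by (auto simp: flat_bands_def)
  have "\<not> B \<subseteq> {\<lambda>x. 0}"
    using B(2) finite_subset by auto
  then obtain f where f: "f \<in> B" "f \<noteq> (\<lambda>x. 0)" by blast
  then have "f \<in> ell2 V" "lap f = (\<lambda>x. z * f x)"
    using B(1) by (auto simp: eigenspace_def)
  then have "z \<in> complex_of_real ` {x. poly U x = 0}"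
    using eigenvector_zero[of f z] f(2) by blast
  then show "z \<in> complex_of_real ` flat_value N ` {1..N}"
    unfolding cheb_root_iff by auto
next
  fix z assume "z \<in> complex_of_real ` flat_value N ` {1..N}"
  then show "z \<in> flat_bands V lap"
    using flat_value_flat_band by auto
qed

end

section \<open>Matrices indexed by lists\<close>

text \<open>Entries are indexed by list elements rather than positions, so that an enumeration can
  be changed freely and blocks correspond to concatenated lists.\<close>

definition list_mat :: "'b list \<Rightarrow> ('b \<Rightarrow> 'b \<Rightarrow> 'a) \<Rightarrow> 'a mat" where
  "list_mat xs g = Matrix.mat (length xs) (length xs) (\<lambda>(i, j). g (xs ! i) (xs ! j))"

lemma list_mat_carrier [simp]: "list_mat xs g \<in> carrier_mat (length xs) (length xs)"
  by (simp add: list_mat_def)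

lemma list_mat_cong:
  "(\<And>a b. a \<in> set xs \<Longrightarrow> b \<in> set xs \<Longrightarrow> g a b = h a b) \<Longrightarrow> list_mat xs g = list_mat xs h"
  unfolding list_mat_def by (rule eq_matI) auto

text \<open>Rows and columns undergo the same permutation, so the two signs cancel.\<close>

lemma det_list_mat_permute:
  fixes g :: "'b \<Rightarrow> 'b \<Rightarrow> 'a::comm_ring_1"
  assumes "distinct xs" "distinct ys" "set xs = set ys"
  shows "Determinant.det (list_mat xs g) = Determinant.det (list_mat ys g)"
proof -
  have "mset xs = mset ys"
    using assms by (simp add: set_eq_iff_mset_eq_distinct)
  then obtain p where p: "p permutes {..<length ys}" "permute_list p ys = xs"
    by (rule mset_eq_permutation)
  define n where "n = length ys"
  have p': "p permutes {0..<n}" using p(1) by (simp add: n_def atLeast0LessThan)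
  have len: "length xs = n" using p(2) by (auto simp: n_def)
  have pn: "p i < n" if "i < n" for i using permutes_in_image[OF p', of i] that by simp
  have xs: "xs ! i = ys ! p i" if "i < n" for i
    using p that by (auto simp: permute_list_nth n_def)
  let ?A = "list_mat ys g"
  let ?B = "Matrix.mat n n (\<lambda>(i, j). ?A $$ (p i, j))"
  have A: "?A \<in> carrier_mat n n" by (simp add: n_def)
  have dB: "Determinant.det ?B = signof p * Determinant.det ?A" by (rule Determinant.det_permute_rows[OF A p'])
  have BT: "transpose_mat ?B \<in> carrier_mat n n" by simp
  have "list_mat xs g = transpose_mat (Matrix.mat n n (\<lambda>(i, j). transpose_mat ?B $$ (p i, j)))"
    by (rule eq_matI) (auto simp: list_mat_def len xs pn n_def[symmetric])
  then have "Determinant.det (list_mat xs g) = Determinant.det (Matrix.mat n n (\<lambda>(i, j). transpose_mat ?B $$ (p i, j)))"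
    by (simp add: Determinant.det_transpose[of _ n])
  also have "\<dots> = signof p * Determinant.det (transpose_mat ?B)" by (rule Determinant.det_permute_rows[OF BT p'])
  also have "\<dots> = (signof p * signof p) * Determinant.det ?A"
    by (simp add: Determinant.det_transpose[of _ n] dB mult.assoc)
  also have "signof p * signof p = (1 :: 'a)"
    by (simp add: sign_def)
  finally show ?thesis by simp
qed

lemma list_mat_append:
  "list_mat (xs @ ys) g = four_block_mat (list_mat xs g)
     (Matrix.mat (length xs) (length ys) (\<lambda>(i, j). g (xs ! i) (ys ! j)))
     (Matrix.mat (length ys) (length xs) (\<lambda>(i, j). g (ys ! i) (xs ! j))) (list_mat ys g)"
  by (rule eq_matI) (auto simp: list_mat_def nth_append)

lemma
  fixes g :: "'b \<Rightarrow> 'b \<Rightarrow> 'a::idom"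
  shows det_list_mat_append_lower_zero: "(\<And>x y. x \<in> set xs \<Longrightarrow> y \<in> set ys \<Longrightarrow> g y x = 0) \<Longrightarrow>
      Determinant.det (list_mat (xs @ ys) g) = Determinant.det (list_mat xs g) * Determinant.det (list_mat ys g)"
    and det_list_mat_append_upper_zero: "(\<And>x y. x \<in> set xs \<Longrightarrow> y \<in> set ys \<Longrightarrow> g x y = 0) \<Longrightarrow>
      Determinant.det (list_mat (xs @ ys) g) = Determinant.det (list_mat xs g) * Determinant.det (list_mat ys g)"
proof -
  assume "\<And>x y. x \<in> set xs \<Longrightarrow> y \<in> set ys \<Longrightarrow> g y x = 0"
  then have "Matrix.mat (length ys) (length xs) (\<lambda>(i, j). g (ys ! i) (xs ! j)) = 0\<^sub>m (length ys) (length xs)"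
    by (intro eq_matI) auto
  then show "Determinant.det (list_mat (xs @ ys) g) = Determinant.det (list_mat xs g) * Determinant.det (list_mat ys g)"
    unfolding list_mat_append by (intro det_four_block_mat_lower_left_zero) auto
next
  assume "\<And>x y. x \<in> set xs \<Longrightarrow> y \<in> set ys \<Longrightarrow> g x y = 0"
  then have "Matrix.mat (length xs) (length ys) (\<lambda>(i, j). g (xs ! i) (ys ! j)) = 0\<^sub>m (length xs) (length ys)"
    by (intro eq_matI) auto
  then show "Determinant.det (list_mat (xs @ ys) g) = Determinant.det (list_mat xs g) * Determinant.det (list_mat ys g)"
    unfolding list_mat_append by (intro det_four_block_mat_upper_right_zero) auto
qed

lemma det_list_mat_concat:
  fixes g :: "'b \<Rightarrow> 'b \<Rightarrow> 'a::idom"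
  assumes "distinct ss" "\<And>s r x y. s \<noteq> r \<Longrightarrow> x \<in> set (f s) \<Longrightarrow> y \<in> set (f r) \<Longrightarrow> g x y = 0"
  shows "Determinant.det (list_mat (concat (map f ss)) g) = (\<Prod>s\<leftarrow>ss. Determinant.det (list_mat (f s) g))"
  using assms(1)
proof (induction ss)
  case Nil
  then show ?case by (simp add: list_mat_def det_dim_zero)
next
  case (Cons s ss)
  have "Determinant.det (list_mat (f s @ concat (map f ss)) g) = Determinant.det (list_mat (f s) g) * Determinant.det (list_mat (concat (map f ss)) g)"
  proof (rule det_list_mat_append_lower_zero)
    fix x y assume "x \<in> set (f s)" "y \<in> set (concat (map f ss))"
    then obtain r where "r \<in> set ss" "y \<in> set (f r)" by auto
    with \<open>x \<in> set (f s)\<close> Cons.prems show "g y x = 0" by (intro assms(2)[of r s]) auto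
  qed
  then show ?case using Cons by simp
qed

lemma sum_nth_distinct: "distinct xs \<Longrightarrow> (\<Sum>i = 0..<length xs. f (xs ! i)) = (\<Sum>x\<in>set xs. f x)"
  using sum.reindex_bij_betw[OF bij_betw_nth[of xs "{0..<length xs}" "set xs"], of f]
  by (simp add: atLeast0LessThan)

lemma list_mat_mult:
  fixes g :: "'b \<Rightarrow> 'b \<Rightarrow> 'a::comm_ring_1"
  assumes "distinct xs"
  shows "list_mat xs g * list_mat xs h = list_mat xs (\<lambda>a b. \<Sum>c\<in>set xs. g a c * h c b)"
  by (rule eq_matI)
    (auto simp: list_mat_def scalar_prod_def sum_nth_distinct[OF assms, symmetric] intro!: sum.cong)

lemma poly_char_poly_list_mat:
  fixes g :: "'b \<Rightarrow> 'b \<Rightarrow> 'a::field"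
  assumes "distinct xs"
  shows "poly (char_poly (list_mat xs g)) k = Determinant.det (list_mat xs (\<lambda>a b. (if a = b then k else 0) - g a b))"
  unfolding char_poly_def
  by (rule poly_det_cong[of _ "length xs"])
    (auto simp: char_poly_matrix_def list_mat_def nth_eq_iff_index_eq[OF assms])

section \<open>Floquet matrices\<close>

text \<open>The matrix of the Laplacian in the quasi-periodic functions \<open>bloch \<theta> b\<close>, for \<open>b\<close> in the
  fundamental domain, is the Floquet matrix.\<close>
definition bloch :: "real ^ 'd::finite \<Rightarrow> real ^ 'd \<Rightarrow> real ^ 'd \<Rightarrow> complex" where
  "bloch \<theta> b v = (if frac_part v = b then exp (\<i> * of_real (inner (int_part v) \<theta>)) else 0)"

lemma translation_class:
  "translation_rel `` {(x, y)} = (\<lambda>m. (x + m, y + m)) ` int_points"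
  unfolding translation_rel_def by auto

lemma translation_class_shift:
  assumes "m \<in> int_points"
  shows "translation_rel `` {(x + m, y + m)} = translation_rel `` {(x, y)}"
proof -
  have "(\<lambda>n. (x + m + n, y + m + n)) ` int_points = (\<lambda>n. (x + n, y + n)) ` int_points"
  proof (intro equalityI subsetI; clarify)
    fix n :: "real ^ 'a" assume n: "n \<in> int_points"
    show "(x + m + n, y + m + n) \<in> (\<lambda>n. (x + n, y + n)) ` int_points"
      by (rule image_eqI[of _ _ "m + n"]) (use n assms in \<open>auto simp: int_points_add add.assoc\<close>)
    show "(x + n, y + n) \<in> (\<lambda>n. (x + m + n, y + m + n)) ` int_points"
      by (rule image_eqI[of _ _ "n - m"]) (use n assms in \<open>auto simp: int_points_diff\<close>)
  qed
  then show ?thesis by (simp add: translation_class)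
qed

lemma class_index_translation_class: "class_index (translation_rel `` {(x, y)}) = int_part y - int_part x"
proof -
  have "edge_index ` translation_rel `` {(x, y)} = {int_part y - int_part x}"
    unfolding translation_class
    by (auto simp: edge_index_def int_part_add image_iff intro!: exI[of _ 0])
  then show ?thesis by (simp add: class_index_def)
qed

text \<open>Every class of oriented edges from the orbit of a to that of b has exactly one
  representative starting at a itself. Neighbours u of a in the orbit of b thus correspond to edge
  classes, and the index of the class is the integral part of u; parallel edges of the quotient are
  counted separately, as they must be.\<close>

lemma laplacian_bloch:
  fixes E :: "(real ^ 'd::finite) set set"
  assumes inv: "\<And>u v m. {u, v} \<in> E \<Longrightarrow> m \<in> int_points \<Longrightarrow> {u + m, v + m} \<in> E"
    and fin: "finite {u. {a, u} \<in> E}" and a: "int_part a = 0"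
  shows "laplacian E (bloch \<theta> b) a = (if a = b then of_nat (graph_degree E a) else 0) -
     (\<Sum>c \<in> fund_edges_between E a b. exp (\<i> * of_real (inner (class_index c) \<theta>)))"
proof -
  define \<phi> where "\<phi> u = translation_rel `` {(a, u)}" for u
  have fa: "frac_part a = a" using a by (simp add: frac_part_def)
  have "bij_betw \<phi> {u. {a, u} \<in> E \<and> frac_part u = b} (fund_edges_between E a b)"
  proof (rule bij_betw_imageI)
    show "inj_on \<phi> {u. {a, u} \<in> E \<and> frac_part u = b}"
    proof (rule inj_onI)
      fix u v assume "\<phi> u = \<phi> v"
      moreover have "(a, u) \<in> \<phi> u"
        unfolding \<phi>_def translation_class by (rule image_eqI[of _ _ 0]) auto
      ultimately show "u = v" unfolding \<phi>_def translation_class by auto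
    qed
    show "\<phi> ` {u. {a, u} \<in> E \<and> frac_part u = b} = fund_edges_between E a b"
    proof (intro equalityI subsetI)
      fix c assume "c \<in> \<phi> ` {u. {a, u} \<in> E \<and> frac_part u = b}"
      then obtain u where u: "{a, u} \<in> E" "frac_part u = b" "c = \<phi> u" by auto
      have "c \<in> fund_edges E"
        unfolding u \<phi>_def fund_edges_def by (rule quotientI) (simp add: oriented_edges_def u)
      moreover have "(a, u) \<in> c"
        unfolding u \<phi>_def translation_class by (rule image_eqI[of _ _ 0]) auto
      ultimately show "c \<in> fund_edges_between E a b"
        unfolding fund_edges_between_def using fa u by auto
    next
      fix c assume "c \<in> fund_edges_between E a b"
      then obtain u v where uv: "c \<in> fund_edges E" "(u, v) \<in> c" "frac_part u = a" "frac_part v = b"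
        by (auto simp: fund_edges_between_def)
      then obtain x y where xy: "{x, y} \<in> E" "c = translation_rel `` {(x, y)}"
        by (auto simp: fund_edges_def oriented_edges_def elim: quotientE)
      then obtain m where m: "m \<in> int_points" "u = x + m" "v = y + m"
        using uv(2) by (auto simp: translation_class)
      \<comment> \<open>Translating by this lattice vector moves the start of the representative
        into the unit cell, that is, to a.\<close>
      let ?n = "m - int_part u" and ?w = "v - int_part u"
      have n: "?n \<in> int_points" using m by (simp add: int_points_diff)
      have eq: "x + ?n = a" "y + ?n = ?w"
        using uv(3) m unfolding frac_part_def by (auto simp: algebra_simps)
      have "frac_part ?w = b"
        using frac_part_add[OF int_points_uminus[OF int_part_int_points], of v u] uv(4) by simp
      moreover have "{a, ?w} \<in> E" using inv[OF xy(1) n] unfolding eq .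
      moreover have "c = \<phi> ?w"
        using translation_class_shift[OF n, of x y] unfolding eq xy(2) \<phi>_def by simp
      ultimately show "c \<in> \<phi> ` {u. {a, u} \<in> E \<and> frac_part u = b}" by auto
    qed
  qed
  then have "(\<Sum>c \<in> fund_edges_between E a b. exp (\<i> * of_real (inner (class_index c) \<theta>)))
    = (\<Sum>u | {a, u} \<in> E \<and> frac_part u = b. exp (\<i> * of_real (inner (class_index (\<phi> u)) \<theta>)))"
    by (rule sum.reindex_bij_betw[symmetric])
  also have "\<dots> = (\<Sum>u | {a, u} \<in> E. bloch \<theta> b u)"
    using fin by (intro sum.mono_neutral_cong_left)
      (auto simp: bloch_def \<phi>_def class_index_translation_class a)
  finally show ?thesis
    using a fa by (auto simp: laplacian_def sum_subtractf graph_degree_def bloch_def)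
qed

lemma (in subdivided_lattice) edge_translate:
  assumes "{u, v} \<in> E" "m \<in> int_points" shows "{u + m, v + m} \<in> E"
proof -
  obtain n s j where "n \<in> int_points" "j \<le> N"
    "u = pt n s j \<and> v = pt n s (Suc j) \<or> v = pt n s j \<and> u = pt n s (Suc j)"
    using assms(1) unfolding edge_iff by blast
  then show ?thesis
    unfolding edge_iff using assms(2) by (intro exI[of _ "n + m"] exI[of _ s] exI[of _ j]) (auto simp: pt_add int_points_add)
qed

lemma int_part_0_iff: "int_part x = 0 \<longleftrightarrow> (\<forall>i. 0 \<le> x $ i \<and> x $ i < 1)"
  by (simp add: int_part_def vec_eq_iff floor_eq_iff)

context subdivided_lattice_ge2
begin

lemma fund_verts_iff: "v \<in> fund_verts V \<longleftrightarrow> v \<in> V \<and> int_part v = 0"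
  by (auto simp: fund_verts_def int_part_0_iff)

lemma fund_verts_eq: "fund_verts V = insert 0 ((\<lambda>(s, j). pt 0 s j) ` (UNIV \<times> {1..N}))"
proof (intro equalityI subsetI)
  fix v assume "v \<in> fund_verts V"
  then have v: "v \<in> V" "int_part v = 0" by (auto simp: fund_verts_iff)
  from v(1) show "v \<in> insert 0 ((\<lambda>(s, j). pt 0 s j) ` (UNIV \<times> {1..N}))"
  proof (cases rule: vert_cases)
    case 1
    then show ?thesis using v(2) int_part_eq_self[of v] by simp
  next
    case (2 m s j)
    then have "m = 0" using v(2) int_part_pt[of m j s] by simp
    then show ?thesis using 2 by auto
  qed
next
  fix v assume "v \<in> insert 0 ((\<lambda>(s, j). pt 0 s j) ` (UNIV \<times> {1..N}))"
  then obtain s j where "v = pt 0 s j" "j \<le> N" by force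
  then show "v \<in> fund_verts V"
    unfolding fund_verts_iff using int_part_pt[of 0 j s] pt_vert[of 0 j s] by auto
qed

lemma inj_pt: "inj_on (\<lambda>(s, j). pt 0 s j) (UNIV \<times> {1..N})"
proof (rule inj_onI; clarify)
  fix s j r i assume "j \<in> {1..N}" "i \<in> {1..N}" "pt 0 s j = pt 0 r i"
  then show "s = r \<and> j = i" by (intro pt_0_inj) auto
qed

lemma pt_ne_0: "1 \<le> j \<Longrightarrow> j \<le> N \<Longrightarrow> pt 0 s j \<noteq> 0"
  using pt_not_int[of j 0 s] int_points_0 by metis

lemma card_fund_verts: "card (fund_verts V) = CARD('d) * N + 1"
proof -
  have "0 \<notin> (\<lambda>(s, j). pt 0 s j) ` (UNIV \<times> {1..N})"
  proof
    assume "0 \<in> (\<lambda>(s, j). pt 0 s j) ` (UNIV \<times> {1..N})"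
    then obtain s j where "0 = pt 0 s j" "1 \<le> j" "j \<le> N" by auto
    with pt_ne_0[of j s] show False by simp
  qed
  then show ?thesis
    using card_image[OF inj_pt] by (simp add: fund_verts_eq card_cartesian_product)
qed

lemma finite_fund_verts: "finite (fund_verts V)"
  by (simp add: fund_verts_eq)

lemma floquet_eq:
  assumes "distinct vs" "set vs = fund_verts V"
  shows "floquet E vs \<theta> = list_mat vs (\<lambda>a b. lap (bloch \<theta> b) a)"
proof -
  have *: "vs ! i \<in> V" "int_part (vs ! i) = 0" if "i < length vs" for i
    using that assms nth_mem[OF that] by (auto simp: fund_verts_iff)
  show ?thesis
    unfolding floquet_def list_mat_def
    by (rule eq_matI) (auto simp: laplacian_bloch[OF edge_translate nb_bounds(1) *(2)] nth_eq_iff_index_eq[OF assms(1)])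
qed

end

lemma laplacian_sum:
  "laplacian E (\<lambda>v. \<Sum>b\<in>B. c b * f b v) a = (\<Sum>b\<in>B. c b * laplacian E (f b) a)"
  unfolding laplacian_def
  by (simp add: sum_distrib_left right_diff_distrib sum_subtractf[symmetric]) (rule sum.swap)

abbreviation "lattice_symbol (\<theta> :: real ^ 'd::finite) \<equiv> \<Sum>s\<in>UNIV. 2 * cos (\<theta> $ s)"

lemma lattice_symbol_abs_le: "\<bar>lattice_symbol (\<theta> :: real ^ 'd::finite)\<bar> \<le> 2 * real CARD('d)"
proof -
  have "\<bar>lattice_symbol \<theta>\<bar> \<le> (\<Sum>s\<in>(UNIV :: 'd set). 2)"
    by (intro order.trans[OF sum_abs] sum_mono) (simp add: abs_mult)
  then show ?thesis by simp
qed

lemma list_mat_map: "list_mat (map h xs) g = list_mat xs (\<lambda>i j. g (h i) (h j))"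
  unfolding list_mat_def by (rule eq_matI) auto

lemma det_list_mat_single: "Determinant.det (list_mat [a] g) = g a a"
  by (subst Determinant.det_single) (auto simp: list_mat_def)

lemma det_list_mat_id:
  assumes "distinct xs"
  shows "Determinant.det (list_mat xs (\<lambda>a b. if a = b then 1 else 0)) = (1 :: 'b::comm_ring_1)"
proof -
  have "list_mat xs (\<lambda>a b. if a = b then 1 else 0) = (1\<^sub>m (length xs) :: 'b mat)"
    unfolding list_mat_def by (rule eq_matI) (auto simp: nth_eq_iff_index_eq[OF assms])
  then show ?thesis by (simp add: Determinant.det_one)
qed

section \<open>Block structure and characteristic polynomial of the Floquet matrix\<close>

context subdivided_lattice_ge2
begin

lemma bloch_pt:
  assumes "1 \<le> i" "i \<le> N" "j \<le> Suc N"
  shows "bloch \<theta> (pt 0 r i) (pt 0 s j) = (if s = r \<and> i = j then 1 else 0)"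
proof (cases "j = Suc N")
  case True
  then have "frac_part (pt 0 s j) = 0" by simp
  then show ?thesis
    using pt_ne_0[OF assms(1,2), of r] True assms(2) by (auto simp: bloch_def)
next
  case False
  then have j: "j \<le> N" using assms by simp
  have "pt 0 s j = pt 0 r i \<longleftrightarrow> s = r \<and> i = j"
    using pt_0_inj[OF assms(1,2) j, of r s] by auto
  then show ?thesis
    using int_part_pt[of 0 j s] frac_part_pt[of 0 j s] j by (auto simp: bloch_def)
qed

lemma lap_bloch_pt:
  assumes "i \<in> {1..N}" "j \<in> {1..N}"
  shows "lap (bloch \<theta> (pt 0 r i)) (pt 0 s j) =
    (if s = r then 2 * (if i = j then 1 else 0) - (if i = j - 1 then 1 else 0) - (if i = Suc j then 1 else 0) else 0)"
  using assms lap_inner[of 0 j "bloch \<theta> (pt 0 r i)" s] bloch_pt[of i j \<theta> r s] bloch_pt[of i "j - 1" \<theta> r s]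
    bloch_pt[of i "Suc j" \<theta> r s]
  by auto

text \<open>On the added vertices of one edge the matrix is the Dirichlet Laplacian of a path, the
  same for all \<theta>, with the modes as eigenvectors. Vector positions count from 0, the vertices
  of the edge from 1.\<close>

lemma eigenvalue_path_block:
  assumes n: "1 \<le> n" "n \<le> N"
  shows "eigenvalue (list_mat (map (pt 0 s) [1..<Suc N]) (\<lambda>a b. lap (bloch \<theta> b) a)) (of_real (flat_value N n))"
proof -
  define h where "h i j = (2 * (if j = i then 1 else 0) - (if j = i - 1 then 1 else 0) - (if j = Suc i then 1 else 0) :: complex)" for i j
  let ?xs = "[1..<Suc N]"
  have xs: "distinct ?xs" "set ?xs = {1..N}" "length ?xs = N" by auto
  have M: "list_mat (map (pt 0 s) ?xs) (\<lambda>a b. lap (bloch \<theta> b) a) = list_mat ?xs h"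
    unfolding list_mat_map by (rule list_mat_cong) (use lap_bloch_pt in \<open>auto simp: h_def\<close>)
  define w where "w = Matrix.vec N (\<lambda>k. mode n (Suc k))"
  have row: "(\<Sum>j\<in>{1..N}. h i j * mode n j) = of_real (flat_value N n) * mode n i" if i: "i \<in> {1..N}" for i
  proof -
    obtain k where k: "i = Suc k" using i by (cases i) auto
    \<comment> \<open>Adding the two ends costs nothing, as the mode vanishes there, and lets the
      recursion hold without boundary cases.\<close>
    have "(\<Sum>j\<in>{1..N}. h i j * mode n j) = (\<Sum>j\<in>{0..Suc N}. h i j * mode n j)"
      using mode_0[OF n] mode_last[OF n] by (intro sum.mono_neutral_left) (auto simp: le_Suc_eq not_less_eq_eq)
    also have "\<dots> = (\<Sum>j\<in>{0..Suc N}. (if j = i then 2 * mode n i else 0) - (if j = k then mode n k else 0) - (if j = Suc i then mode n (Suc i) else 0))"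
      by (intro sum.cong) (auto simp: h_def k)
    also have "\<dots> = 2 * mode n i - mode n k - mode n (Suc i)"
      using i k by (simp add: sum_subtractf sum.delta del: sum.atLeast0_atMost_Suc)
    also have "\<dots> = of_real (flat_value N n) * mode n i"
      using mode_rec[OF n, of k] by (simp add: k algebra_simps)
    finally show ?thesis .
  qed
  have "list_mat ?xs h *\<^sub>v w = of_real (flat_value N n) \<cdot>\<^sub>v w"
  proof (rule eq_vecI)
    fix k assume "k < dim_vec (complex_of_real (flat_value N n) \<cdot>\<^sub>v w)"
    then have k: "k < N" by (simp add: w_def)
    have "vec_index (list_mat ?xs h *\<^sub>v w) k = (\<Sum>i = 0..<length ?xs. h (Suc k) (?xs ! i) * mode n (?xs ! i))"
      using k by (simp add: list_mat_def w_def scalar_prod_def del: upt_Suc)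
    also have "\<dots> = (\<Sum>j\<in>{1..N}. h (Suc k) j * mode n j)"
      unfolding sum_nth_distinct[OF xs(1), of "\<lambda>j. h (Suc k) j * mode n j"] xs(2) ..
    also have "\<dots> = vec_index (of_real (flat_value N n) \<cdot>\<^sub>v w) k"
      using row[of "Suc k"] k by (simp add: w_def)
    finally show "vec_index (list_mat ?xs h *\<^sub>v w) k = vec_index (of_real (flat_value N n) \<cdot>\<^sub>v w) k" .
  qed (simp add: w_def list_mat_def)
  moreover have "w \<noteq> 0\<^sub>v N"
  proof
    assume "w = 0\<^sub>v N"
    then have "vec_index w 0 = vec_index (0\<^sub>v N) 0" by simp
    then show False using mode_1[OF n] n by (simp add: w_def)
  qed
  ultimately show ?thesis
    unfolding M eigenvalue_def eigenvector_def
    by (intro exI[of _ w]) (simp add: w_def list_mat_def del: upt_Suc)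
qed

lemma char_poly_path_block:
  "char_poly (list_mat (map (pt 0 s) [1..<Suc N]) (\<lambda>a b. lap (bloch \<theta> b) a)) = (\<Prod>n\<in>{1..N}. [:- of_real (flat_value N n), 1:])"
proof -
  let ?M = "list_mat (map (pt 0 s) [1..<Suc N]) (\<lambda>a b. lap (bloch \<theta> b) a)"
  let ?f = "\<lambda>n. complex_of_real (flat_value N n)"
  have M: "?M \<in> carrier_mat N N" using list_mat_carrier[of "map (pt 0 s) [1..<Suc N]"] by (simp del: upt_Suc)
  have "char_poly ?M = Polynomial.smult (lead_coeff (char_poly ?M)) (\<Prod>x\<in>?f ` {1..N}. [:- x, 1:])"
  proof (rule poly_eq_prod_roots)
    show "card (?f ` {1..N}) = degree (char_poly ?M)"
      using degree_monic_char_poly[OF M] by (simp add: card_image[OF inj_complex_flat_value] del: One_nat_def)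
    show "char_poly ?M \<noteq> 0"
      using degree_monic_char_poly[OF M] by auto
    fix x assume "x \<in> ?f ` {1..N}"
    then obtain n where "x = ?f n" "1 \<le> n" "n \<le> N" by auto
    then show "poly (char_poly ?M) x = 0"
      using eigenvalue_path_block[of n s \<theta>] eigenvalue_root_char_poly[OF M] by simp
  qed simp
  then show ?thesis
    using degree_monic_char_poly[OF M] by (simp add: prod.reindex[OF inj_complex_flat_value] del: One_nat_def)
qed

definition plane_wave :: "real ^ 'd \<Rightarrow> real ^ 'd \<Rightarrow> complex" where
  "plane_wave \<theta> v = (if v \<in> int_points then exp (\<i> * of_real (inner v \<theta>)) else 0)"

lemma plane_wave_off: "\<forall>v. v \<notin> int_points \<longrightarrow> plane_wave \<theta> v = 0"
  by (simp add: plane_wave_def)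

lemma plane_wave_add: "m \<in> int_points \<Longrightarrow> plane_wave \<theta> (v + m) = exp (\<i> * of_real (inner m \<theta>)) * plane_wave \<theta> v"
  using int_points_add[of v m] int_points_diff[of "v + m" m]
  by (auto simp: plane_wave_def inner_add_left ring_distribs exp_add)

lemma shift_plane_wave:
  "shift_op (plane_wave \<theta>) v = of_real (lattice_symbol \<theta>) * plane_wave \<theta> v"
proof -
  have ne: "- e s \<in> int_points" for s by (simp add: int_points_uminus)
  have 2: "exp (\<i> * of_real y) + exp (- (\<i> * of_real y)) = of_real (2 * cos y)" for y
    using cos_exp_eq[of "of_real y :: complex"] by (simp add: cos_of_real mult.commute)
  have "shift_op (plane_wave \<theta>) v = (\<Sum>s\<in>UNIV. (exp (\<i> * of_real (\<theta> $ s)) + exp (- (\<i> * of_real (\<theta> $ s)))) * plane_wave \<theta> v)"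
    unfolding shift_op_def diff_conv_add_uminus plane_wave_add[OF axis_int_points] plane_wave_add[OF ne]
    by (simp add: inner_axis' algebra_simps)
  then show ?thesis
    unfolding 2 by (simp add: sum_distrib_right)
qed

lemma extension_plane_wave_add:
  assumes m: "m \<in> int_points"
  shows "extension x (plane_wave \<theta>) (v + m) = exp (\<i> * of_real (inner m \<theta>)) * extension x (plane_wave \<theta>) v"
proof -
  have "plane_wave \<theta> (v + m - a) = exp (\<i> * of_real (inner m \<theta>)) * plane_wave \<theta> (v - a)"
    "plane_wave \<theta> (v + m - a + b) = exp (\<i> * of_real (inner m \<theta>)) * plane_wave \<theta> (v - a + b)" for a b
    using plane_wave_add[OF m, of \<theta> "v - a"] plane_wave_add[OF m, of \<theta> "v - a + b"] by (simp_all add: algebra_simps)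
  then show ?thesis
    unfolding extension_def plane_wave_add[OF m]
    by (simp add: sum_distrib_left distrib_left mult.left_commute del: cheb.simps)
qed

text \<open>The extension of a plane wave is quasi-periodic, hence the combination of Bloch
  functions with its values on the fundamental domain as coefficients; by linearity its Laplacian is
  a combination of columns of the Floquet matrix.\<close>

lemma extension_eq_bloch_sum:
  "extension x (plane_wave \<theta>) v = (\<Sum>b\<in>fund_verts V. extension x (plane_wave \<theta>) b * bloch \<theta> b v)"
proof -
  have v: "frac_part v + int_part v = v" using int_frac_part[of v] by (simp add: add.commute)
  have V: "frac_part v \<in> V \<longleftrightarrow> v \<in> V"
    using translate_iff[of "int_part v" "frac_part v"] v by simp
  have "int_part (frac_part v) = 0"
    using int_part_add[OF int_points_uminus[OF int_part_int_points], of v v] by (simp add: frac_part_def)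
  then have fv: "frac_part v \<in> fund_verts V \<longleftrightarrow> v \<in> V"
    using V by (simp add: fund_verts_iff)
  have "(\<Sum>b\<in>fund_verts V. extension x (plane_wave \<theta>) b * bloch \<theta> b v) = (\<Sum>b\<in>fund_verts V. if b = frac_part v then
      extension x (plane_wave \<theta>) (frac_part v) * exp (\<i> * of_real (inner (int_part v) \<theta>)) else 0)"
    by (intro sum.cong) (auto simp: bloch_def)
  also have "\<dots> = (if v \<in> V then extension x (plane_wave \<theta>) (frac_part v) * exp (\<i> * of_real (inner (int_part v) \<theta>)) else 0)"
    using finite_fund_verts by (simp add: fv)
  also have "\<dots> = extension x (plane_wave \<theta>) v"
    using extension_off[OF plane_wave_off, of v x \<theta>] extension_plane_wave_add[OF int_part_int_points, of x \<theta> "frac_part v" v]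
    unfolding v by (simp add: mult.commute)
  finally show ?thesis ..
qed

end

lemma poly_eqI_infinite:
  fixes p q :: "'a::idom poly"
  assumes "infinite S" "\<And>x. x \<in> S \<Longrightarrow> poly p x = poly q x"
  shows "p = q"
proof (rule ccontr)
  assume "p \<noteq> q"
  then have "finite {x. poly (p - q) x = 0}" by (intro poly_roots_finite) simp
  moreover have "S \<subseteq> {x. poly (p - q) x = 0}" using assms(2) by auto
  ultimately show False using assms(1) finite_subset by blast
qed

lemma infinite_nonroots:
  fixes p :: "real poly"
  assumes "p \<noteq> 0" shows "infinite {x. poly p x \<noteq> 0}"
proof
  assume "finite {x. poly p x \<noteq> 0}"
  then have "finite ({x. poly p x \<noteq> 0} \<union> {x. poly p x = 0})" using poly_roots_finite[OF assms] by simp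
  moreover have "{x. poly p x \<noteq> 0} \<union> {x. poly p x = 0} = UNIV" by auto
  ultimately show False using infinite_UNIV_char_0[where ?'a = real] by simp
qed

context subdivided_lattice_ge2
begin

lemma extension_at_0: "extension x (plane_wave \<theta>) 0 = of_real (poly U x)"
  using extension_pt[OF plane_wave_off, of 0 0 x \<theta> undefined] by (simp add: plane_wave_def[of _ 0] del: cheb.simps(2,3))

lemma lap_extension_fund:
  assumes "a \<in> fund_verts V"
  shows "of_real x * extension x (plane_wave \<theta>) a - lap (extension x (plane_wave \<theta>)) a
    = (if a = 0 then of_real (lattice_symbol \<theta> - poly D x) else 0)"
proof -
  have "a = 0" if "a \<in> int_points"
    using assms int_part_eq_self[OF that] by (simp add: fund_verts_iff)
  then have "plane_wave \<theta> a = (if a = 0 then 1 else 0)"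
    by (auto simp: plane_wave_def)
  then show ?thesis
    using lap_extension[OF plane_wave_off, of x \<theta> a] unfolding shift_plane_wave by (auto simp: algebra_simps)
qed

text \<open>Replacing the column of the vertex \<open>0\<close> by the combination of columns with the coefficients
  \<open>extension x (plane_wave \<theta>)\<close> makes the matrix \<open>x - \<Delta>(\<theta>)\<close> block triangular.\<close>
lemma poly_char_poly_floquet:
  assumes vs: "distinct vs" "set vs = fund_verts V"
  shows "poly (char_poly (floquet E vs \<theta>)) (of_real x) * of_real (poly U x)
    = of_real (lattice_symbol \<theta> - poly D x) * (\<Prod>n\<in>{1..N}. of_real x - of_real (flat_value N n)) ^ CARD('d)"
proof -
  define X where "X a b = (if a = b then of_real x else 0) - lap (bloch \<theta> b) a" for a b
  define \<psi> where "\<psi> = extension x (plane_wave \<theta>)"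
  \<comment> \<open>The column operation as a matrix: the identity with the column of 0 replaced by
    \<psi>. Its determinant is \<psi> 0 = U(x).\<close>
  define W where "W a b = (if b = 0 then \<psi> a else if a = b then 1 else 0)" for a b
  obtain ss :: "'d list" where ss: "distinct ss" "set ss = UNIV"
    using finite_distinct_list[OF finite_class.finite_UNIV] by metis
  define block where "block s = map (pt 0 s) [1..<Suc N]" for s
  define rest where "rest = concat (map block ss)"
  define us where "us = [0] @ rest"
  have block: "set (block s) = pt 0 s ` {1..N}" for s by (auto simp: block_def)
  have set_rest: "set rest = (\<lambda>(s, j). pt 0 s j) ` (UNIV \<times> {1..N})"
    unfolding rest_def using ss by (auto simp: block)
  have rest_0: "a \<noteq> 0" if "a \<in> set rest" for a
    using that pt_ne_0 by (auto simp: set_rest)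
  have set_us: "set us = fund_verts V"
    by (simp add: us_def set_rest fund_verts_eq)
  have distinct_block: "distinct (block s)" for s
    unfolding block_def distinct_map using pt_0_inj[of _ _ s s] by (auto intro!: inj_onI)
  have "length rest = CARD('d) * N"
    unfolding rest_def using ss distinct_card[OF ss(1)]
    by (simp add: length_concat block_def map_replicate_const sum_list_replicate comp_def del: upt_Suc)
  then have "card (set rest) = length rest"
    unfolding set_rest card_image[OF inj_pt] by (simp add: card_cartesian_product)
  then have "distinct rest" by (rule card_distinct)
  then have us: "distinct us" using rest_0 by (auto simp: us_def)
  have "floquet E vs \<theta> = list_mat vs (\<lambda>a b. lap (bloch \<theta> b) a)"
    by (rule floquet_eq[OF vs])
  then have "poly (char_poly (floquet E vs \<theta>)) (of_real x) = Determinant.det (list_mat vs X)"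
    unfolding X_def using poly_char_poly_list_mat[OF vs(1)] by simp
  also have "\<dots> = Determinant.det (list_mat us X)"
    using vs(2) set_us by (intro det_list_mat_permute vs us) simp
  finally have 1: "poly (char_poly (floquet E vs \<theta>)) (of_real x) = Determinant.det (list_mat us X)" .
  have "Determinant.det (list_mat us W) = Determinant.det (list_mat [0] W) * Determinant.det (list_mat rest W)"
    unfolding us_def using rest_0 by (intro det_list_mat_append_upper_zero) (auto simp: W_def)
  also have "list_mat rest W = list_mat rest (\<lambda>a b. if a = b then 1 else 0)"
    using rest_0 by (intro list_mat_cong) (auto simp: W_def)
  finally have 2: "Determinant.det (list_mat us W) = of_real (poly U x)"
    unfolding det_list_mat_single det_list_mat_id[OF \<open>distinct rest\<close>] by (simp add: W_def[of 0 0] \<psi>_def extension_at_0 del: cheb.simps)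
  have XW: "(\<Sum>c\<in>set us. X a c * W c b) = (if b = 0 then (if a = 0 then of_real (lattice_symbol \<theta> - poly D x) else 0) else X a b)"
    if a: "a \<in> set us" and b: "b \<in> set us" for a b
  proof (cases "b = 0")
    case True
    have "(\<Sum>c\<in>set us. X a c * W c b) = (\<Sum>c\<in>set us. (if c = a then of_real x * \<psi> a else 0) - \<psi> c * lap (bloch \<theta> c) a)"
      using True by (intro sum.cong) (auto simp: X_def W_def algebra_simps)
    also have "\<dots> = of_real x * \<psi> a - lap (\<lambda>v. \<Sum>c\<in>set us. \<psi> c * bloch \<theta> c v) a"
      using a by (simp add: sum_subtractf laplacian_sum)
    also have "(\<lambda>v. \<Sum>c\<in>set us. \<psi> c * bloch \<theta> c v) = \<psi>"
      unfolding set_us \<psi>_def by (rule ext) (rule extension_eq_bloch_sum[symmetric])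
    also have "of_real x * \<psi> a - lap \<psi> a = (if a = 0 then of_real (lattice_symbol \<theta> - poly D x) else 0)"
      unfolding \<psi>_def by (rule lap_extension_fund) (use a set_us in auto)
    finally show ?thesis using True by simp
  next
    case False
    have "(\<Sum>c\<in>set us. X a c * W c b) = (\<Sum>c\<in>set us. if c = b then X a b else 0)"
      using False by (intro sum.cong) (auto simp: W_def)
    then show ?thesis using False b by simp
  qed
  \<comment> \<open>Of the column of 0 a single entry remains, the symbol minus D(x), and it splits
    off as a factor of the determinant.\<close>
  define Y where "Y a b = (if b = 0 then (if a = 0 then of_real (lattice_symbol \<theta> - poly D x) else 0) else X a b)" for a b
  have "list_mat us X * list_mat us W = list_mat us Y"
    unfolding list_mat_mult[OF us] Y_def by (rule list_mat_cong) (rule XW)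
  then have "Determinant.det (list_mat us X) * Determinant.det (list_mat us W) = Determinant.det (list_mat us Y)"
    using Determinant.det_mult[OF list_mat_carrier list_mat_carrier, of us X W] by simp
  also have "\<dots> = Determinant.det (list_mat [0] Y) * Determinant.det (list_mat rest Y)"
    unfolding us_def using rest_0 by (intro det_list_mat_append_lower_zero) (auto simp: Y_def)
  also have "list_mat rest Y = list_mat rest X"
    using rest_0 by (intro list_mat_cong) (auto simp: Y_def)
  \<comment> \<open>Added vertices on edges of different directions are never adjacent, so the
    remaining matrix is block diagonal, with one path block for each direction.\<close>
  also have "Determinant.det (list_mat rest X) = (\<Prod>s\<leftarrow>ss. Determinant.det (list_mat (block s) X))"
    unfolding rest_def
  proof (rule det_list_mat_concat[OF ss(1)])
    fix s r a b assume sr: "s \<noteq> r" "a \<in> set (block s)" "b \<in> set (block r)"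
    then obtain i j where ij: "i \<in> {1..N}" "j \<in> {1..N}" "a = pt 0 s j" "b = pt 0 r i"
      unfolding block by auto
    then have "a \<noteq> b" using sr(1) pt_0_inj[of j i s r] by auto
    then show "X a b = 0"
      using sr(1) lap_bloch_pt[OF ij(1,2), of \<theta> r s] ij by (simp add: X_def)
  qed
  also have "\<dots> = (\<Prod>s\<leftarrow>ss. \<Prod>n\<in>{1..N}. of_real x - of_real (flat_value N n))"
  proof -
    have "Determinant.det (list_mat (block s) X) = (\<Prod>n\<in>{1..N}. of_real x - of_real (flat_value N n))" for s
    proof -
      have "Determinant.det (list_mat (block s) X) = poly (char_poly (list_mat (block s) (\<lambda>a b. lap (bloch \<theta> b) a))) (of_real x)"
        unfolding X_def by (rule poly_char_poly_list_mat[OF distinct_block, symmetric])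
      then show ?thesis
        unfolding block_def char_poly_path_block by (simp add: poly_prod)
    qed
    then show ?thesis by simp
  qed
  also have "\<dots> = (\<Prod>n\<in>{1..N}. of_real x - of_real (flat_value N n)) ^ CARD('d)"
    using ss distinct_card[OF ss(1)] by (simp add: map_replicate_const prod_list_replicate)
  finally show ?thesis
    unfolding 1 2 det_list_mat_single by (simp add: Y_def)
qed

text \<open>The path blocks contribute the d-th power of the product over the roots of U, and
  dividing by U(x) removes one factor. The division is legitimate at real x that are not roots of U;
  these are infinitely many points and determine the polynomial.\<close>

theorem char_poly_floquet:
  assumes vs: "distinct vs" "set vs = fund_verts V"
  shows "char_poly (floquet E vs \<theta>) = (\<Prod>n\<in>{1..N}. [:- of_real (flat_value N n), 1:]) ^ (CARD('d) - 1)
    * (\<Prod>k\<le>N. [:- of_real (roots.band_root k (lattice_symbol \<theta>)), 1:])"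
    (is "?p = ?q ^ _ * ?r")
proof (rule poly_eqI_infinite)
  let ?c = "lattice_symbol \<theta>"
  note c = lattice_symbol_abs_le[of \<theta>]
  have "U \<noteq> 0" using degree_cheb[of N] by auto
  then show "infinite (complex_of_real ` {x. poly U x \<noteq> 0})"
    using infinite_nonroots[of U] by (simp add: finite_image_iff inj_on_def)
  fix z assume "z \<in> complex_of_real ` {x. poly U x \<noteq> 0}"
  then obtain x where x: "z = of_real x" "poly U x \<noteq> 0" by auto
  define u where "u = (\<Prod>n\<in>{1..N}. x - flat_value N n)"
  define r where "r = (\<Prod>k\<le>N. x - roots.band_root k ?c)"
  have U: "poly U x = (-1) ^ N * u"
    unfolding cheb_eq_prod u_def by (simp add: poly_prod)
  have "poly (D - [:?c:]) x = (-1) ^ Suc N * r"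
    unfolding D_def roots.discriminant_minus_eq_prod[OF c] r_def by (simp add: poly_prod)
  then have D: "?c - poly D x = (-1) ^ N * r" by simp
  obtain k where k: "CARD('d) = Suc k" using card_ge2 by (cases "CARD('d)") auto
  have u: "u \<noteq> 0" using x(2) U by auto
  have "poly ?p z * of_real ((-1) ^ N * u) = of_real ((-1) ^ N * r) * of_real u ^ CARD('d)"
    using poly_char_poly_floquet[OF vs, of \<theta> x] unfolding U D x(1) by (simp add: u_def)
  then have "(poly ?p z) * (of_real u * of_real ((-1) ^ N)) = (of_real r * of_real u ^ k) * (of_real u * of_real ((-1) ^ N))"
    unfolding k of_real_mult power_Suc by (simp only: mult_ac)
  then have "poly ?p z = of_real r * of_real u ^ k"
    using u by simp
  moreover have "poly ?q z = of_real u" "poly ?r z = of_real r"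
    by (simp_all add: poly_prod u_def r_def x(1))
  ultimately show "poly ?p z = poly (?q ^ (CARD('d) - 1) * ?r) z"
    unfolding poly_mult poly_power by (simp add: k mult.commute)
qed

end

section \<open>Multiplicities and bands\<close>

lemma proots_prod_linear: "finite A \<Longrightarrow> proots (\<Prod>i\<in>A. [:- f i, 1:]) = image_mset f (mset_set A)"
proof -
  assume A: "finite A"
  then have "proots (\<Prod>i\<in>A. [:- f i, 1:]) = (\<Sum>i\<in>A. {#f i#})"
    by (subst proots_prod) simp_all
  also have "\<dots> = image_mset f (mset_set A)"
    using A by (induction A rule: finite_induct) auto
  finally show ?thesis .
qed

lemma sum_replicate_mset: "finite A \<Longrightarrow> (\<Sum>i\<in>A. replicate_mset k (f i)) = repeat_mset k (image_mset f (mset_set A))"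
  by (induction A rule: finite_induct) auto

lemma infinite_torus: "infinite (torus :: (real ^ 'd::finite) set)"
proof -
  have "inj_on (\<lambda>r. (\<chi> i. r) :: real ^ 'd) {0..<2 * pi}"
    by (auto simp: inj_on_def vec_eq_iff)
  moreover have "(\<lambda>r. (\<chi> i. r) :: real ^ 'd) ` {0..<2 * pi} \<subseteq> torus"
    by (auto simp: torus_def)
  moreover have "infinite {0..<2 * pi}" by simp
  ultimately show ?thesis using finite_imageD finite_subset by blast
qed

text \<open>Two different multiplicities would both hold off finite sets, but the torus is infinite;
  so the description operator in \<open>flat_band_mset\<close> picks the intended value.\<close>

lemma flat_multiplicity_eqI: "has_flat_multiplicity E vs \<mu> m \<Longrightarrow> (THE m. has_flat_multiplicity E vs \<mu> m) = m"
proof (rule the_equality)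
  fix n assume n: "has_flat_multiplicity E vs \<mu> m" "has_flat_multiplicity E vs \<mu> n"
  show "n = m"
  proof (rule ccontr)
    assume "n \<noteq> m"
    then have "torus \<subseteq> {\<theta> \<in> torus. count (floquet_eigenvalues E vs \<theta>) \<mu> \<noteq> m}
      \<union> {\<theta> \<in> torus. count (floquet_eigenvalues E vs \<theta>) \<mu> \<noteq> n}" by auto
    then have "finite (torus :: (real ^ 'a) set)"
      by (rule finite_subset) (use n in \<open>simp add: has_flat_multiplicity_def\<close>)
    then show False using infinite_torus by blast
  qed
qed

lemma lattice_symbol_torus:
  "lattice_symbol ` (torus :: (real ^ 'd::finite) set) = {- 2 * real CARD('d)..2 * real CARD('d)}"
proof (intro equalityI subsetI)
  fix c :: real assume c: "c \<in> {- 2 * real CARD('d)..2 * real CARD('d)}"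
  define r where "r = c / (2 * real CARD('d))"
  have r: "- 1 \<le> r" "r \<le> 1" using c by (auto simp: r_def divide_simps)
  have "c = lattice_symbol ((\<chi> i. arccos r) :: real ^ 'd)"
    using r by (simp add: r_def)
  moreover have "(\<chi> i. arccos r) \<in> (torus :: (real ^ 'd) set)"
    using arccos_bounded[OF r] pi_gt_zero by (auto simp: torus_def simp del: pi_gt_zero)
  ultimately show "c \<in> lattice_symbol ` (torus :: (real ^ 'd) set)" by blast
next
  fix c assume "c \<in> lattice_symbol ` (torus :: (real ^ 'd) set)"
  then obtain \<theta> :: "real ^ 'd" where "c = lattice_symbol \<theta>" by blast
  then show "c \<in> {- 2 * real CARD('d)..2 * real CARD('d)}"
    using lattice_symbol_abs_le[of \<theta>] unfolding atLeastAtMost_iff by linarith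
qed

text \<open>The extremes force every |cos| to be 1, which leaves the angles 0 and pi. Only at such
  quasimomenta can a band function meet a flat band.\<close>

lemma finite_extremal_quasimomenta:
  "finite {\<theta> \<in> torus. \<bar>lattice_symbol (\<theta> :: real ^ 'd::finite)\<bar> = 2 * real CARD('d)}"
proof (rule finite_subset)
  show "finite (vec_lambda ` (PiE UNIV (\<lambda>_. {0, pi})) :: (real ^ 'd) set)"
    by (intro finite_imageI finite_PiE) auto
  show "{\<theta> \<in> torus. \<bar>lattice_symbol (\<theta> :: real ^ 'd)\<bar> = 2 * real CARD('d)} \<subseteq> vec_lambda ` (PiE UNIV (\<lambda>_. {0, pi}))"
  proof
    fix \<theta> :: "real ^ 'd" assume "\<theta> \<in> {\<theta> \<in> torus. \<bar>lattice_symbol \<theta>\<bar> = 2 * real CARD('d)}"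
    then have \<theta>: "\<theta> \<in> torus" "\<bar>lattice_symbol \<theta>\<bar> = 2 * real CARD('d)" by auto
    have "\<bar>lattice_symbol \<theta>\<bar> \<le> (\<Sum>s\<in>UNIV. 2 * \<bar>cos (\<theta> $ s)\<bar>)"
      by (intro order.trans[OF sum_abs] sum_mono) (simp add: abs_mult)
    then have "(\<Sum>s\<in>UNIV. 2 - 2 * \<bar>cos (\<theta> $ s)\<bar>) \<le> 0"
      unfolding \<theta>(2) by (simp add: sum_subtractf)
    moreover have nonneg: "0 \<le> 2 - 2 * \<bar>cos (\<theta> $ s)\<bar>" for s by simp
    ultimately have "(\<Sum>s\<in>UNIV. 2 - 2 * \<bar>cos (\<theta> $ s)\<bar>) = 0"
      by (intro antisym sum_nonneg)
    then have "2 - 2 * \<bar>cos (\<theta> $ s)\<bar> = 0" for s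
      using sum_nonneg_eq_0_iff[of UNIV "\<lambda>s. 2 - 2 * \<bar>cos (\<theta> $ s)\<bar>"] nonneg by simp
    then have "\<bar>cos (\<theta> $ s)\<bar> = 1" for s by (simp add: algebra_simps)
    then have "(cos (\<theta> $ s))\<^sup>2 = 1" for s by (metis power2_abs one_power2)
    then have sin: "sin (\<theta> $ s) = 0" for s using sin_cos_squared_add[of "\<theta> $ s"] by simp
    have "\<theta> $ s \<in> {0, pi}" for s
    proof (cases "\<theta> $ s = 0")
      case False
      then have "\<bar>\<theta> $ s - pi\<bar> < pi"
        using spec[OF \<theta>(1)[unfolded torus_def mem_Collect_eq], of s] by (simp add: abs_less_iff)
      then show ?thesis using sin_zero_pi_iff[of "\<theta> $ s - pi"] sin[of s] by (simp add: sin_diff)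
    qed simp
    then have "(\<lambda>s. \<theta> $ s) \<in> PiE UNIV (\<lambda>_. {0, pi})" by (simp add: PiE_iff)
    moreover have "\<theta> = vec_lambda (\<lambda>s. \<theta> $ s)" by simp
    ultimately show "\<theta> \<in> vec_lambda ` (PiE UNIV (\<lambda>_. {0, pi}))" by blast
  qed
qed

lemma flat_value_reindex:
  "(\<lambda>n. complex_of_real (2 + 2 * cos (pi * real n / real (N + 1)))) ` {1..N} = complex_of_real ` flat_value N ` {1..N}"
proof -
  have "flat_value N n = 2 + 2 * cos (pi * real (Suc N - n) / real (N + 1))" if "n \<in> {1..N}" for n
  proof -
    have "pi * real (Suc N - n) / real (N + 1) = pi - pi * real n / real (Suc N)"
      using that by (simp add: of_nat_diff field_simps)
    then show ?thesis by (simp add: flat_value_def del: of_nat_Suc)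
  qed
  then have "complex_of_real ` flat_value N ` {1..N}
    = (\<lambda>n. complex_of_real (2 + 2 * cos (pi * real n / real (N + 1)))) ` (\<lambda>n. Suc N - n) ` {1..N}"
    unfolding image_image by (intro image_cong) simp_all
  moreover have "(\<lambda>n. Suc N - n) ` {1..N} = {1..N}"
    by (rule endo_inj_surj) (auto simp: inj_on_def)
  ultimately show ?thesis by simp
qed

context subdivided_lattice_ge2
begin

context
  fixes vs assumes vs: "distinct vs" "set vs = fund_verts V"
begin

lemma floquet_eigenvalues_eq:
  "floquet_eigenvalues E vs \<theta> = repeat_mset (CARD('d) - 1) (image_mset (\<lambda>n. of_real (flat_value N n)) (mset_set {1..N}))
    + image_mset (\<lambda>k. of_real (roots.band_root k (lattice_symbol \<theta>))) (mset_set {..N})"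
proof -
  have nz: "(\<Prod>n\<in>{1..N}. [:- complex_of_real (flat_value N n), 1:]) ^ (CARD('d) - 1) \<noteq> 0"
    "(\<Prod>k\<le>N. [:- complex_of_real (roots.band_root k (lattice_symbol \<theta>)), 1:]) \<noteq> 0"
    by auto
  show ?thesis
    unfolding floquet_eigenvalues_def char_poly_floquet[OF vs] proots_mult[OF nz] proots_power
    by (simp only: proots_prod_linear finite_atLeastAtMost finite_atMost)
qed

text \<open>The path factors always give d - 1. A further copy requires a band root equal to the
  flat value, where |D| = 2d, and hence an extremal quasimomentum.\<close>

lemma has_flat_multiplicity:
  assumes m: "m \<in> {1..N}"
  shows "has_flat_multiplicity E vs (of_real (flat_value N m)) (CARD('d) - 1)"
  unfolding has_flat_multiplicity_def
proof (rule finite_subset[OF _ finite_extremal_quasimomenta]; clarify)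
  fix \<theta> :: "real ^ 'd" assume \<theta>: "count (floquet_eigenvalues E vs \<theta>) (of_real (flat_value N m)) \<noteq> CARD('d) - 1"
  have "image_mset (\<lambda>n. complex_of_real (flat_value N n)) (mset_set {1..N}) = mset_set ((\<lambda>n. complex_of_real (flat_value N n)) ` {1..N})"
    by (rule image_mset_mset_set[OF inj_complex_flat_value])
  then have "count (image_mset (\<lambda>n. complex_of_real (flat_value N n)) (mset_set {1..N})) (of_real (flat_value N m)) = 1"
    using m by (simp only: count_mset_set finite_imageI finite_atLeastAtMost image_eqI)
  with \<theta> have "count (image_mset (\<lambda>k. complex_of_real (roots.band_root k (lattice_symbol \<theta>))) (mset_set {..N})) (of_real (flat_value N m)) \<noteq> 0"
    unfolding floquet_eigenvalues_eq count_union count_repeat_mset by (simp only: mult_1_right add_cancel_left_right not_False_eq_True)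
  then have "complex_of_real (flat_value N m) \<in># image_mset (\<lambda>k. complex_of_real (roots.band_root k (lattice_symbol \<theta>))) (mset_set {..N})"
    by (simp only: count_eq_zero_iff not_not)
  then obtain k where k: "k \<le> N" "flat_value N m = roots.band_root k (lattice_symbol \<theta>)"
    by auto
  then have "poly D (flat_value N m) = lattice_symbol \<theta>"
    using roots.band_root[OF lattice_symbol_abs_le k(1)] by (simp add: D_def)
  then have "lattice_symbol \<theta> = 2 * real CARD('d) * (-1) ^ m"
    using discriminant_flat_value[of m N "CARD('d)"] m by (simp add: D_def)
  then show "\<bar>lattice_symbol \<theta>\<bar> = 2 * real CARD('d)" by (simp add: abs_mult)
qed

lemma flat_band_mset_eq:
  "flat_band_mset V E vs = repeat_mset (CARD('d) - 1) (image_mset (\<lambda>n. of_real (flat_value N n)) (mset_set {1..N}))"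
proof -
  have "flat_band_mset V E vs = (\<Sum>n\<in>{1..N}. replicate_mset (THE m. has_flat_multiplicity E vs (of_real (flat_value N n)) m) (of_real (flat_value N n)))"
    unfolding flat_band_mset_def flat_bands_eq image_image by (subst sum.reindex[OF inj_complex_flat_value]) (simp only: o_def)
  also have "\<dots> = (\<Sum>n\<in>{1..N}. replicate_mset (CARD('d) - 1) (of_real (flat_value N n)))"
    by (intro sum.cong refl) (simp only: flat_multiplicity_eqI[OF has_flat_multiplicity])
  finally show ?thesis
    by (simp only: sum_replicate_mset finite_atLeastAtMost)
qed

lemma num_bands_eq: "num_bands V E vs = N + 1"
proof -
  obtain k where "CARD('d) = Suc k" using card_ge2 by (cases "CARD('d)") auto
  then show ?thesis
    unfolding num_bands_def card_fund_verts flat_band_mset_eq by (simp add: mult.commute)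
qed

text \<open>Removing the flat part leaves the roots of D = c, with c the lattice symbol, already
  listed in increasing order window by window, so sorting is the identity. Bands are numbered from
  1, windows from 0.\<close>

lemma band_function_eq:
  assumes "n \<in> {1..N + 1}"
  shows "band_function V E vs n \<theta> = roots.band_root (n - 1) (lattice_symbol \<theta>)"
proof -
  let ?f = "\<lambda>k. roots.band_root k (lattice_symbol \<theta>)"
  have "image_mset Re (floquet_eigenvalues E vs \<theta> - flat_band_mset V E vs) = image_mset ?f (mset_set {..N})"
    unfolding floquet_eigenvalues_eq flat_band_mset_eq by (simp add: multiset.map_comp comp_def)
  also have "\<dots> = mset (map ?f [0..<Suc N])"
    by (simp only: mset_map mset_upt lessThan_Suc_atMost atLeast0LessThan)
  finally have "sorted_list_of_multiset (image_mset Re (floquet_eigenvalues E vs \<theta> - flat_band_mset V E vs)) = sort (map ?f [0..<Suc N])"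
    by (simp only: sorted_list_of_multiset_mset)
  also have "sort (map ?f [0..<Suc N]) = map ?f [0..<Suc N]"
  proof (rule sorted_sort_id)
    show "sorted (map ?f [0..<Suc N])"
      unfolding sorted_iff_nth_mono_less
      using roots.root_less[OF lattice_symbol_abs_le, of _ _ \<theta>] by (auto simp del: upt_Suc simp: less_imp_le)
  qed
  finally show ?thesis
    unfolding band_function_def using assms by (auto simp: nth_map simp del: upt_Suc)
qed

lemma spectral_band_eq:
  assumes "n \<in> {1..N + 1}"
  shows "spectral_band V E vs n = (\<lambda>c. roots.band_root (n - 1) c) ` {- 2 * real CARD('d)..2 * real CARD('d)}"
  unfolding spectral_band_def band_function_eq[OF assms] lattice_symbol_torus[symmetric] image_image ..

lemma spectral_band_interval:
  assumes "n \<in> {1..N + 1}"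
  shows "\<exists>a b. a < b \<and> spectral_band V E vs n = {a..b} \<and> (n \<le> N \<longrightarrow> b = flat_value N n)"
proof -
  obtain k where k: "n = Suc k" "k \<le> N" using assms by (cases n) auto
  show ?thesis
    using roots.band_interval[OF k(2)] unfolding spectral_band_eq[OF assms] by (simp add: k(1) Suc_le_eq)
qed

lemma Union_spectral_bands: "(\<Union>n\<in>{1..N + 1}. spectral_band V E vs n) = band_set CARD('d) N"
proof -
  have "(\<Union>n\<in>{1..N + 1}. spectral_band V E vs n) = (\<Union>n\<in>Suc ` {..N}. spectral_band V E vs n)"
    by (simp add: image_Suc_atMost)
  also have "\<dots> = (\<Union>k\<le>N. (\<lambda>c. roots.band_root k c) ` {- 2 * real CARD('d)..2 * real CARD('d)})"
    by (simp add: spectral_band_eq)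
  finally show ?thesis
    unfolding roots.bands_eq band_set_def .
qed

end

end

theorem proposition7p3:
  fixes N :: nat and t :: "'d::finite \<Rightarrow> nat \<Rightarrow> real"
    and V :: "(real ^ 'd) set" and E :: "(real ^ 'd) set set"
  assumes d: "CARD('d) \<ge> 2" and N: "N \<ge> 1"
    and t: "edge_parameters N t"
    and V: "V = subdiv_verts N t" and E: "E = subdiv_edges N t"
  shows "card (fund_verts V) = CARD('d) * N + 1 \<and>
    op_spectrum V (laplacian E) = ac_spectrum V (laplacian E) \<union> flat_bands V (laplacian E) \<and>
    flat_bands V (laplacian E)
      = (\<lambda>n. complex_of_real (2 + 2 * cos (pi * real n / real (N + 1)))) ` {1..N} \<and>
    (\<forall>vs. distinct vs \<and> set vs = fund_verts V \<longrightarrow>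
           num_bands V E vs = N + 1 \<and>
           (\<forall>n\<in>{1..N + 1}. \<exists>a b. a < b \<and> spectral_band V E vs n = {a..b}) \<and>
           ac_spectrum V (laplacian E)
             = complex_of_real ` (\<Union>n\<in>{1..N + 1}. spectral_band V E vs n) \<and>
           (\<forall>\<mu> \<in> flat_bands V (laplacian E).
              has_flat_multiplicity E vs \<mu> (CARD('d) - 1) \<and>
              (\<exists>n\<in>{1..N + 1}. \<exists>a b. spectral_band V E vs n = {a..b} \<and> a < b \<and>
                 (\<mu> = complex_of_real a \<or> \<mu> = complex_of_real b))))"
proof -
  interpret G: subdivided_lattice_ge2 N t "discriminant CARD('d) N"
    by unfold_locales (use d N t in auto)
  show ?thesis
    unfolding V E
  proof (intro conjI allI impI ballI)
    show "op_spectrum (subdiv_verts N t) (laplacian (subdiv_edges N t))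
      = ac_spectrum (subdiv_verts N t) (laplacian (subdiv_edges N t)) \<union> flat_bands (subdiv_verts N t) (laplacian (subdiv_edges N t))"
      unfolding G.op_spectrum_eq G.ac_spectrum_eq G.flat_bands_eq
      \<comment> \<open>The flat values lie in the bands, so the union with them does not enlarge
        the set.\<close>
      using G.flat_subset_bands by auto
    show "flat_bands (subdiv_verts N t) (laplacian (subdiv_edges N t))
      = (\<lambda>n. complex_of_real (2 + 2 * cos (pi * real n / real (N + 1)))) ` {1..N}"
      unfolding G.flat_bands_eq flat_value_reindex ..
    show "card (fund_verts (subdiv_verts N t)) = CARD('d) * N + 1"
      by (rule G.card_fund_verts)
  next
    fix vs assume "distinct vs \<and> set vs = fund_verts (subdiv_verts N t)"
    then have vs: "distinct vs" "set vs = fund_verts (subdiv_verts N t)" by auto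
    show "num_bands (subdiv_verts N t) (subdiv_edges N t) vs = N + 1"
      by (rule G.num_bands_eq[OF vs])
    show "ac_spectrum (subdiv_verts N t) (laplacian (subdiv_edges N t))
      = complex_of_real ` (\<Union>n\<in>{1..N + 1}. spectral_band (subdiv_verts N t) (subdiv_edges N t) vs n)"
      unfolding G.Union_spectral_bands[OF vs] by (rule G.ac_spectrum_eq)
    show "\<exists>a b. a < b \<and> spectral_band (subdiv_verts N t) (subdiv_edges N t) vs n = {a..b}"
      if "n \<in> {1..N + 1}" for n
      using G.spectral_band_interval[OF vs that] by blast
    fix \<mu> assume "\<mu> \<in> flat_bands (subdiv_verts N t) (laplacian (subdiv_edges N t))"
    then obtain n where n: "n \<in> {1..N}" "\<mu> = of_real (flat_value N n)"
      unfolding G.flat_bands_eq by blast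
    show "has_flat_multiplicity (subdiv_edges N t) vs \<mu> (CARD('d) - 1)"
      unfolding n(2) by (rule G.has_flat_multiplicity[OF vs n(1)])
    have "n \<in> {1..N + 1}" using n(1) by auto
    \<comment> \<open>The n-th flat value is the upper end of the n-th band, so the same n is the
      witness.\<close>
    then show "\<exists>n\<in>{1..N + 1}. \<exists>a b. spectral_band (subdiv_verts N t) (subdiv_edges N t) vs n = {a..b} \<and> a < b \<and>
        (\<mu> = complex_of_real a \<or> \<mu> = complex_of_real b)"
      using G.spectral_band_interval[OF vs, of n] n by (intro bexI[of _ n]) auto
  qed
qed

end
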